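(* Let $s$ be a positive integer. The knots of the family $\big(P(-(2s+1),\,2s+1,\,2i+1)\big)_{i>s}$ ($i$ an integer) all have the same Alexander polynomial, namely $s(s+1)t^2-(2s(s+1)+1)t+s(s+1)$ (up to multiplication by units $\pm t^n$ of $\mathbb{Z}[t,t^{-1}]$). Furthermore, setting $i_{k,s}=(2k-1)s+k-1$ for each positive integer $k$, the knots $\big(P(-(2s+1),\,2s+1,\,2i_{k,s}+1)\big)_{k\in\mathbb{Z}^+}$ all have the same sequence of elementary ideals.
   Context: Knots are in $S^3$. For odd integers $p,q,r$, the pretzel knot $P(p,q,r)$ is the boundary of the surface formed by two disjoint disks, one above the other, joined by three vertical bands placed side by side, having respectively $|p|,|q|,|r|$ half-twists; the handedness of the half-twists in each band is determined by the sign of the corresponding integer (the same handedness for all positive entries, the opposite one for all negative entries). Since $p,q,r$ are odd, this surface is orientable and its boundary is a knot; the knot is oriented as the boundary of this surface (so the two strands of each column run antiparallel), and the sign convention is that crossings in a column with a positive entry are negative crossings and crossings in a column with a negative entry are positive crossings. The Alexander module of a knot $K$ is the first homology of the infinite cyclic cover of its complement, as a module over $\mathbb{Z}[t,t^{-1}]$; if $A$ is an $n\times n$ Seifert matrix of $K$, the module is presented by the $n\times n$ matrix $tA-A^{T}$. For $r\ge 1$, the $r$-th elementary ideal of $K$ is the ideal of $\mathbb{Z}[t,t^{-1}]$ generated by the $(n-r+1)\times(n-r+1)$ minors of such a presentation matrix (the whole ring if $r>n$); it does not depend on the presentation. The Alexander polynomial is a generator of the first elementary ideal, i.e. $\det(tA-A^T)$,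 and is defined up to multiplication by $\pm t^n$. *)

theory Defs
  imports
    "HOL-Analysis.Cross3"
    "HOL-Library.Poly_Mapping"
    "Jordan_Normal_Form.Determinant"
    "Jordan_Normal_Form.DL_Submatrix"
begin

text \<open>
  Everything is piecewise linear in \<open>\<real>\<^sup>3\<close>, that is, in \<open>S\<^sup>3\<close> minus a point. An oriented surface is
  given by a set of oriented triangles; the cyclic order of the vertices of \<open>(a, b, c)\<close> orients
  the triangle, its positive side being the one to which \<open>(b - a) \<times> (c - a)\<close> points. An oriented
  polygonal link is given by its set of directed edges.
\<close>

type_synonym point = "real^3"
type_synonym triangle = "point \<times> point \<times> point"
type_synonym edge = "point \<times> point"


section \<open>Oriented surfaces\<close>

fun verts :: "triangle \<Rightarrow> point set" where
  "verts (a, b, c) = {a, b, c}"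

fun directed_edges :: "triangle \<Rightarrow> edge set" where
  "directed_edges (a, b, c) = {(a, b), (b, c), (c, a)}"

fun normal :: "triangle \<Rightarrow> point" where
  "normal (a, b, c) = cross3 (b - a) (c - a)"

definition vertices :: "triangle set \<Rightarrow> point set" where
  "vertices T = (\<Union>t\<in>T. verts t)"

definition surface_edges :: "triangle set \<Rightarrow> edge set" where
  "surface_edges T = (\<Union>t\<in>T. directed_edges t \<union> (directed_edges t)\<inverse>)"

definition surface_boundary :: "triangle set \<Rightarrow> edge set" where
  "surface_boundary T = {(a, b). (a, b) \<in> \<Union> (directed_edges ` T) \<and> (b, a) \<notin> \<Union> (directed_edges ` T)}"

text \<open>
  In \<open>oriented_surface\<close>, the third line says that the triangles form an embedded simplicial complex.
  The fourth says that an edge lies in at most two triangles, which then induce opposite directions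
  on it. The fifth says that the triangles around a vertex are linked to each other through common
  edges at that vertex, so that the link of a vertex is an arc or a circle. The last one is
  connectedness.
\<close>

definition oriented_surface :: "triangle set \<Rightarrow> bool" where
  "oriented_surface T \<longleftrightarrow>
     finite T \<and> T \<noteq> {} \<and>
     (\<forall>t\<in>T. normal t \<noteq> 0) \<and> inj_on verts T \<and>
     (\<forall>t\<in>T. \<forall>t'\<in>T. convex hull (verts t) \<inter> convex hull (verts t') = convex hull (verts t \<inter> verts t')) \<and>
     (\<forall>t\<in>T. \<forall>t'\<in>T. t \<noteq> t' \<longrightarrow> directed_edges t \<inter> directed_edges t' = {}) \<and>
     (\<forall>v. \<forall>t\<in>T. \<forall>t'\<in>T. v \<in> verts t \<inter> verts t' \<longrightarrow>
        (t, t') \<in> {(u, u'). u \<in> T \<and> u' \<in> T \<and> v \<in> verts u \<inter> verts u' \<and> card (verts u \<inter> verts u') \<ge> 2}\<^sup>*) \<and>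
     (\<forall>t\<in>T. \<forall>t'\<in>T. (t, t') \<in> {(u, u'). u \<in> T \<and> u' \<in> T \<and> verts u \<inter> verts u' \<noteq> {}}\<^sup>*)"

definition seifert_surface :: "triangle set \<Rightarrow> edge set \<Rightarrow> bool" where
  "seifert_surface T K \<longleftrightarrow> oriented_surface T \<and> surface_boundary T = K"

text \<open>
  \<open>\<nu>\<close> describes a motion of the surface off itself to its positive side: at time \<open>\<delta>\<close> each vertex
  \<open>v\<close> has moved to \<open>v + \<delta> \<nu>(v)\<close>, and the motion is extended linearly over the triangles. A curve
  \<open>c\<close> on the surface is thus carried to \<open>c\<^sup>+\<close> at time \<open>1\<close>, never meeting the surface at positive times.
\<close>

definition positive_pushoff :: "triangle set \<Rightarrow> (point \<Rightarrow> point) \<Rightarrow> bool" where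
  "positive_pushoff T \<nu> \<longleftrightarrow>
     (\<forall>t\<in>T. \<forall>v\<in>verts t. inner (\<nu> v) (normal t) > 0) \<and>
     (\<forall>\<delta>\<in>{0<..1}. (\<Union>t\<in>T. convex hull ((\<lambda>v. v + \<delta> *\<^sub>R \<nu> v) ` verts t)) \<inter>
                    (\<Union>t\<in>T. convex hull (verts t)) = {})"


section \<open>First homology of a surface\<close>

definition closed_edges :: "'a list \<Rightarrow> ('a \<times> 'a) list" where
  "closed_edges l = zip l (rotate1 l)"

text \<open>A simplicial 1-chain is an antisymmetric integer function on directed edges.\<close>

definition loop_chain :: "point list \<Rightarrow> edge \<Rightarrow> int" where
  "loop_chain l = (\<lambda>(a, b). int (count_list (closed_edges l) (a, b)) - int (count_list (closed_edges l) (b, a)))"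

definition one_cycles :: "triangle set \<Rightarrow> (edge \<Rightarrow> int) set" where
  "one_cycles T = {z. (\<forall>a b. z (b, a) = - z (a, b)) \<and> (\<forall>e. e \<notin> surface_edges T \<longrightarrow> z e = 0) \<and>
                      (\<forall>a. (\<Sum>b\<in>vertices T. z (a, b)) = 0)}"

definition one_boundaries :: "triangle set \<Rightarrow> (edge \<Rightarrow> int) set" where
  "one_boundaries T =
     {z. \<exists>x. z = (\<lambda>(a, b). \<Sum>t\<in>T. x t * (of_bool ((a, b) \<in> directed_edges t) - of_bool ((b, a) \<in> directed_edges t)))}"

text \<open>The closed edge paths \<open>c 0, \<dots>, c (n - 1)\<close> represent a basis of \<open>H\<^sub>1(T; \<int>)\<close>.\<close>

definition homology_basis :: "triangle set \<Rightarrow> nat \<Rightarrow> (nat \<Rightarrow> point list) \<Rightarrow> bool" where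
  "homology_basis T n c \<longleftrightarrow>
     (\<forall>i<n. set (closed_edges (c i)) \<subseteq> surface_edges T) \<and>
     (\<forall>z\<in>one_cycles T. \<exists>!m :: nat \<Rightarrow> int.
        (\<forall>i\<ge>n. m i = 0) \<and> (\<lambda>e. z e - (\<Sum>i<n. m i * loop_chain (c i) e)) \<in> one_boundaries T)"


section \<open>Linking numbers\<close>

text \<open>
  The closed polygons are projected along \<open>u\<close>, with the viewer on the side to which \<open>u\<close> points.
  \<open>crosses_over u e f\<close> means that \<open>e\<close> passes over \<open>f\<close>; the crossing is then positive iff
  \<open>(e, f, u)\<close> is a positively oriented basis, i.e. iff the shortest turn from the direction of \<open>e\<close>
  to that of \<open>f\<close> is counterclockwise. The linking number is the sum of the signs of the crossings
  at which the first polygon is over the second one, for any direction \<open>u\<close> in general position;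
  it does not depend on that direction.
\<close>

fun crosses_over :: "point \<Rightarrow> edge \<Rightarrow> edge \<Rightarrow> bool" where
  "crosses_over u (a, b) (c, d) \<longleftrightarrow>
     (\<exists>x\<in>open_segment a b. \<exists>y\<in>open_segment c d. \<exists>\<tau>>0. x - y = \<tau> *\<^sub>R u)"

fun crossing_sign :: "point \<Rightarrow> edge \<Rightarrow> edge \<Rightarrow> int" where
  "crossing_sign u (a, b) (c, d) =
     (let D = inner (cross3 (b - a) (d - c)) u in if D > 0 then 1 else if D < 0 then -1 else 0)"

fun general_position :: "point \<Rightarrow> edge \<Rightarrow> edge \<Rightarrow> bool" where
  "general_position u (a, b) (c, d) \<longleftrightarrow>
     (\<forall>x\<in>closed_segment a b. \<forall>y\<in>closed_segment c d. \<forall>\<tau>. x - y = \<tau> *\<^sub>R u \<longrightarrow>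
        x \<in> open_segment a b \<and> y \<in> open_segment c d \<and> \<tau> \<noteq> 0 \<and>
        inner (cross3 (b - a) (d - c)) u \<noteq> 0)"

definition has_linking_number :: "point list \<Rightarrow> point list \<Rightarrow> int \<Rightarrow> bool" where
  "has_linking_number l l' k \<longleftrightarrow>
     (\<exists>u. u \<noteq> 0 \<and>
       (\<forall>e\<in>set (closed_edges l). \<forall>f\<in>set (closed_edges l'). general_position u e f) \<and>
       k = (\<Sum>e\<leftarrow>closed_edges l. \<Sum>f\<leftarrow>closed_edges l'.
              if crosses_over u e f then crossing_sign u e f else 0))"


section \<open>Seifert matrices, Alexander polynomial, elementary ideals\<close>

definition seifert_matrix :: "edge set \<Rightarrow> nat \<Rightarrow> int mat \<Rightarrow> bool" where
  "seifert_matrix K n A \<longleftrightarrow> A \<in> carrier_mat n n \<and>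
     (\<exists>T \<nu> c. seifert_surface T K \<and> positive_pushoff T \<nu> \<and> homology_basis T n c \<and>
        (\<forall>i<n. \<forall>j<n. has_linking_number (c i) (map (\<lambda>v. v + \<nu> v) (c j)) (A $$ (i, j))))"

text \<open>
  \<open>\<int>[t, t\<^sup>-\<^sup>1]\<close> is the group ring of \<open>\<int>\<close>; \<open>Poly_Mapping.single n a\<close> is the term \<open>a t\<^sup>n\<close>.
\<close>

type_synonym laurent = "int \<Rightarrow>\<^sub>0 int"

definition alexander_matrix :: "int mat \<Rightarrow> laurent mat" where
  "alexander_matrix A =
     map_mat (Poly_Mapping.single 1) A - map_mat (Poly_Mapping.single 0) (transpose_mat A)"

definition ideal_generated :: "'a::comm_ring_1 set \<Rightarrow> 'a set" where
  "ideal_generated S = module.span (*) S"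

definition minors :: "'a::comm_ring_1 mat \<Rightarrow> nat \<Rightarrow> 'a set" where
  "minors M k = {Determinant.det (submatrix M I J) | I J.
     I \<subseteq> {..<dim_row M} \<and> J \<subseteq> {..<dim_col M} \<and> card I = k \<and> card J = k}"

definition elementary_ideal :: "'a::comm_ring_1 mat \<Rightarrow> nat \<Rightarrow> 'a set" where
  "elementary_ideal M r = (if r > dim_row M then UNIV else ideal_generated (minors M (dim_row M - r + 1)))"

text \<open>
  Seifert matrices of a knot are not unique, but the ideals below do not depend on the choice of the
  Seifert matrix, and the polynomial depends on it only up to units.
\<close>

definition is_alexander_polynomial :: "edge set \<Rightarrow> laurent \<Rightarrow> bool" where
  "is_alexander_polynomial K f \<longleftrightarrow>
     (\<exists>n A \<epsilon> m. seifert_matrix K n A \<and> \<epsilon> \<in> {1, -1} \<and>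
        f = Poly_Mapping.single m \<epsilon> * Determinant.det (alexander_matrix A))"

definition has_elementary_ideals :: "edge set \<Rightarrow> (nat \<Rightarrow> laurent set) \<Rightarrow> bool" where
  "has_elementary_ideals K I \<longleftrightarrow>
     (\<exists>n A. seifert_matrix K n A \<and> (\<forall>r\<ge>1. I r = elementary_ideal (alexander_matrix A) r))"


section \<open>Pretzel knots\<close>

text \<open>
  The picture is seen from the side of negative second coordinates: the first coordinate increases
  to the right, the third one upwards, and the second one away from the viewer. The two disks lie
  in the plane of the picture.

  The band with \<open>\<bar>h\<bar>\<close> half-twists around the vertical axis through \<open>(x, 0, 0)\<close> is swept out by a
  segment rising from height 0 to height 1 and making \<open>2 \<bar>h\<bar>\<close> quarter turns, which are
  counterclockwise seen from above for \<open>h > 0\<close>; \<open>band_point x h \<epsilon> m\<close> with \<open>\<epsilon> = \<plusminus>1\<close> are the endpoints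
  of the segment after \<open>m\<close> quarter turns. For \<open>h > 0\<close> the edges of the band are right-handed
  helices, so that the crossings of these two (antiparallel) strands are negative.
\<close>

definition band_point :: "real \<Rightarrow> int \<Rightarrow> real \<Rightarrow> nat \<Rightarrow> point" where
  "band_point x h \<epsilon> m = (let \<theta> = of_int (sgn h) * real m * pi / 2 in
     vector [x + \<epsilon> * cos \<theta>, \<epsilon> * sin \<theta>, real m / (2 * \<bar>of_int h\<bar>)])"

definition band :: "real \<Rightarrow> int \<Rightarrow> triangle set" where
  "band x h = (let L = band_point x h (-1); R = band_point x h 1 in
     (\<Union>m\<in>{..<nat (2 * \<bar>h\<bar>)}. {(L m, R m, R (Suc m)), (L m, R (Suc m), L (Suc m))}))"

text \<open>
  A disk is a triangle with apex \<open>(3, 0, a)\<close> and base from \<open>(-1, 0, z)\<close> to \<open>(7, 0, z)\<close>, subdivided so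
  that the ends of the three bands, around the axes \<open>x = 0, 3, 6\<close>, are edges. The bottom disk
  (\<open>a < z\<close>) has its positive side towards the viewer, the top disk (\<open>a > z\<close>) away from the viewer,
  in accordance with the odd numbers of half-twists.
\<close>

definition disk :: "real \<Rightarrow> real \<Rightarrow> triangle set" where
  "disk z a = (\<lambda>(x, x'). (vector [x', 0, z], vector [x, 0, z], vector [3, 0, a])) `
     {(-1, 1), (1, 2), (2, 4), (4, 5), (5, 7)}"

definition pretzel_surface :: "int \<Rightarrow> int \<Rightarrow> int \<Rightarrow> triangle set" where
  "pretzel_surface p q r = disk 0 (-1) \<union> disk 1 2 \<union> band 0 p \<union> band 3 q \<union> band 6 r"

definition pretzel_knot :: "int \<Rightarrow> int \<Rightarrow> int \<Rightarrow> edge set" where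
  "pretzel_knot p q r = surface_boundary (pretzel_surface p q r)"

end

theory Submission
  imports Defs "HOL-Analysis.Polytope"
begin

text \<open>
  The surface \<open>pretzel_surface p q r\<close> itself is used as Seifert surface, with a horizontal push-off, and
  the two loops that run up the first or second band and down the next one as basis of its homology. In
  the projection along the second coordinate, the contribution of each band to the linking numbers
  is local to its layers, which gives the Seifert matrix \<open>((p + q)/2, -(q - 1)/2; -(q + 1)/2, (q + r)/2)\<close>.
  For \<open>p = -q\<close> the upper left entry vanishes, so that \<open>r\<close> does not enter the determinant of \<open>t A - A\<^sup>T\<close>. With
  \<open>q = 2 s + 1\<close>, the off-diagonal entries of that matrix generate an ideal containing
  \<open>(2 s + 1) (t - 1)\<close>, and the remaining entry \<open>(t - 1) (q + r)/2\<close> is a multiple of it for \<open>r = 2 i\<^bsub>k,s\<^esub> + 1\<close>.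
\<close>

section \<open>Convex hulls separated by planes\<close>

text \<open>The definitions ask for an embedded triangulated surface and for a push-off that avoids
  it at all positive times, so pairs of triangles have to be compared although the number of layers
  is arbitrary. This becomes finite because the vertices of a band are quarter turns: in every layer
  cosine and sine form one of four pairs, and each type of pair of triangles has an explicit affine
  function that separates it. A loop is the difference of two strands, that is, of paths from the
  bottom apex to the top apex, and signed crossings are additive. The strands pair with the pushed
  strands to \<open>(h j + 1)/2\<close> on the diagonal, 1 above it and 0 below it; the alternating
  sums of these numbers form the Seifert matrix, which explains its asymmetry. A 1-cycle is measured
  by its flow through the bands. The three flows add up to 0, and a cycle without flow is filled
  explicitly, so the homology has rank 2. The indices in the second claim are the solutions
  \<open>i\<close> of \<open>s + i + 1 = k (2 s + 1)\<close>, that is, of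
  \<open>(q + r)/2 = k q\<close>.\<close>

lemma convex_hull_Int_hyperplane_subset:
  fixes A :: "'a::euclidean_space set"
  assumes "finite A" "\<And>v. v \<in> A \<Longrightarrow> inner n v \<le> c"
  shows "convex hull A \<inter> {x. inner n x = c} \<subseteq> convex hull (A \<inter> {x. inner n x = c})"
proof -
  have le: "convex hull A \<subseteq> {x. inner n x \<le> c}"
    using assms(2) by (intro hull_minimal) (auto simp: convex_halfspace_le)
  \<comment> \<open>The hyperplane supports the hull, so it cuts out a face, and a face of a
    polytope is spanned by some of the generating points.\<close>
  have "(convex hull A \<inter> {x. inner n x = c}) face_of convex hull A"
    using le by (intro face_of_Int_supporting_hyperplane_le) auto
  then obtain S where S: "S \<subseteq> A" "convex hull A \<inter> {x. inner n x = c} = convex hull S"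
    using face_of_convex_hull_subset[OF finite_imp_compact[OF assms(1)]] by metis
  have "S \<subseteq> A \<inter> {x. inner n x = c}"
    using S hull_subset[of S convex] by blast
  thus ?thesis using S by (simp add: hull_mono)
qed

text \<open>The hulls lie on opposite sides of the hyperplane, so they meet inside it, where each
  reduces to the points it has there. \<open>A'\<close> and \<open>B'\<close> may be any sets
  containing those points; in applications they are candidates for a common face.\<close>

lemma convex_hulls_Int_subset_at_level:
  fixes A B :: "'a::euclidean_space set"
  assumes "finite A" "finite B"
    and A: "\<And>v. v \<in> A \<Longrightarrow> inner n v \<le> c \<and> (inner n v = c \<longrightarrow> v \<in> A')"
    and B: "\<And>v. v \<in> B \<Longrightarrow> c \<le> inner n v \<and> (inner n v = c \<longrightarrow> v \<in> B')"
  shows "convex hull A \<inter> convex hull B \<subseteq> convex hull A' \<inter> convex hull B'"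
proof -
  have leA: "convex hull A \<subseteq> {x. inner n x \<le> c}"
    using A by (intro hull_minimal) (auto simp: convex_halfspace_le)
  have leB: "convex hull B \<subseteq> {x. inner n x \<ge> c}"
    using B by (intro hull_minimal) (auto simp: convex_halfspace_ge)
  have sub: "convex hull A \<inter> convex hull B \<subseteq> {x. inner n x = c}"
    using leA leB by fastforce
  have "convex hull A \<inter> {x. inner n x = c} \<subseteq> convex hull A'"
    using convex_hull_Int_hyperplane_subset[OF assms(1), of n c] A
      hull_mono[of "A \<inter> {x. inner n x = c}" A' convex] by fastforce
  moreover have "convex hull B \<inter> {x. inner n x = c} \<subseteq> convex hull B'"
    using convex_hull_Int_hyperplane_subset[OF assms(2), of "-n" "-c"] B
      hull_mono[of "B \<inter> {x. inner n x = c}" B' convex] by fastforce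
  ultimately show ?thesis using sub by blast
qed

text \<open>One inequality is strict and the other weak because the separating plane may contain a
  triangle of the surface while the push-off stays strictly on one side.\<close>

lemma convex_hulls_disjoint:
  fixes A B :: "'a::euclidean_space set"
  assumes "\<And>v. v \<in> A \<Longrightarrow> inner n v < c" "\<And>v. v \<in> B \<Longrightarrow> c \<le> inner n v"
  shows "convex hull A \<inter> convex hull B = {}"
proof -
  have "convex hull A \<subseteq> {x. inner n x < c}"
    using assms by (intro hull_minimal) (auto simp: convex_halfspace_lt)
  moreover have "convex hull B \<subseteq> {x. inner n x \<ge> c}"
    using assms by (intro hull_minimal) (auto simp: convex_halfspace_ge)
  ultimately show ?thesis by fastforce
qed

lemma convex_hulls_Int_subset_doubleton:
  assumes "A \<subseteq> {x, y}" "B \<subseteq> {x, y :: 'a::euclidean_space}"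
  shows "convex hull A \<inter> convex hull B \<subseteq> convex hull (A \<inter> B)"
proof (rule convex_hull_Int_subset)
  show "\<not> affine_dependent (A \<union> B)"
    by (rule affine_independent_subset[OF affine_independent_2[of x y]]) (use assms in auto)
qed

abbreviation vec3 :: "real \<Rightarrow> real \<Rightarrow> real \<Rightarrow> point" where
  "vec3 x y z \<equiv> vector [x, y, z]"

abbreviation cx :: "point \<Rightarrow> real" where "cx v \<equiv> Finite_Cartesian_Product.vec_nth v 1"
abbreviation cy :: "point \<Rightarrow> real" where "cy v \<equiv> Finite_Cartesian_Product.vec_nth v 2"
abbreviation cz :: "point \<Rightarrow> real" where "cz v \<equiv> Finite_Cartesian_Product.vec_nth v 3"

lemma vec3_eq_iff [simp]: "vec3 x y z = vec3 x' y' z' \<longleftrightarrow> x = x' \<and> y = y' \<and> z = z'"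
  by (simp add: Finite_Cartesian_Product.vec_eq_iff forall_3)

lemma point_eq_iff: "v = w \<longleftrightarrow> cx v = cx w \<and> cy v = cy w \<and> cz v = cz w"
  by (simp add: Finite_Cartesian_Product.vec_eq_iff forall_3)

lemma inner_coords: "inner v w = cx v * cx w + cy v * cy w + cz v * cz w"
  by (simp add: inner_vec_def sum_3)

lemma cross3_coords:
  "cx (cross3 v w) = cy v * cz w - cz v * cy w"
  "cy (cross3 v w) = cz v * cx w - cx v * cz w"
  "cz (cross3 v w) = cx v * cy w - cy v * cx w"
  by (simp_all add: cross3_def)

section \<open>The triangulated surface\<close>

definition qcos :: "nat \<Rightarrow> real" where "qcos m = cos (real m * pi / 2)"
definition qsin :: "nat \<Rightarrow> real" where "qsin m = sin (real m * pi / 2)"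

lemma qcos_qsin_Suc [simp]: "qcos (Suc m) = - qsin m" "qsin (Suc m) = qcos m"
  by (simp_all add: qcos_def qsin_def add_divide_distrib distrib_right cos_add sin_add)

lemma qcos_qsin_0 [simp]: "qcos 0 = 1" "qsin 0 = 0"
  by (simp_all add: qcos_def qsin_def)

text \<open>Quarter turns permute these four pairs, which turns metric statements about a layer into
  four arithmetic ones.\<close>

lemma qcos_qsin_cases:
  obtains (0) "qcos m = 1" "qsin m = 0" | (1) "qcos m = 0" "qsin m = 1"
    | (2) "qcos m = -1" "qsin m = 0" | (3) "qcos m = 0" "qsin m = -1"
proof -
  have "(qcos m = 1 \<and> qsin m = 0) \<or> (qcos m = 0 \<and> qsin m = 1) \<or> (qcos m = -1 \<and> qsin m = 0)
     \<or> (qcos m = 0 \<and> qsin m = -1)"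
    by (induction m) auto
  thus ?thesis using that by blast
qed

text \<open>The half-twists are given for all natural indices so that formulas can mention
  \<open>Suc j\<close> freely; \<open>T\<close> contains only the bands 0, 1, 2.\<close>

locale pretzel =
  fixes h :: "nat \<Rightarrow> int"
  assumes odd_h: "odd (h j)"
begin

definition N :: "nat \<Rightarrow> nat" where "N j = nat (2 * \<bar>h j\<bar>)"

definition sg :: "nat \<Rightarrow> real" where "sg j = of_int (sgn (h j))"

definition L :: "nat \<Rightarrow> nat \<Rightarrow> point" where
  "L j m = vec3 (3 * real j - qcos m) (- (sg j * qsin m)) (real m / real (N j))"

definition R :: "nat \<Rightarrow> nat \<Rightarrow> point" where
  "R j m = vec3 (3 * real j + qcos m) (sg j * qsin m) (real m / real (N j))"

lemma LR_coords [simp]: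
  "cx (L j m) = 3 * real j - qcos m" "cy (L j m) = - (sg j * qsin m)" "cz (L j m) = real m / real (N j)"
  "cx (R j m) = 3 * real j + qcos m" "cy (R j m) = sg j * qsin m" "cz (R j m) = real m / real (N j)"
  by (simp_all add: L_def R_def)

lemma h_nz: "h j \<noteq> 0"
  using odd_h[of j] by auto

lemma N_pos [simp]: "N j > 0"
  using h_nz[of j] by (simp add: N_def)

lemma N_nz [simp]: "N j \<noteq> 0"
  using N_pos[of j] by simp

lemma sg_cases: obtains (pos) "sg j = 1" | (neg) "sg j = -1"
proof -
  have "sg j = 1 \<or> sg j = -1" using h_nz[of j] by (simp add: sg_def sgn_if)
  thus ?thesis using that by blast
qed

lemma sg_nz [simp]: "sg j \<noteq> 0"
  by (cases rule: sg_cases[of j]) auto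

lemma N_eq: "real (N j) = 2 * \<bar>real_of_int (h j)\<bar>"
  by (simp add: N_def)

lemma band_point_eq:
  "band_point (3 * real j) (h j) (-1) m = L j m"
  "band_point (3 * real j) (h j) 1 m = R j m"
proof -
  have "cos (real_of_int (sgn (h j)) * real m * pi / 2) = qcos m"
    using h_nz[of j] by (auto simp: sgn_if qcos_def)
  moreover have "sin (real_of_int (sgn (h j)) * real m * pi / 2) = sg j * qsin m"
    using h_nz[of j] by (auto simp: sgn_if qsin_def sg_def)
  ultimately show "band_point (3 * real j) (h j) (-1) m = L j m"
    "band_point (3 * real j) (h j) 1 m = R j m"
    by (simp_all add: band_point_def L_def R_def Let_def N_eq)
qed

lemma qcos_qsin_N: "qcos (N j) = -1" "qsin (N j) = 0"
proof -
  have eq: "real (N j) * pi / 2 = real (nat \<bar>h j\<bar>) * pi"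
    by (simp add: N_def)
  have "odd (nat \<bar>h j\<bar>)" using odd_h[of j] by (simp add: even_nat_iff)
  thus "qcos (N j) = -1" "qsin (N j) = 0"
    unfolding qcos_def qsin_def eq by (simp_all only: cos_npi sin_npi) simp
qed

definition A :: "nat \<Rightarrow> nat \<Rightarrow> triangle" where "A j m = (L j m, R j m, R j (Suc m))"
definition B :: "nat \<Rightarrow> nat \<Rightarrow> triangle" where "B j m = (L j m, R j (Suc m), L j (Suc m))"

text \<open>Heights \<open>0\<close> and \<open>1\<close> stand for the bottom and the top disk: \<open>dv z k\<close> are the six points on the
  base of the disk at height \<open>z\<close>, from left to right, and \<open>ap z\<close> is its apex.\<close>

definition xk :: "nat \<Rightarrow> real" where "xk k = 3 * real (k div 2) + (if even k then -1 else 1)"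

definition dv :: "real \<Rightarrow> nat \<Rightarrow> point" where "dv z k = vec3 (xk k) 0 z"
definition ap :: "real \<Rightarrow> point" where "ap z = vec3 3 0 (3 * z - 1)"
definition D :: "real \<Rightarrow> nat \<Rightarrow> triangle" where "D z k = (dv z (Suc k), dv z k, ap z)"

definition T :: "triangle set" where "T = pretzel_surface (h 0) (h 1) (h 2)"

lemma disk_coords [simp]:
  "cx (dv z k) = xk k" "cy (dv z k) = 0" "cz (dv z k) = z"
  "cx (ap z) = 3" "cy (ap z) = 0" "cz (ap z) = 3 * z - 1"
  by (simp_all add: dv_def ap_def)

lemma band_eq: "band (3 * real j) (h j) = (\<Union>m<N j. {A j m, B j m})"
  unfolding band_def by (simp add: band_point_eq A_def B_def N_def)

lemma xk_0 [simp]: "xk 0 = -1" by (simp add: xk_def)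
lemma xk_numeral:
  "xk 1 = 1" "xk (Suc 0) = 1" "xk 2 = 2" "xk 3 = 4" "xk 4 = 5" "xk 5 = 7" by (simp_all add: xk_def)

text \<open>\<open>3 * z - 1\<close> interpolates the apex heights: -1 for \<open>z = 0\<close> and
  2 for \<open>z = 1\<close>.\<close>

lemma disk_eq: "disk z (3 * z - 1) = D z ` {..<5}"
proof -
  have "{..<5::nat} = {0,1,2,3,4}" by auto
  thus ?thesis by (simp add: disk_def D_def dv_def ap_def xk_numeral eval_nat_numeral(3)[symmetric])
     (simp add: eval_nat_numeral xk_def)
qed

lemma T_eq: "T = D 0 ` {..<5} \<union> D 1 ` {..<5} \<union> (\<Union>j<3. \<Union>m<N j. {A j m, B j m})"
proof -
  have 3: "{..<3::nat} = {0,1,2}" by auto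
  have "disk 0 (-1) = D 0 ` {..<5}" "disk 1 2 = D 1 ` {..<5}"
    using disk_eq[of 0] disk_eq[of 1] by simp_all
  moreover have "band 0 (h 0) = (\<Union>m<N 0. {A 0 m, B 0 m})"
    "band 3 (h 1) = (\<Union>m<N 1. {A 1 m, B 1 m})" "band 6 (h 2) = (\<Union>m<N 2. {A 2 m, B 2 m})"
    using band_eq[of 0] band_eq[of 1] band_eq[of 2] by simp_all
  ultimately show ?thesis unfolding T_def pretzel_surface_def 3 by auto
qed

lemma T_cases [consumes 1, case_names D A B]:
  assumes "t \<in> T"
  obtains z k where "z = 0 \<or> z = 1" "k < 5" "t = D z k"
    | j m where "j < 3" "m < N j" "t = A j m"
    | j m where "j < 3" "m < N j" "t = B j m"
  using assms unfolding T_eq by blast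

lemma T_mem: "k < 5 \<Longrightarrow> D 0 k \<in> T" "k < 5 \<Longrightarrow> D 1 k \<in> T"
  "j < 3 \<Longrightarrow> m < N j \<Longrightarrow> A j m \<in> T" "j < 3 \<Longrightarrow> m < N j \<Longrightarrow> B j m \<in> T"
  unfolding T_eq by blast+

lemma finite_T: "finite T"
  unfolding T_eq by auto

text \<open>An odd number of half-twists exchanges the two edges of a band, so at the top the left
  end of the band belongs to its right edge.\<close>

lemma dv_eq:
  "dv 0 (2 * j) = L j 0" "dv 0 (Suc (2 * j)) = R j 0"
  "dv 1 (2 * j) = R j (N j)" "dv 1 (Suc (2 * j)) = L j (N j)"
  by (simp_all add: dv_def L_def R_def xk_def qcos_qsin_N)

text \<open>The axes are 3 apart and a band reaches at most 1 from its axis, so the first coordinate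
  determines the band.\<close>

lemma LR_aux:
  assumes "3 * real j + x = 3 * real j' + x'" "\<bar>x\<bar> \<le> 1" "\<bar>x'\<bar> \<le> 1"
  shows "j = j'"
proof -
  have "\<bar>real j - real j'\<bar> < 1" using assms by linarith
  thus ?thesis by linarith
qed

lemma qcos_le: "\<bar>qcos m\<bar> \<le> 1" by (simp add: qcos_def)

lemma qsin_le: "\<bar>qsin m\<bar> \<le> 1" by (simp add: qsin_def)

lemma LR_eq_iff [simp]:
  "L j m = L j' m' \<longleftrightarrow> j = j' \<and> m = m'" "R j m = R j' m' \<longleftrightarrow> j = j' \<and> m = m'"
  "L j m \<noteq> R j' m'" "R j' m' \<noteq> L j m"
proof -
  have *: "j = j' \<and> m = m'"
    if "3 * real j + x = 3 * real j' + x'" "\<bar>x\<bar> \<le> 1" "\<bar>x'\<bar> \<le> 1" "real m / real (N j) = real m' / real (N j')"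
    for x x'
  proof -
    have "j = j'" using LR_aux[OF that(1-3)] .
    thus ?thesis using that(4) by simp
  qed
  show "L j m = L j' m' \<longleftrightarrow> j = j' \<and> m = m'"
    using *[of "- qcos m" "- qcos m'"] qcos_le[of m] qcos_le[of m'] by (auto simp: L_def)
  show "R j m = R j' m' \<longleftrightarrow> j = j' \<and> m = m'"
    using *[of "qcos m" "qcos m'"] qcos_le[of m] qcos_le[of m'] by (auto simp: R_def)
  show "L j m \<noteq> R j' m'"
  proof
    assume eq: "L j m = R j' m'"
    hence "j = j' \<and> m = m'"
      using *[of "- qcos m" "qcos m'"] qcos_le[of m] qcos_le[of m'] by (auto simp: L_def R_def)
    thus False using eq by (cases rule: qcos_qsin_cases[of m]) (auto simp: L_def R_def)
  qed
  thus "R j' m' \<noteq> L j m" by metis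
qed

lemma ap_neq [simp]:
  "ap 0 \<noteq> L j m" "ap 1 \<noteq> L j m" "ap 0 \<noteq> R j m" "ap 1 \<noteq> R j m"
  "L j m \<noteq> ap 0" "L j m \<noteq> ap 1" "R j m \<noteq> ap 0" "R j m \<noteq> ap 1"
  "ap 0 \<noteq> ap 1" "ap 1 \<noteq> ap 0"
proof -
  have 0: "real m / real (N j) \<noteq> -1" by (smt (verit) divide_nonneg_nonneg of_nat_0_le_iff)
  \<comment> \<open>Levels \<open>m\<close> above \<open>N j\<close> are not excluded here, so the
    height cannot decide. A band vertex in the plane of the disks has a first coordinate that is 1
    off a multiple of 3, whereas the apex has 3.\<close>
  have 1: "L j m \<noteq> ap 1 \<and> R j m \<noteq> ap 1"
  proof (rule ccontr)
    assume a: "\<not> ?thesis"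
    hence s: "qsin m = 0" by (auto simp: L_def R_def ap_def)
    have c: "qcos m = 1 \<or> qcos m = -1" using s by (cases rule: qcos_qsin_cases[of m]) auto
    have "3 * real j - 3 = 1 \<or> 3 * real j - 3 = -1"
      using a c by (auto simp: L_def R_def ap_def)
    hence "3 * j = 4 \<or> 3 * j = 2" by linarith
    thus False by presburger
  qed
  show "ap 0 \<noteq> L j m" "ap 1 \<noteq> L j m" "ap 0 \<noteq> R j m" "ap 1 \<noteq> R j m"
  "L j m \<noteq> ap 0" "L j m \<noteq> ap 1" "R j m \<noteq> ap 0" "R j m \<noteq> ap 1"
  "ap 0 \<noteq> ap 1" "ap 1 \<noteq> ap 0"
    using 0 1 by (auto simp: L_def R_def ap_def)
qed

lemma xk_less: "k < l \<Longrightarrow> xk k < xk l"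
proof (rule lift_Suc_mono_less[of xk])
  show "xk n < xk (Suc n)" for n
    by (cases "even n") (auto simp: xk_def elim!: evenE oddE)
qed

end

lemma convex_hulls_Int_subset_at_plane:
  fixes A B :: "point set"
  assumes "finite A" "finite B"
    and "\<And>v. v \<in> A \<Longrightarrow> a * cx v + b * cy v + c * cz v \<le> d \<and> (a * cx v + b * cy v + c * cz v = d \<longrightarrow> v \<in> A')"
    and "\<And>v. v \<in> B \<Longrightarrow> d \<le> a * cx v + b * cy v + c * cz v \<and> (a * cx v + b * cy v + c * cz v = d \<longrightarrow> v \<in> B')"
  shows "convex hull A \<inter> convex hull B \<subseteq> convex hull A' \<inter> convex hull B'"
proof -
  have i: "inner (vec3 a b c) v = a * cx v + b * cy v + c * cz v" for v
    by (simp add: inner_vec_def sum_3)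
  show ?thesis
    by (rule convex_hulls_Int_subset_at_level[OF assms(1,2), where n="vec3 a b c" and c=d])
      (use assms(3,4) in \<open>auto simp: i\<close>)
qed

lemma convex_hulls_disjoint_plane:
  fixes A B :: "point set"
  assumes "\<And>v. v \<in> A \<Longrightarrow> a * cx v + b * cy v + c * cz v > d"
    and "\<And>v. v \<in> B \<Longrightarrow> a * cx v + b * cy v + c * cz v \<le> d"
  shows "convex hull A \<inter> convex hull B = {}"
proof -
  have i: "inner (vec3 a b c) v = a * cx v + b * cy v + c * cz v" for v
    by (simp add: inner_vec_def sum_3)
  show ?thesis
    by (rule convex_hulls_disjoint[where n="- vec3 a b c" and c="-d"]) (use assms in \<open>fastforce simp: i\<close>)+
qed

section \<open>The push-off\<close>

context pretzel
begin

text \<open>The push-off is horizontal. At an endpoint of the segment of a band with direction \<open>e\<close> it is a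
  quarter of \<open>n = e \<times> k\<close> plus or minus \<open>e\<close>, where \<open>k\<close> is vertical: the multiple of \<open>n\<close> alone would be
  tangent to one of the triangles of the adjacent layer.\<close>

definition nu :: "point \<Rightarrow> point" where
  "nu v = (THE w. (v = ap 0 \<and> w = vec3 (-1/4) (-1/4) 0) \<or> (v = ap 1 \<and> w = vec3 (-1/4) (1/4) 0) \<or>
     (\<exists>j m. v = L j m \<and> w = vec3 (sg j * (qcos m + qsin m) / 4) ((qsin m - qcos m) / 4) 0) \<or>
     (\<exists>j m. v = R j m \<and> w = vec3 (sg j * (qsin m - qcos m) / 4) (- (qcos m + qsin m) / 4) 0))"

text \<open>The description in \<open>nu\<close> is unambiguous because the vertices
  \<open>L j m\<close>, \<open>R j m\<close> and the two apexes are pairwise distinct.\<close>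

lemma nu_simps [simp]:
  "nu (ap 0) = vec3 (-1/4) (-1/4) 0"
  "nu (ap 1) = vec3 (-1/4) (1/4) 0"
  "nu (L j m) = vec3 (sg j * (qcos m + qsin m) / 4) ((qsin m - qcos m) / 4) 0"
  "nu (R j m) = vec3 (sg j * (qsin m - qcos m) / 4) (- (qcos m + qsin m) / 4) 0"
  unfolding nu_def by (rule the_equality; auto)+

text \<open>\<open>2 * z - 1\<close> is a sign, -1 for the bottom disk and 1 for the top one. The
  apex has the same second displacement, so a pushed disk lies in a plane parallel to the
  disk.\<close>

lemma nu_dv:
  assumes "z = 0 \<or> z = 1"
  shows "cy (nu (dv z k)) = (2 * z - 1) / 4" "cz (nu (dv z k)) = 0" "\<bar>cx (nu (dv z k))\<bar> = 1 / 4"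
proof -
  obtain j where "k = 2 * j \<or> k = Suc (2 * j)" by (metis oddE evenE Suc_eq_plus1)
  hence "cy (nu (dv z k)) = (2 * z - 1) / 4 \<and> cz (nu (dv z k)) = 0 \<and> \<bar>cx (nu (dv z k))\<bar> = 1 / 4"
    using assms by (cases rule: sg_cases[of j]) (auto simp: dv_eq qcos_qsin_N)
  thus "cy (nu (dv z k)) = (2 * z - 1) / 4" "cz (nu (dv z k)) = 0" "\<bar>cx (nu (dv z k))\<bar> = 1 / 4" by auto
qed

lemma verts_simps:
  "verts (A j m) = {L j m, R j m, R j (Suc m)}"
  "verts (B j m) = {L j m, R j (Suc m), L j (Suc m)}"
  "verts (D z k) = {dv z (Suc k), dv z k, ap z}"
  by (auto simp: A_def B_def D_def)

lemma nu_normal_pos: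
  assumes "t \<in> T" "v \<in> verts t"
  shows "inner (nu v) (normal t) > 0"
  using assms(1)
proof (cases rule: T_cases)
  case (D z k)
  have "xk (Suc k) > xk k" using xk_less[of k "Suc k"] by simp
  moreover have "cy (nu v) = (2 * z - 1) / 4"
    using assms(2) D(1) unfolding D(3) verts_simps by (auto simp: nu_dv)
  moreover have "inner (nu v) (normal (D z k)) = cy (nu v) * ((2 * z - 1) * (xk (Suc k) - xk k))"
    using D(1) by (auto simp: D_def inner_coords cross3_coords algebra_simps)
  moreover have "cy (nu v) * (2 * z - 1) = 1 / 4"
    using D(1) unfolding \<open>cy (nu v) = (2 * z - 1) / 4\<close> by auto
  ultimately have "inner (nu v) (normal (D z k)) = (xk (Suc k) - xk k) / 4"
    by (metis mult.assoc mult.commute mult_1 times_divide_eq_left)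
  thus ?thesis using \<open>xk (Suc k) > xk k\<close> by (simp add: D(3))
next
  case (A j m)
  have N: "real (N j) > 0" by simp
  have "real (Suc m) / real (N j) = real m / real (N j) + 1 / real (N j)"
    by (simp add: add_divide_distrib)
  thus ?thesis using assms(2) N unfolding A(3) verts_simps A_def
    by (cases rule: sg_cases[of j]; cases rule: qcos_qsin_cases[of m])
      (auto simp: inner_coords cross3_coords)
next
  case (B j m)
  have N: "real (N j) > 0" by simp
  have "real (Suc m) / real (N j) = real m / real (N j) + 1 / real (N j)"
    by (simp add: add_divide_distrib)
  thus ?thesis using assms(2) N unfolding B(3) verts_simps B_def
    by (cases rule: sg_cases[of j]; cases rule: qcos_qsin_cases[of m])
      (auto simp: inner_coords cross3_coords)
qed

text \<open>On the points of level \<open>m\<close> of band \<open>j\<close>, \<open>lev s j m\<close> is the coordinate along the normal \<open>n\<close>, hence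
  \<open>0\<close>, and it is positive on their push-offs; the term with the factor \<open>3\<close> outweighs this coordinate
  on all other levels.\<close>

definition lev :: "real \<Rightarrow> nat \<Rightarrow> nat \<Rightarrow> point \<Rightarrow> real" where
  "lev s j m v = sg j * qsin m * (cx v - 3 * real j) - qcos m * cy v + 3 * s * (real (N j) * cz v - real m)"

abbreviation push :: "real \<Rightarrow> point \<Rightarrow> point" where "push \<delta> v \<equiv> v + \<delta> *\<^sub>R nu v"

text \<open>\<open>s = 1\<close> separates the push-off of what is at or above level
  \<open>m\<close> from what is at or below it, and \<open>s = -1\<close> does the converse. Off
  level \<open>m\<close> the last term has absolute value at least 3 and beats the 1 + 1/4 of the
  horizontal terms; on level \<open>m\<close> these are 0 before and \<delta>/4 after the
  push.\<close>

lemma lev_LR: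
  assumes "v = L j l \<or> v = R j l" "s = 1 \<or> s = -1" "0 < \<delta>" "\<delta> \<le> 1"
  shows "s * real l \<ge> s * real m \<Longrightarrow> lev s j m (push \<delta> v) > 0"
    and "s * real l \<le> s * real m \<Longrightarrow> lev s j m v \<le> 0"
proof -
  have sep: "s * real l - s * real m \<ge> 1" if "s * real l > s * real m"
    using that assms(2) by auto
  have nu: "\<bar>cx (nu v)\<bar> = 1 / 4" "\<bar>cy (nu v)\<bar> = 1 / 4"
    using assms(1) by (cases rule: sg_cases[of j]; cases rule: qcos_qsin_cases[of l]; auto)+
  have f1: "\<bar>sg j * qsin m * (cx v - 3 * real j) - qcos m * cy v\<bar> \<le> 1"
    using assms(1) by (cases rule: qcos_qsin_cases[of m]; cases rule: sg_cases[of j])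
      (use qcos_le[of l] qsin_le[of l] in auto)
  have f2: "\<bar>sg j * qsin m * (\<delta> * cx (nu v)) - qcos m * (\<delta> * cy (nu v))\<bar> \<le> 1 / 4"
  proof -
    have "\<bar>\<delta> * cx (nu v)\<bar> \<le> 1 / 4" "\<bar>\<delta> * cy (nu v)\<bar> \<le> 1 / 4"
      using assms(3,4) by (simp_all add: abs_mult nu)
    thus ?thesis by (cases rule: qcos_qsin_cases[of m]; cases rule: sg_cases[of j]) simp_all
  qed
  have z: "real (N j) * cz v = real l" "real (N j) * cz (push \<delta> v) = real l"
    using assms(1) by auto
  have lev: "lev s j m v = sg j * qsin m * (cx v - 3 * real j) - qcos m * cy v + 3 * s * (real l - real m)"
    "lev s j m (push \<delta> v) = (sg j * qsin m * (cx v - 3 * real j) - qcos m * cy v)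
      + (sg j * qsin m * (\<delta> * cx (nu v)) - qcos m * (\<delta> * cy (nu v))) + 3 * s * (real l - real m)"
    unfolding lev_def z by (simp_all add: algebra_simps)
  have pos: "0 < p + q + 3 * d" if "\<bar>p\<bar> \<le> 1" "\<bar>q\<bar> \<le> 1 / 4" "1 \<le> d" for p q d :: real
    using that by linarith
  have neg: "p + 3 * (a - b) \<le> 0" if "\<bar>p\<bar> \<le> 1" "1 \<le> b - a" for p a b :: real
    using that by (simp add: abs_le_iff algebra_simps)
  have 3: "3 * s * (real l - real m) = 3 * (s * real l - s * real m)" by (simp add: algebra_simps)
  show "lev s j m (push \<delta> v) > 0" if le: "s * real l \<ge> s * real m"
  proof (cases "l = m")
    case True
    thus ?thesis using assms
      by (cases rule: sg_cases[of j]; cases rule: qcos_qsin_cases[of m])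
        (auto simp: lev_def)
  next
    case False
    hence "s * real l - s * real m \<ge> 1" using sep le assms(2) by force
    from pos[OF f1 f2 this] show ?thesis unfolding lev 3 .
  qed
  show "lev s j m v \<le> 0" if le: "s * real l \<le> s * real m"
  proof (cases "l = m")
    case True
    thus ?thesis using assms
      by (cases rule: sg_cases[of j]; cases rule: qcos_qsin_cases[of m])
        (auto simp: lev_def)
  next
    case False
    hence "s * real m - s * real l \<ge> 1" using le assms(2) by auto
    from neg[OF f1 this] show ?thesis unfolding lev 3 .
  qed
qed

lemma lev_disjoint:
  assumes "\<And>v. v \<in> X \<Longrightarrow> lev s j m v > 0" "\<And>v. v \<in> Y \<Longrightarrow> lev s j m v \<le> 0"
  shows "convex hull X \<inter> convex hull Y = {}"
proof (rule convex_hulls_disjoint_plane)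
  let ?d = "3 * real j * (sg j * qsin m) + 3 * s * real m"
  have eq: "sg j * qsin m * cx v + (- qcos m) * cy v + (3 * s * real (N j)) * cz v = lev s j m v + ?d" for v
    by (simp add: lev_def algebra_simps)
  show "v \<in> X \<Longrightarrow> sg j * qsin m * cx v + (- qcos m) * cy v + (3 * s * real (N j)) * cz v > ?d" for v
    unfolding eq using assms(1)[of v] by simp
  show "v \<in> Y \<Longrightarrow> sg j * qsin m * cx v + (- qcos m) * cy v + (3 * s * real (N j)) * cz v \<le> ?d" for v
    unfolding eq using assms(2)[of v] by simp
qed

definition layer :: "nat \<Rightarrow> nat \<Rightarrow> point set" where
  "layer j m = {L j m, R j m, L j (Suc m), R j (Suc m)}"

lemma verts_AB_layer: "verts (A j m) \<subseteq> layer j m" "verts (B j m) \<subseteq> layer j m"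
  by (auto simp: verts_simps layer_def)

lemma lev_layer:
  assumes "v \<in> layer j l" "0 < \<delta>" "\<delta> \<le> 1"
  shows "m \<le> l \<Longrightarrow> lev 1 j m (push \<delta> v) > 0" "m \<ge> Suc l \<Longrightarrow> lev (-1) j m (push \<delta> v) > 0"
    "m \<ge> Suc l \<Longrightarrow> lev 1 j m v \<le> 0" "m \<le> l \<Longrightarrow> lev (-1) j m v \<le> 0"
proof -
  obtain l' where l': "v = L j l' \<or> v = R j l'" "l' \<in> {l, Suc l}"
    using assms(1) by (auto simp: layer_def)
  show "m \<le> l \<Longrightarrow> lev 1 j m (push \<delta> v) > 0" "m \<ge> Suc l \<Longrightarrow> lev (-1) j m (push \<delta> v) > 0"
    "m \<ge> Suc l \<Longrightarrow> lev 1 j m v \<le> 0" "m \<le> l \<Longrightarrow> lev (-1) j m v \<le> 0"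
    using lev_LR[OF l'(1) _ assms(2,3), of 1 m] lev_LR[OF l'(1) _ assms(2,3), of "-1" m] l'(2) by auto
qed

text \<open>At the levels 0 and \<open>N j\<close> the rung lies along the base of a disk, and the
  normal coordinate is the second coordinate up to sign. A disk thus behaves like a continuation of
  each band beyond its end.\<close>

lemma lev_disk:
  assumes "v \<in> verts (D z k)" "0 < \<delta>" "z = 0 \<and> m = 0 \<and> s = 1 \<or> z = 1 \<and> m = N j \<and> s = -1"
  shows "lev (-s) j m (push \<delta> v) > 0" "lev s j m v \<le> 0"
proof -
  have y: "cy (nu v) = (2 * z - 1) / 4" "cz (nu v) = 0" "cy v = 0" "(2 * z - 1) * (cz v - z) \<ge> 0"
    using assms unfolding verts_simps by (auto simp: nu_dv)
  have z: "0 \<le> real (N j) * ((2 * z - 1) * (cz v - z))" by (rule mult_nonneg_nonneg[OF _ y(4)]) simp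
  have e: "cy (push \<delta> v) = \<delta> * (2 * z - 1) / 4" "cz (push \<delta> v) = cz v" using y by simp_all
  have "lev (-s) j m (push \<delta> v) = \<delta> / 4 + 3 * (real (N j) * ((2 * z - 1) * (cz v - z)))"
    using assms(3) unfolding lev_def e by (auto simp: qcos_qsin_N algebra_simps)
  thus "lev (-s) j m (push \<delta> v) > 0" using z assms(2) by linarith
  have "lev s j m v = - 3 * (real (N j) * ((2 * z - 1) * (cz v - z)))"
    using assms(3) unfolding lev_def y(3) by (auto simp: qcos_qsin_N algebra_simps)
  thus "lev s j m v \<le> 0" using z by linarith
qed

text \<open>In the horizontal sections of a layer, the two triangles form an L, where \<open>g1 = 0 \<le> g2\<close> on one arm
  and \<open>g2 = 0 \<le> g1\<close> on the other one; the push-off moves the corner of the L diagonally.\<close>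

lemma push_same_layer:
  assumes "t = A j m \<or> t = B j m" "t' = A j m \<or> t' = B j m" "0 < \<delta>" "\<delta> \<le> 1"
  shows "convex hull (push \<delta> ` verts t) \<inter> convex hull (verts t') = {}"
proof -
  define g1 where "g1 = (\<lambda>v. qcos m * (cx v - 3 * real j) + sg j * qsin m * cy v + 1 - (real (N j) * cz v - real m))"
  define g2 where "g2 = (\<lambda>v. qsin m * (cx v - 3 * real j) - sg j * qcos m * cy v + (real (N j) * cz v - real m))"
  have dis: "convex hull X \<inter> convex hull Y = {}" if
    "\<And>v. v \<in> X \<Longrightarrow> a1 * g1 v + a2 * g2 v > 0" "\<And>v. v \<in> Y \<Longrightarrow> a1 * g1 v + a2 * g2 v \<le> 0" for a1 a2 X Y
  proof (rule convex_hulls_disjoint_plane)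
    let ?a = "a1 * qcos m + a2 * qsin m" and ?b = "a1 * (sg j * qsin m) - a2 * (sg j * qcos m)"
    let ?c = "(a2 - a1) * real (N j)"
    let ?d = "3 * real j * ?a - a1 + (a2 - a1) * real m"
    have eq: "?a * cx v + ?b * cy v + ?c * cz v = a1 * g1 v + a2 * g2 v + ?d" for v
      by (simp add: g1_def g2_def algebra_simps)
    show "v \<in> X \<Longrightarrow> ?a * cx v + ?b * cy v + ?c * cz v > ?d" for v
      unfolding eq using that(1)[of v] by simp
    show "v \<in> Y \<Longrightarrow> ?a * cx v + ?b * cy v + ?c * cz v \<le> ?d" for v
      unfolding eq using that(2)[of v] by simp
  qed
  have g: "g1 (L j m) = 0 \<and> g2 (L j m) = 0 \<and> g1 (R j m) = 2 \<and> g2 (R j m) = 0 \<and>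
      g1 (R j (Suc m)) = 0 \<and> g2 (R j (Suc m)) = 0 \<and> g1 (L j (Suc m)) = 0 \<and> g2 (L j (Suc m)) = 2"
    by (cases rule: sg_cases[of j]; cases rule: qcos_qsin_cases[of m])
      (auto simp: g1_def g2_def)
  have p: "g1 (push \<delta> (L j m)) = sg j * \<delta> / 4 \<and> g2 (push \<delta> (L j m)) = sg j * \<delta> / 4 \<and>
      g1 (push \<delta> (R j m)) = 2 - sg j * \<delta> / 4 \<and> g2 (push \<delta> (R j m)) = sg j * \<delta> / 4 \<and>
      g1 (push \<delta> (R j (Suc m))) = sg j * \<delta> / 4 \<and> g2 (push \<delta> (R j (Suc m))) = sg j * \<delta> / 4 \<and>
      g1 (push \<delta> (L j (Suc m))) = sg j * \<delta> / 4 \<and> g2 (push \<delta> (L j (Suc m))) = 2 - sg j * \<delta> / 4"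
    by (cases rule: sg_cases[of j]; cases rule: qcos_qsin_cases[of m])
      (auto simp: g1_def g2_def)
  \<comment> \<open>For \<open>sg j = 1\<close> the push-off moves to where \<open>g1\<close> and
    \<open>g2\<close> are positive, and the function vanishing on \<open>t'\<close> separates. For
    \<open>sg j = -1\<close> the function vanishing on \<open>t\<close> becomes negative on the
    push-off of \<open>t\<close>, while it is nonnegative on both triangles.\<close>
  consider "sg j = 1" "t' = A j m" | "sg j = 1" "t' = B j m" | "sg j = -1" "t = A j m" | "sg j = -1" "t = B j m"
    using assms(1,2) by (cases rule: sg_cases[of j]) auto
  thus ?thesis
  proof cases
    case 1
    thus ?thesis using assms g p by (intro dis[of _ 0 1]) (auto simp: verts_simps)
  next
    case 2
    thus ?thesis using assms g p by (intro dis[of _ 1 0]) (auto simp: verts_simps)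
  next
    case 3
    thus ?thesis using assms g p by (intro dis[of _ 0 "-1"]) (auto simp: verts_simps)
  next
    case 4
    thus ?thesis using assms g p by (intro dis[of _ "-1" 0]) (auto simp: verts_simps)
  qed
qed

lemma layer_coords:
  assumes "v \<in> layer j m" "m < N j"
  shows "\<bar>cx v - 3 * real j\<bar> \<le> 1" "\<bar>cx (nu v)\<bar> = 1/4" "0 \<le> cz v" "cz v \<le> 1"
    "cz v = 0 \<longrightarrow> v \<in> {L j 0, R j 0}" "cz v = 1 \<longrightarrow> v \<in> {L j (N j), R j (N j)}"
proof -
  obtain l where l: "v = L j l \<or> v = R j l" "l \<le> N j"
    using assms by (auto simp: layer_def)
  have z: "cz v = real l / real (N j)" using l by (auto simp: L_def R_def)
  show "\<bar>cx v - 3 * real j\<bar> \<le> 1"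
    using l qcos_le[of l] by (auto simp: L_def R_def)
  show "\<bar>cx (nu v)\<bar> = 1/4"
    using l by (cases rule: sg_cases[of j]; cases rule: qcos_qsin_cases[of l]) auto
  show "0 \<le> cz v" "cz v \<le> 1" unfolding z using l(2) by auto
  show "cz v = 0 \<longrightarrow> v \<in> {L j 0, R j 0}" "cz v = 1 \<longrightarrow> v \<in> {L j (N j), R j (N j)}"
    unfolding z using l by (auto simp del: LR_eq_iff)
qed

lemma T_layer_cases:
  assumes "t \<in> T"
  obtains z k where "z = 0 \<or> z = 1" "t = D z k" "k < 5"
    | j m where "m < N j" "verts t \<subseteq> layer j m" "t = A j m \<or> t = B j m" "j < 3"
  using assms
proof (cases rule: T_cases)
  case (D z k)
  thus thesis using that(1) by blast
next
  case (A j m)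
  thus thesis using that(2)[of m j] verts_AB_layer(1)[of j m] by simp
next
  case (B j m)
  thus thesis using that(2)[of m j] verts_AB_layer(2)[of j m] by simp
qed

lemma push_disjoint:
  assumes t: "t \<in> T" and t': "t' \<in> T" and d: "0 < \<delta>" "\<delta> \<le> 1"
  shows "convex hull (push \<delta> ` verts t) \<inter> convex hull (verts t') = {}"
proof -
  consider (DD) z k z' k' where "z = 0 \<or> z = 1" "t = D z k" "z' = 0 \<or> z' = 1" "t' = D z' k'"
    | (DB) z k j m where "z = 0 \<or> z = 1" "t = D z k" "m < N j" "verts t' \<subseteq> layer j m"
    | (BD) z k j m where "z = 0 \<or> z = 1" "t' = D z k" "m < N j" "verts t \<subseteq> layer j m"
    | (BB) j m j' m' where "m < N j" "verts t \<subseteq> layer j m" "m' < N j'" "verts t' \<subseteq> layer j' m'"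
        "t = A j m \<or> t = B j m" "t' = A j' m' \<or> t' = B j' m'"
    by (rule T_layer_cases[OF t]; rule T_layer_cases[OF t']) simp_all
  thus ?thesis
  proof cases
    case DD
    have 1: "cy v = \<delta> * (2 * z - 1) / 4" "(2 * z - 1) * (cz v - z) \<ge> 0" if v: "v \<in> push \<delta> ` verts t" for v
    proof -
      obtain w where w: "w \<in> verts (D z k)" "v = push \<delta> w" using v unfolding DD(2) by blast
      have "cy w = 0" "cy (nu w) = (2 * z - 1) / 4" "cz (nu w) = 0" "(2 * z - 1) * (cz w - z) \<ge> 0"
        using w(1) DD(1) unfolding verts_simps by (auto simp: nu_dv)
      thus "cy v = \<delta> * (2 * z - 1) / 4" "(2 * z - 1) * (cz v - z) \<ge> 0" by (simp_all add: w(2))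
    qed
    have 2: "cy v = 0" "(2 * z' - 1) * (cz v - z') \<ge> 0" if "v \<in> verts t'" for v
      using that DD(3) unfolding DD verts_simps by (auto)
    show ?thesis
    proof (cases "z = z'")
      case True
      show ?thesis
      proof (rule convex_hulls_disjoint_plane[where a=0 and b="2*z-1" and c=0 and d=0])
        fix v assume "v \<in> push \<delta> ` verts t"
        hence "(2 * z - 1) * cy v = \<delta> / 4" using 1(1)[of v] DD(1) by auto
        thus "0 * cx v + (2 * z - 1) * cy v + 0 * cz v > 0" using d by simp
      qed (use 2 in simp)
    next
      case False
      show ?thesis
      proof (rule convex_hulls_disjoint_plane[where a=0 and b=0 and c="2*z-1" and d="(2*z-1)/2"])
        show "0 * cx v + 0 * cy v + (2 * z - 1) * cz v > (2 * z - 1) / 2" if "v \<in> push \<delta> ` verts t" for v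
          using 1(2)[OF that] DD(1) by auto
        show "0 * cx v + 0 * cy v + (2 * z - 1) * cz v \<le> (2 * z - 1) / 2" if "v \<in> verts t'" for v
          using 2(2)[OF that] DD(1,3) False by auto
      qed
    qed
  next
    case DB
    obtain s l where s: "z = 0 \<and> l = 0 \<and> s = 1 \<or> z = 1 \<and> l = N j \<and> s = (-1::real)" using DB(1) by blast
    show ?thesis
    proof (rule lev_disjoint[of _ "-s" j l])
      show "lev (- s) j l v > 0" if "v \<in> push \<delta> ` verts t" for v
        using that lev_disk(1)[OF _ d(1) s] DB(2) by auto
      show "lev (- s) j l v \<le> 0" if "v \<in> verts t'" for v
        using that lev_layer(3,4)[OF _ d, of v j m l] DB s by auto
    qed
  next
    case BD
    obtain s l where s: "z = 0 \<and> l = 0 \<and> s = 1 \<or> z = 1 \<and> l = N j \<and> s = (-1::real)" using BD(1) by blast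
    show ?thesis
    proof (rule lev_disjoint[of _ "s" j l])
      show "lev s j l v \<le> 0" if "v \<in> verts t'" for v
        using that lev_disk(2)[OF _ d(1) s] BD(2) by auto
      show "lev s j l v > 0" if "v \<in> push \<delta> ` verts t" for v
        using that lev_layer(1,2)[OF _ d, of _ j m l] BD s by auto
    qed
  next
    case BB
    consider "j < j'" | "j' < j" | "j = j'" "m = m'" | "j = j'" "m < m'" | "j = j'" "m' < m" by linarith
    thus ?thesis
    proof cases
      case 1
      show ?thesis
      \<comment> \<open>3/2 is half the distance of neighbouring axes and exceeds the reach 1 + 1/4
        of a pushed band.\<close>
      proof (rule convex_hulls_disjoint_plane[where a="-1" and b=0 and c=0 and d="- 3 * real j - 3/2"])
        fix v assume "v \<in> push \<delta> ` verts t"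
        then obtain w where w: "w \<in> verts t" "v = push \<delta> w" by blast
        have "w \<in> layer j m" using w BB by blast
        note c = layer_coords[OF this BB(1)]
        have "\<bar>\<delta> * cx (nu w)\<bar> \<le> 1/4" using d by (simp add: abs_mult c(2))
        thus "- 1 * cx v + 0 * cy v + 0 * cz v > - 3 * real j - 3/2" using c(1) w(2) by auto
      next
        fix v assume "v \<in> verts t'"
        hence "v \<in> layer j' m'" using BB by blast
        note c = layer_coords[OF this BB(3)]
        show "- 1 * cx v + 0 * cy v + 0 * cz v \<le> - 3 * real j - 3/2" using c(1) 1 by auto
      qed
    next
      case 2
      show ?thesis
      proof (rule convex_hulls_disjoint_plane[where a="1" and b=0 and c=0 and d="3 * real j - 3/2"])
        fix v assume "v \<in> push \<delta> ` verts t"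
        then obtain w where w: "w \<in> verts t" "v = push \<delta> w" by blast
        have "w \<in> layer j m" using w BB by blast
        note c = layer_coords[OF this BB(1)]
        have "\<bar>\<delta> * cx (nu w)\<bar> \<le> 1/4" using d by (simp add: abs_mult c(2))
        thus "1 * cx v + 0 * cy v + 0 * cz v > 3 * real j - 3/2" using c(1) w(2) by auto
      next
        fix v assume "v \<in> verts t'"
        hence "v \<in> layer j' m'" using BB by blast
        note c = layer_coords[OF this BB(3)]
        show "1 * cx v + 0 * cy v + 0 * cz v \<le> 3 * real j - 3/2" using c(1) 2 by auto
      qed
    next
      case 3
      thus ?thesis using push_same_layer BB d by blast
    next
      case 4
      \<comment> \<open>The separating level is the lower end \<open>m'\<close> of the upper layer;
        the pushed triangle is below it, hence the sign -1.\<close>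
      show ?thesis
        by (rule lev_disjoint[of _ "-1" j m'])
          (use lev_layer[OF _ d, of _ j m m'] lev_layer[OF _ d, of _ j m' m'] BB 4 in fastforce)+
    next
      case 5
      show ?thesis
        by (rule lev_disjoint[of _ 1 j m])
          (use lev_layer[OF _ d, of _ j m m] lev_layer[OF _ d, of _ j m' m] BB 5 in fastforce)+
    qed
  qed
qed

lemma positive_pushoff_T: "positive_pushoff T nu"
  unfolding positive_pushoff_def using nu_normal_pos push_disjoint by fastforce

end

section \<open>The surface is an oriented surface\<close>

context pretzel
begin

section \<open>Intersections of pairs of triangles\<close>

lemma xk_le_iff [simp]: "xk k \<le> xk l \<longleftrightarrow> k \<le> l" "xk k < xk l \<longleftrightarrow> k < l" "xk k = xk l \<longleftrightarrow> k = l"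
proof -
  have "strict_mono xk" by (simp add: strict_mono_def xk_less)
  thus "xk k \<le> xk l \<longleftrightarrow> k \<le> l" "xk k < xk l \<longleftrightarrow> k < l" "xk k = xk l \<longleftrightarrow> k = l"
    by (simp_all add: strict_mono_less_eq strict_mono_less strict_mono_eq)
qed

lemma dv_eq_iff [simp]: "dv z k = dv z' l \<longleftrightarrow> z = z' \<and> k = l"
  by (auto simp: point_eq_iff)

lemma base_edges_Int:
  assumes "W \<subseteq> {dv z i, dv z (Suc i)}"
  shows "convex hull {dv z k, dv z (Suc k)} \<inter> convex hull W \<subseteq> convex hull ({dv z k, dv z (Suc k)} \<inter> W)"
proof -
  have fin: "finite W" using assms finite_subset by auto
  consider "k < i" | "k = i" | "i < k" by linarith
  thus ?thesis
  proof cases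
    case 1
    have "convex hull {dv z k, dv z (Suc k)} \<inter> convex hull W \<subseteq>
        convex hull {dv z (Suc k)} \<inter> convex hull ({dv z k, dv z (Suc k)} \<inter> W)"
      by (rule convex_hulls_Int_subset_at_plane[where a=1 and b=0 and c=0 and d="xk (Suc k)"])
        (use fin 1 assms in auto)
    thus ?thesis by blast
  next
    case 2
    hence "{dv z k, dv z (Suc k)} \<inter> W = W" using assms by auto
    thus ?thesis by auto
  next
    case 3
    have "convex hull {dv z k, dv z (Suc k)} \<inter> convex hull W \<subseteq>
        convex hull {dv z k} \<inter> convex hull ({dv z k, dv z (Suc k)} \<inter> W)"
      by (rule convex_hulls_Int_subset_at_plane[where a="-1" and b=0 and c=0 and d="- xk k"])
        (use fin 3 assms in auto)
    thus ?thesis by blast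
  qed
qed

text \<open>The plane at height \<open>z\<close> supports both the disk and the band, which reduces
  the claim to intervals on the base line. The factor \<open>1 - 2 * z\<close> lets the same
  inequalities serve for both disks.\<close>

lemma disk_band_Int:
  assumes z: "z = 0 \<or> z = 1" and W: "W \<subseteq> layer j m" "m < N j"
  shows "convex hull (verts (D z k)) \<inter> convex hull W \<subseteq> convex hull (verts (D z k) \<inter> W)"
proof -
  let ?W = "W \<inter> {dv z (2 * j), dv z (Suc (2 * j))}"
  have fin: "finite W" by (rule finite_subset[OF W(1)]) (simp add: layer_def)
  have "convex hull (verts (D z k)) \<inter> convex hull W \<subseteq> convex hull {dv z k, dv z (Suc k)} \<inter> convex hull ?W"
  proof (rule convex_hulls_Int_subset_at_plane[where a=0 and b=0 and c="1 - 2 * z" and d="(1 - 2 * z) * z"])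
    show "0 * cx v + 0 * cy v + (1 - 2 * z) * cz v \<le> (1 - 2 * z) * z \<and>
       (0 * cx v + 0 * cy v + (1 - 2 * z) * cz v = (1 - 2 * z) * z \<longrightarrow> v \<in> {dv z k, dv z (Suc k)})"
      if "v \<in> verts (D z k)" for v
      using that z unfolding verts_simps by auto
    show "(1 - 2 * z) * z \<le> 0 * cx v + 0 * cy v + (1 - 2 * z) * cz v \<and>
       (0 * cx v + 0 * cy v + (1 - 2 * z) * cz v = (1 - 2 * z) * z \<longrightarrow> v \<in> ?W)"
      if v: "v \<in> W" for v
    proof -
      have "v \<in> layer j m" using v W by blast
      from layer_coords(3-6)[OF this W(2)] show ?thesis using v z
        by (auto simp: dv_eq)
    qed
  qed (use fin in \<open>auto simp: verts_simps\<close>)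
  also have "\<dots> \<subseteq> convex hull ({dv z k, dv z (Suc k)} \<inter> ?W)"
    by (rule base_edges_Int) auto
  also have "\<dots> \<subseteq> convex hull (verts (D z k) \<inter> W)"
    by (rule hull_mono) (auto simp: verts_simps)
  finally show ?thesis .
qed

lemma disk_disk_Int:
  assumes z: "z = 0 \<or> z = 1" and "k < l"
  shows "convex hull (verts (D z k)) \<inter> convex hull (verts (D z l)) \<subseteq> convex hull (verts (D z k) \<inter> verts (D z l))"
proof -
  \<comment> \<open>The plane is perpendicular to the disk and passes through the apex and
    \<open>dv z (Suc k)\<close>. \<open>?b\<close> is the signed horizontal distance between these
    points; \<open>1 - 2 * z\<close> accounts for an apex one unit below or above the base.\<close>
  let ?b = "3 - xk (Suc k)"
  let ?c = "?b * (1 - 2 * z)" and ?d = "xk (Suc k) + ?b * ((1 - 2 * z) * z)"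
  let ?S = "{dv z (Suc k), ap z}"
  have ap: "1 * cx (ap z) + 0 * cy (ap z) + ?c * cz (ap z) = ?d"
    using z by auto
  have dv: "1 * cx (dv z i) + 0 * cy (dv z i) + ?c * cz (dv z i) = ?d + (xk i - xk (Suc k))" for i
    by (simp add: algebra_simps)
  have "convex hull (verts (D z k)) \<inter> convex hull (verts (D z l)) \<subseteq> convex hull ?S \<inter> convex hull (verts (D z l) \<inter> ?S)"
  proof (rule convex_hulls_Int_subset_at_plane[where a=1 and b=0 and c="?c" and d="?d"])
    show "1 * cx v + 0 * cy v + ?c * cz v \<le> ?d \<and> (1 * cx v + 0 * cy v + ?c * cz v = ?d \<longrightarrow> v \<in> ?S)"
      if v: "v \<in> verts (D z k)" for v
    proof -
      consider "v = dv z k" | "v = dv z (Suc k)" | "v = ap z" using v by (auto simp: verts_simps)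
      thus ?thesis by cases (simp_all only: ap dv, simp_all)
    qed
    show "?d \<le> 1 * cx v + 0 * cy v + ?c * cz v \<and>
        (1 * cx v + 0 * cy v + ?c * cz v = ?d \<longrightarrow> v \<in> verts (D z l) \<inter> ?S)"
      if v: "v \<in> verts (D z l)" for v
    proof -
      consider "v = dv z l" | "v = dv z (Suc l)" | "v = ap z" using v by (auto simp: verts_simps)
      thus ?thesis using assms(2) by cases (simp_all only: ap dv, simp_all add: verts_simps)
    qed
  qed (auto simp: verts_simps)
  also have "\<dots> \<subseteq> convex hull (verts (D z k) \<inter> verts (D z l))"
    by (rule subset_trans[OF Int_lower2 hull_mono]) (auto simp: verts_simps)
  finally show ?thesis .
qed

lemma disk_disk_opp: "convex hull (verts (D 0 k)) \<inter> convex hull (verts (D 1 l)) = {}"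
  unfolding Int_commute[of "convex hull (verts (D 0 k))"]
  by (rule convex_hulls_disjoint_plane[where a=0 and b=0 and c=1 and d="1/2"]) (auto simp: verts_simps)

lemma band_band_axis_Int:
  assumes "j < j'" "X \<subseteq> layer j m" "m < N j" "Y \<subseteq> layer j' m'" "m' < N j'"
  shows "convex hull X \<inter> convex hull Y = {}"
proof (rule convex_hulls_disjoint_plane[where a="-1" and b=0 and c=0 and d="- 3 * real j - 3/2"])
  show "- 1 * cx v + 0 * cy v + 0 * cz v > - 3 * real j - 3/2" if "v \<in> X" for v
    using layer_coords(1)[of v j m] that assms by auto
  show "- 1 * cx v + 0 * cy v + 0 * cz v \<le> - 3 * real j - 3/2" if "v \<in> Y" for v
    using layer_coords(1)[of v j' m'] that assms by auto
qed

lemma same_layer_Int: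
  "convex hull (verts (A j m)) \<inter> convex hull (verts (B j m)) \<subseteq> convex hull (verts (A j m) \<inter> verts (B j m))"
proof -
  \<comment> \<open>This function is equal at both ends of the common diagonal, 2 smaller at the
    third vertex of \<open>A j m\<close> and 2 larger at that of \<open>B j m\<close>.\<close>
  let ?a = "- (qcos m - qsin m)" and ?b = "- (sg j * (qsin m + qcos m))" and ?c = "2 * real (N j)"
  define g where "g v = ?a * cx v + ?b * cy v + ?c * cz v" for v
  let ?d = "2 * real m + 1 - 3 * real j * (qcos m - qsin m)"
  let ?S = "{L j m, R j (Suc m)}"
  have g: "g (L j m) = ?d \<and> g (R j (Suc m)) = ?d \<and> g (R j m) = ?d - 2 \<and> g (L j (Suc m)) = ?d + 2"
    unfolding g_def
    by (cases rule: sg_cases[of j]; cases rule: qcos_qsin_cases[of m]) auto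
  have "convex hull (verts (A j m)) \<inter> convex hull (verts (B j m)) \<subseteq> convex hull ?S \<inter> convex hull ?S"
  proof (rule convex_hulls_Int_subset_at_plane[where a="?a" and b="?b" and c="?c" and d="?d"])
    show "?a * cx v + ?b * cy v + ?c * cz v \<le> ?d \<and> (?a * cx v + ?b * cy v + ?c * cz v = ?d \<longrightarrow> v \<in> ?S)"
      if "v \<in> verts (A j m)" for v
      using that g unfolding g_def[symmetric] verts_simps by auto
    show "?d \<le> ?a * cx v + ?b * cy v + ?c * cz v \<and> (?a * cx v + ?b * cy v + ?c * cz v = ?d \<longrightarrow> v \<in> ?S)"
      if "v \<in> verts (B j m)" for v
      using that g unfolding g_def[symmetric] verts_simps by auto
  qed (auto simp: verts_simps)
  also have "\<dots> \<subseteq> convex hull (verts (A j m) \<inter> verts (B j m))"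
    by (simp add: verts_simps insert_commute hull_mono)
  finally show ?thesis .
qed

lemma layers_Int:
  assumes "X \<subseteq> layer j m" "Y \<subseteq> layer j m'" "m < m'"
  shows "convex hull X \<inter> convex hull Y \<subseteq> convex hull (X \<inter> Y)"
proof -
  \<comment> \<open>The upper rung of the lower layer; if the layers are not adjacent,
    \<open>Y\<close> has no point on it.\<close>
  let ?S = "{L j (Suc m), R j (Suc m)}"
  have fin: "finite X" "finite Y" by (rule finite_subset[OF assms(1)] finite_subset[OF assms(2)], simp add: layer_def)+
  have "convex hull X \<inter> convex hull Y \<subseteq> convex hull (X \<inter> ?S) \<inter> convex hull (Y \<inter> ?S)"
  proof (rule convex_hulls_Int_subset_at_plane[where a=0 and b=0 and c="real (N j)" and d="real (Suc m)"])
    show "0 * cx v + 0 * cy v + real (N j) * cz v \<le> real (Suc m) \<and>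
        (0 * cx v + 0 * cy v + real (N j) * cz v = real (Suc m) \<longrightarrow> v \<in> X \<inter> ?S)" if "v \<in> X" for v
      using that assms(1) by (auto simp: layer_def)
    show "real (Suc m) \<le> 0 * cx v + 0 * cy v + real (N j) * cz v \<and>
        (0 * cx v + 0 * cy v + real (N j) * cz v = real (Suc m) \<longrightarrow> v \<in> Y \<inter> ?S)" if v: "v \<in> Y" for v
    proof -
      have "\<exists>l\<ge>m'. v = L j l \<or> v = R j l" using v assms(2) by (auto simp: layer_def intro: le_SucI)
      thus ?thesis using assms(3) v by auto
    qed
  qed (use fin in auto)
  also have "\<dots> \<subseteq> convex hull ((X \<inter> ?S) \<inter> (Y \<inter> ?S))"
    by (rule convex_hulls_Int_subset_doubleton[of _ "L j (Suc m)" "R j (Suc m)"]) auto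
  also have "\<dots> \<subseteq> convex hull (X \<inter> Y)" by (rule hull_mono) auto
  finally show ?thesis .
qed

lemma triangles_Int:
  assumes t: "t \<in> T" and t': "t' \<in> T"
  shows "convex hull (verts t) \<inter> convex hull (verts t') = convex hull (verts t \<inter> verts t')"
proof
  show "convex hull (verts t \<inter> verts t') \<subseteq> convex hull (verts t) \<inter> convex hull (verts t')"
    by (simp add: hull_mono)
  consider (DD) z k z' k' where "z = 0 \<or> z = 1" "t = D z k" "z' = 0 \<or> z' = 1" "t' = D z' k'"
    | (DB) z k j m where "z = 0 \<or> z = 1" "t = D z k" "m < N j" "verts t' \<subseteq> layer j m"
    | (BD) z k j m where "z = 0 \<or> z = 1" "t' = D z k" "m < N j" "verts t \<subseteq> layer j m"
    | (BB) j m j' m' where "m < N j" "verts t \<subseteq> layer j m" "m' < N j'" "verts t' \<subseteq> layer j' m'"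
        "t = A j m \<or> t = B j m" "t' = A j' m' \<or> t' = B j' m'"
    by (rule T_layer_cases[OF t]; rule T_layer_cases[OF t']) simp_all
  thus "convex hull (verts t) \<inter> convex hull (verts t') \<subseteq> convex hull (verts t \<inter> verts t')"
  proof cases
    case DD
    show ?thesis
    proof (cases "z = z'")
      case True
      thus ?thesis using disk_disk_Int[OF DD(1), of k k'] disk_disk_Int[OF DD(1), of k' k]
        unfolding DD by (cases k k' rule: linorder_cases) (auto simp: Int_commute)
    next
      case False
      thus ?thesis using DD disk_disk_opp[of k k'] disk_disk_opp[of k' k] by (auto simp: Int_commute)
    qed
  next
    case DB
    thus ?thesis using disk_band_Int[OF DB(1) DB(4,3)] by simp
  next
    case BD
    thus ?thesis using disk_band_Int[OF BD(1) BD(4,3)] by (simp add: Int_commute)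
  next
    case BB
    consider "j < j'" | "j' < j" | "j = j'" "m = m'" | "j = j'" "m < m'" | "j = j'" "m' < m" by linarith
    thus ?thesis
    proof cases
      case 1 thus ?thesis using band_band_axis_Int[OF _ BB(2,1,4,3)] by simp
    next
      case 2 thus ?thesis using band_band_axis_Int[OF _ BB(4,3,2,1)] by (simp add: Int_commute)
    next
      case 3 thus ?thesis using BB(5,6) same_layer_Int[of j m] by (auto simp: Int_commute)
    next
      case 4 thus ?thesis using layers_Int[OF BB(2), of "verts t'" m'] BB(4) by simp
    next
      case 5 thus ?thesis using layers_Int[of "verts t'" j m' "verts t" m] BB(2,4) by (simp add: Int_commute)
    qed
  qed
qed

section \<open>Edges, vertex links and connectedness\<close>

lemma D_eq:
  "D 0 (2 * j) = (R j 0, L j 0, ap 0)" "D 0 (Suc (2 * j)) = (L (Suc j) 0, R j 0, ap 0)"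
  "D 1 (2 * j) = (L j (N j), R j (N j), ap 1)" "D 1 (Suc (2 * j)) = (R (Suc j) (N (Suc j)), L j (N j), ap 1)"
  using dv_eq[of j] dv_eq[of "Suc j"] by (simp_all add: D_def)

lemma T_cases6 [consumes 1, case_names D0e D0o D1e D1o A B]:
  assumes "t \<in> T"
  obtains j where "j < 3" "t = D 0 (2 * j)" "t = (R j 0, L j 0, ap 0)"
    | j where "j < 2" "t = D 0 (Suc (2 * j))" "t = (L (Suc j) 0, R j 0, ap 0)"
    | j where "j < 3" "t = D 1 (2 * j)" "t = (L j (N j), R j (N j), ap 1)"
    | j where "j < 2" "t = D 1 (Suc (2 * j))" "t = (R (Suc j) (N (Suc j)), L j (N j), ap 1)"
    | j m where "j < 3" "m < N j" "t = A j m" "t = (L j m, R j m, R j (Suc m))"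
    | j m where "j < 3" "m < N j" "t = B j m" "t = (L j m, R j (Suc m), L j (Suc m))"
  using assms
proof (cases rule: T_cases)
  case (D z k)
  obtain j where "k = 2 * j \<or> k = Suc (2 * j)" by (metis oddE evenE Suc_eq_plus1)
  thus thesis using D that(1-4)[of j] D_eq[of j] by auto
next
  case (A j m)
  show thesis by (rule that(5)[OF A]) (simp add: A A_def)
next
  case (B j m)
  show thesis by (rule that(6)[OF B]) (simp add: B B_def)
qed

lemma T_tuples:
  assumes "t \<in> T"
  obtains j where "j < 3" "t = (R j 0, L j 0, ap 0)"
    | j where "j < 2" "t = (L (Suc j) 0, R j 0, ap 0)"
    | j where "j < 3" "t = (L j (N j), R j (N j), ap 1)"
    | j where "j < 2" "t = (R (Suc j) (N (Suc j)), L j (N j), ap 1)"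
    | j m where "j < 3" "m < N j" "t = (L j m, R j m, R j (Suc m))"
    | j m where "j < 3" "m < N j" "t = (L j m, R j (Suc m), L j (Suc m))"
  using assms by (cases rule: T_cases6) (blast intro: that)+

lemma inj_on_verts: "inj_on verts T"
proof (rule inj_onI)
  fix t t' assume t: "t \<in> T" and t': "t' \<in> T" and eq: "verts t = verts t'"
  have sub: "verts t \<subseteq> verts t'" "verts t' \<subseteq> verts t" using eq by simp_all
  show "t = t'"
    using t t' sub by (elim T_tuples; simp; linarith?)
qed

lemma directed_edges_disjoint:
  assumes "t \<in> T" "t' \<in> T" "t \<noteq> t'"
  shows "directed_edges t \<inter> directed_edges t' = {}"
  using assms by (elim T_tuples; auto)

definition adj :: "point \<Rightarrow> (triangle \<times> triangle) set" where
  "adj v = {(u, u'). u \<in> T \<and> u' \<in> T \<and> v \<in> verts u \<inter> verts u' \<and> card (verts u \<inter> verts u') \<ge> 2}"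

lemma adjI:
  assumes "u \<in> T" "u' \<in> T" "v \<in> verts u" "v \<in> verts u'" "w \<in> verts u" "w \<in> verts u'" "v \<noteq> w"
  shows "(u, u') \<in> (adj v)\<^sup>*"
proof -
  have "finite (verts u \<inter> verts u')" by (cases u) auto
  hence "card {v, w} \<le> card (verts u \<inter> verts u')" using assms by (intro card_mono) auto
  thus ?thesis using assms by (intro r_into_rtrancl) (simp add: adj_def)
qed

lemma sym_adj: "sym (adj v)"
  by (auto simp: adj_def sym_def Int_commute)

lemma N_pred: obtains n where "N j = Suc n"
  using N_pos[of j] gr0_conv_Suc by blast

lemma T_mem6:
  "j < 3 \<Longrightarrow> D 0 (2 * j) \<in> T" "j < 2 \<Longrightarrow> D 0 (Suc (2 * j)) \<in> T"
  "j < 3 \<Longrightarrow> D 1 (2 * j) \<in> T" "j < 2 \<Longrightarrow> D 1 (Suc (2 * j)) \<in> T"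
  using T_mem(1,2) by auto

lemma verts_D:
  "verts (D 0 (2 * j)) = {R j 0, L j 0, ap 0}" "verts (D 0 (Suc (2 * j))) = {L (Suc j) 0, R j 0, ap 0}"
  "verts (D 1 (2 * j)) = {L j (N j), R j (N j), ap 1}"
  "verts (D 1 (Suc (2 * j))) = {R (Suc j) (N (Suc j)), L j (N j), ap 1}"
  unfolding D_eq by simp_all

lemmas verts_all = verts_D verts_simps(1,2)

text \<open>Every triangle at \<open>v\<close> is joined to one chosen triangle, here the one
  standing on the rung of level \<open>m\<close>. At level 0 the triangles of the bottom disk are
  reached through the base edge and the edges to the apex.\<close>

lemma link_interior:
  assumes "j < 3" "m < N j" "v = L j m \<or> v = R j m" "t \<in> T" "v \<in> verts t"
  shows "(t, A j m) \<in> (adj v)\<^sup>*"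
proof -
  note mem = T_mem(3,4) T_mem6
  have 1: "(B j m, A j m) \<in> (adj (L j m))\<^sup>*"
    by (rule adjI[where w="R j (Suc m)"]) (use assms mem in \<open>auto simp: verts_all\<close>)
  have 2: "(B j n, A j m) \<in> (adj v)\<^sup>*" if "m = Suc n" for n
    by (rule adjI[where w="if v = L j m then R j m else L j m"]) (use assms mem that in \<open>auto simp: verts_all\<close>)
  have 3: "(A j n, B j n) \<in> (adj (R j m))\<^sup>*" if "m = Suc n" for n
    by (rule adjI[where w="L j n"]) (use assms mem that in \<open>auto simp: verts_all\<close>)
  have 4: "(D 0 (2 * j), A j m) \<in> (adj v)\<^sup>*" if "m = 0"
    by (rule adjI[where w="if v = L j m then R j m else L j m"]) (use assms mem that in \<open>auto simp: verts_all\<close>)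
  have 5: "(D 0 (Suc (2 * j)), D 0 (2 * j)) \<in> (adj (R j m))\<^sup>*" if "m = 0" "j < 2"
    by (rule adjI[where w="ap 0"]) (use assms mem that in \<open>auto simp: verts_all\<close>)
  have 6: "(D 0 (Suc (2 * i)), D 0 (2 * j)) \<in> (adj (L j m))\<^sup>*" if "m = 0" "j = Suc i" for i
    by (rule adjI[where w="ap 0"]) (use assms mem that in \<open>auto simp: verts_all simp del: mult_Suc_right\<close>)
  show ?thesis
    using assms(4)
  proof (cases rule: T_cases6)
    case (D0e i)
    thus ?thesis using 4 assms(3,5) by (auto simp: verts_all)
  next
    case (D0o i)
    hence "(v = L j m \<and> m = 0 \<and> j = Suc i) \<or> (v = R j m \<and> m = 0 \<and> j = i)"
      using assms(3,5) by (auto simp: verts_all)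
    thus ?thesis using 4 5 6 D0o(1,2) by (auto intro: rtrancl_trans simp del: mult_Suc_right)
  next
    case (D1e i)
    thus ?thesis using assms(2,3,5) by (auto simp: verts_all)
  next
    case (D1o i)
    thus ?thesis using assms(2,3,5) by (auto simp: verts_all)
  next
    case (A i l)
    hence "i = j \<and> (l = m \<or> (v = R j m \<and> m = Suc l))" using assms(3,5) by (auto simp: verts_all)
    thus ?thesis using A(3) 2 3 by (auto intro: rtrancl_trans)
  next
    case (B i l)
    hence "i = j \<and> ((v = L j m \<and> l = m) \<or> m = Suc l)" using assms(3,5) by (auto simp: verts_all)
    thus ?thesis using B(3) 1 2 by auto
  qed
qed

text \<open>No layer starts at the top level, so the chosen triangle is now the last one of the
  band.\<close>

lemma link_top:
  assumes "j < 3" "N j = Suc n" "v = L j (N j) \<or> v = R j (N j)" "t \<in> T" "v \<in> verts t"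
  shows "(t, B j n) \<in> (adj v)\<^sup>*"
proof -
  note mem = T_mem(3,4) T_mem6
  have 3: "(A j n, B j n) \<in> (adj (R j (N j)))\<^sup>*"
    by (rule adjI[where w="L j n"]) (use assms mem in \<open>auto simp: verts_all\<close>)
  have 4: "(D 1 (2 * j), B j n) \<in> (adj v)\<^sup>*"
    by (rule adjI[where w="if v = L j (N j) then R j (N j) else L j (N j)"]) (use assms mem in \<open>auto simp: verts_all\<close>)
  have 5: "(D 1 (Suc (2 * j)), D 1 (2 * j)) \<in> (adj (L j (N j)))\<^sup>*" if "j < 2"
    by (rule adjI[where w="ap 1"]) (use assms mem that in \<open>auto simp: verts_all\<close>)
  have 6: "(D 1 (Suc (2 * i)), D 1 (2 * j)) \<in> (adj (R j (N j)))\<^sup>*" if "j = Suc i" for i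
    by (rule adjI[where w="ap 1"]) (use assms mem that in \<open>auto simp: verts_all simp del: mult_Suc_right\<close>)
  show ?thesis
    using assms(4)
  proof (cases rule: T_cases6)
    case (D0e i)
    thus ?thesis using assms(2,3,5) by (auto simp: verts_all)
  next
    case (D0o i)
    thus ?thesis using assms(2,3,5) by (auto simp: verts_all)
  next
    case (D1e i)
    thus ?thesis using 4 assms(3,5) by (auto simp: verts_all)
  next
    case (D1o i)
    hence "(v = R j (N j) \<and> j = Suc i) \<or> (v = L j (N j) \<and> j = i)"
      using assms(3,5) by (auto simp: verts_all)
    thus ?thesis using 4 5 6 D1o(1,2) by (auto intro: rtrancl_trans simp del: mult_Suc_right)
  next
    case (A i l)
    hence "i = j \<and> v = R j (N j) \<and> l = n" using assms(2,3,5) by (auto simp: verts_all)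
    thus ?thesis using A(3) 3 by auto
  next
    case (B i l)
    hence "i = j \<and> l = n" using assms(2,3,5) by (auto simp: verts_all)
    thus ?thesis using B(3) by auto
  qed
qed

text \<open>The triangles at an apex form a fan in which neighbours share the edge to the base
  vertex between them.\<close>

lemma link_apex:
  assumes z: "z = 0 \<or> z = 1" and "t \<in> T" "ap z \<in> verts t"
  shows "(t, D z 0) \<in> (adj (ap z))\<^sup>*"
proof -
  have *: "(D z k, D z 0) \<in> (adj (ap z))\<^sup>*" if "k < 5" for k
    using that
  proof (induction k)
    case (Suc k)
    have "ap z \<noteq> dv z (Suc k)" using z by (auto simp: point_eq_iff)
    hence "(D z (Suc k), D z k) \<in> (adj (ap z))\<^sup>*"
      using T_mem(1,2)[of k] T_mem(1,2)[of "Suc k"] Suc.prems z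
      by (intro adjI[where w="dv z (Suc k)"]) (auto simp: verts_simps)
    thus ?case using Suc by (auto intro: rtrancl_trans)
  qed simp
  show ?thesis
    using assms(2)
  proof (cases rule: T_cases)
    case (D z' k)
    hence "z = z'" using assms(3) z by (auto simp: verts_simps point_eq_iff)
    thus ?thesis using * D by auto
  qed (use assms(3) z in \<open>auto simp: verts_simps\<close>)
qed

lemma link_connected:
  assumes "t \<in> T" "t' \<in> T" "v \<in> verts t" "v \<in> verts t'"
  shows "(t, t') \<in> (adj v)\<^sup>*"
proof -
  have "(\<exists>j m. j < 3 \<and> m < N j \<and> (v = L j m \<or> v = R j m)) \<or>
        (\<exists>j. j < 3 \<and> (v = L j (N j) \<or> v = R j (N j))) \<or> v = ap 0 \<or> v = ap 1"
  proof -
    have *: "m < N j \<or> m = N j" if "m \<le> N j" for m j using that by linarith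
    have "(\<exists>j m. j < 3 \<and> m \<le> N j \<and> (v = L j m \<or> v = R j m)) \<or> v = ap 0 \<or> v = ap 1"
      using assms(1)
    proof (cases rule: T_cases6)
      case (D0o j)
      have "j < 3" "Suc j < 3" using D0o by auto
      moreover have "v = L (Suc j) 0 \<or> v = R j 0 \<or> v = ap 0" using assms(3) D0o(3) by simp
      ultimately show ?thesis by blast
    next
      case (D1o j)
      have "j < 3" "Suc j < 3" using D1o by auto
      thus ?thesis using assms(3) D1o(3) by auto
    qed (use assms(3) in \<open>auto simp: Suc_le_eq verts_all\<close>)
    thus ?thesis using * by blast
  qed
  then obtain c where "(t, c) \<in> (adj v)\<^sup>*" "(t', c) \<in> (adj v)\<^sup>*"
    using link_interior[of _ _ v t] link_interior[of _ _ v t'] link_top[of _ _ v t] link_top[of _ _ v t']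
      link_apex[of _ t] link_apex[of _ t'] assms N_pred by metis
  moreover have "(c, t') \<in> (adj v)\<^sup>*"
    using symE[OF sym_rtrancl[OF sym_adj] \<open>(t', c) \<in> (adj v)\<^sup>*\<close>] .
  ultimately show ?thesis by (meson rtrancl_trans)
qed

lemma T_connected:
  assumes "t \<in> T" "t' \<in> T"
  shows "(t, t') \<in> {(u, u'). u \<in> T \<and> u' \<in> T \<and> verts u \<inter> verts u' \<noteq> {}}\<^sup>*" (is "_ \<in> ?r\<^sup>*")
proof -
  have step: "(u, c) \<in> ?r\<^sup>*" if "u \<in> T" "u' \<in> T" "w \<in> verts u" "w \<in> verts u'" "(u', c) \<in> ?r\<^sup>*" for u u' w c
    by (rule converse_rtrancl_into_rtrancl[OF _ that(5)]) (use that in auto)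
  note mem = T_mem(3,4) T_mem6
  have AB: "(A j m, D 0 0) \<in> ?r\<^sup>* \<and> (B j m, D 0 0) \<in> ?r\<^sup>*" if "j < 3" "m < N j" for j m
    using that(2)
  proof (induction m)
    case 0
    have D: "(D 0 (2 * j), D 0 0) \<in> ?r\<^sup>*"
      by (rule step[of _ "D 0 0" "ap 0"]) (use T_mem(1)[of 0] T_mem6(1)[of j] that in \<open>auto simp: verts_simps\<close>)
    have "(A j 0, D 0 0) \<in> ?r\<^sup>*"
      by (rule step[of _ "D 0 (2 * j)" "L j 0"]) (use D mem that 0 in \<open>auto simp: verts_all\<close>)
    moreover from this have "(B j 0, D 0 0) \<in> ?r\<^sup>*"
      by (rule step[of _ "A j 0" "L j 0", rotated 4]) (use mem that 0 in \<open>auto simp: verts_all\<close>)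
    ultimately show ?case by blast
  next
    case (Suc m)
    hence B: "(B j m, D 0 0) \<in> ?r\<^sup>*" by simp
    have "(A j (Suc m), D 0 0) \<in> ?r\<^sup>*"
      by (rule step[of _ "B j m" "L j (Suc m)"]) (use B mem that Suc in \<open>auto simp: verts_all\<close>)
    moreover have "(B j (Suc m), D 0 0) \<in> ?r\<^sup>*"
      by (rule step[of _ "B j m" "L j (Suc m)"]) (use B mem that Suc in \<open>auto simp: verts_all\<close>)
    ultimately show ?case by blast
  qed
  have all: "(u, D 0 0) \<in> ?r\<^sup>*" if "u \<in> T" for u
    using that
  proof (cases rule: T_cases)
    case (D z k)
    show ?thesis
    proof (cases "z = 0")
      case True
      show ?thesis
        by (rule step[of _ "D 0 0" "ap 0"]) (use True D T_mem(1)[of 0] T_mem(1)[of k] in \<open>auto simp: verts_simps\<close>)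
    next
      case False
      \<comment> \<open>The top disk is connected to the bottom one through the last layer of band
        0.\<close>
      obtain n where n: "N 0 = Suc n" using N_pred by blast
      have "(D 1 0, D 0 0) \<in> ?r\<^sup>*"
        by (rule step[of _ "B 0 n" "L 0 (N 0)"])
          (use AB[of 0 n] n T_mem(2)[of 0] T_mem(4)[of 0 n] verts_D(3)[of 0] in \<open>auto simp: verts_simps(2)\<close>)
      thus ?thesis
        by (rule step[of _ "D 1 0" "ap 1", rotated 4])
          (use D T_mem(2)[of 0] T_mem(2)[of k] False in \<open>auto simp: verts_simps\<close>)
    qed
  qed (use AB in auto)
  have "sym ?r" by (auto simp: sym_def)
  hence "sym (?r\<^sup>*)" by (rule sym_rtrancl)
  thus ?thesis using all[OF assms(1)] all[OF assms(2)] by (meson rtrancl_trans symE)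
qed

lemma oriented_surface_T: "oriented_surface T"
  unfolding oriented_surface_def
proof (intro conjI)
  show "T \<noteq> {}" using T_mem(1)[of 0] by auto
  show "\<forall>t\<in>T. normal t \<noteq> 0"
  proof
    fix t assume t: "t \<in> T"
    obtain v where "v \<in> verts t" by (cases t) auto
    thus "normal t \<noteq> 0" using nu_normal_pos[OF t] by force
  qed
  show "\<forall>v. \<forall>t\<in>T. \<forall>t'\<in>T. v \<in> verts t \<inter> verts t' \<longrightarrow>
    (t, t') \<in> {(u, u'). u \<in> T \<and> u' \<in> T \<and> v \<in> verts u \<inter> verts u' \<and> 2 \<le> card (verts u \<inter> verts u')}\<^sup>*"
    using link_connected unfolding adj_def by blast
qed (use finite_T inj_on_verts triangles_Int directed_edges_disjoint T_connected in blast)+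

end

section \<open>Crossings and strands\<close>

definition signed_crossing :: "point \<Rightarrow> edge \<Rightarrow> edge \<Rightarrow> int" where
  "signed_crossing u e f = (if crosses_over u e f then crossing_sign u e f else 0)"

lemma general_position_rev:
  "general_position u (b, a) f \<longleftrightarrow> general_position u (a, b) f"
  "general_position u e (d, c) \<longleftrightarrow> general_position u e (c, d)"
proof -
  have "cross3 (a - b) v = - cross3 (b - a) v" "cross3 v (c - d) = - cross3 v (d - c)" for v
    by (metis cross_minus_left minus_diff_eq, metis cross_minus_right minus_diff_eq)
  thus "general_position u (b, a) f \<longleftrightarrow> general_position u (a, b) f"
    "general_position u e (d, c) \<longleftrightarrow> general_position u e (c, d)"
    by (cases f; simp add: closed_segment_commute open_segment_commute)
       (cases e; simp add: \<open>\<And>v. cross3 v (c - d) = - cross3 v (d - c)\<close> closed_segment_commute open_segment_commute)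
qed

text \<open>Reversal preserves over and under and negates one direction vector. With
  \<open>general_position_rev\<close> this reduces the descending half of a loop to ascending
  edges.\<close>

lemma signed_crossing_rev:
  "signed_crossing u (b, a) f = - signed_crossing u (a, b) f"
  "signed_crossing u e (d, c) = - signed_crossing u e (c, d)"
proof -
  have 1: "cross3 (a - b) v = - cross3 (b - a) v" for v
    by (metis cross_minus_left minus_diff_eq)
  have 2: "cross3 v (c - d) = - cross3 v (d - c)" for v
    by (metis cross_minus_right minus_diff_eq)
  show "signed_crossing u (b, a) f = - signed_crossing u (a, b) f"
    by (cases f) (simp add: signed_crossing_def open_segment_commute[of b a] 1 Let_def)
  show "signed_crossing u e (d, c) = - signed_crossing u e (c, d)"
    by (cases e) (simp add: signed_crossing_def open_segment_commute[of d c] 2 Let_def)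
qed

text \<open>All linking numbers are computed in the projection to the first and third coordinates.\<close>

definition view :: point where "view = vec3 0 (-1) 0"

lemma view_eq_iff: "x - y = \<tau> *\<^sub>R view \<longleftrightarrow> cx x = cx y \<and> cz x = cz y \<and> \<tau> = cy y - cy x"
  by (auto simp: point_eq_iff view_def)

section \<open>Coincidences of edges in the projection\<close>

lemma no_coincidence:
  assumes "\<And>x y. x \<in> closed_segment a b \<Longrightarrow> y \<in> closed_segment c d \<Longrightarrow> cx x = cx y \<Longrightarrow> cz x = cz y \<Longrightarrow> False"
  shows "general_position view (a, b) (c, d) \<and> signed_crossing view (a, b) (c, d) = 0"
proof -
  have "\<not> crosses_over view (a, b) (c, d)"
  proof
    assume "crosses_over view (a, b) (c, d)"
    then obtain x y \<tau> where xy: "x \<in> open_segment a b" "y \<in> open_segment c d" "x - y = \<tau> *\<^sub>R view"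
      by auto
    hence "x \<in> closed_segment a b" "y \<in> closed_segment c d" using segment_open_subset_closed by blast+
    thus False using assms xy(3) by (auto simp: view_eq_iff)
  qed
  thus ?thesis using assms by (auto simp: signed_crossing_def view_eq_iff simp del: crosses_over.simps)
qed

lemma closed_segment_coords:
  assumes "x \<in> closed_segment a b"
  obtains s where "0 \<le> s" "s \<le> 1" "x = (1 - s) *\<^sub>R a + s *\<^sub>R b" "cx x = (1 - s) * cx a + s * cx b"
    "cy x = (1 - s) * cy a + s * cy b" "cz x = (1 - s) * cz a + s * cz b"
proof -
  obtain s where "0 \<le> s" "s \<le> 1" "x = (1 - s) *\<^sub>R a + s *\<^sub>R b"
    using assms by (auto simp: closed_segment_def)
  thus thesis using that[of s] by simp
qed

lemma closed_segment_cx_bound: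
  assumes "x \<in> closed_segment a b" "\<bar>cx a - c\<bar> \<le> d" "\<bar>cx b - c\<bar> \<le> d"
  shows "\<bar>cx x - c\<bar> \<le> d"
proof -
  obtain s where s: "0 \<le> s" "s \<le> 1" "cx x = (1 - s) * cx a + s * cx b"
    using closed_segment_coords[OF assms(1)] by metis
  have "(1 - s) * cx a + s * cx b \<le> c + d"
    by (rule convex_bound_le) (use s assms in auto)
  moreover have "(1 - s) * (- cx a) + s * (- cx b) \<le> d - c"
    by (rule convex_bound_le) (use s assms in auto)
  ultimately show ?thesis using s(3) by (simp add: abs_le_iff)
qed

text \<open>The two height ranges have at most an end in common. A coincidence would have to occur
  at that height, hence at an end of each edge, and there the first coordinates differ.\<close>

lemma no_coincidence_levels:
  assumes "cz a < cz b" "cz c < cz d"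
    and "(cz b \<le> cz c \<and> (cz b = cz c \<longrightarrow> cx b \<noteq> cx c)) \<or> (cz d \<le> cz a \<and> (cz d = cz a \<longrightarrow> cx d \<noteq> cx a))"
  shows "general_position view (a, b) (c, d) \<and> signed_crossing view (a, b) (c, d) = 0"
proof (rule no_coincidence)
  fix x y assume xy: "x \<in> closed_segment a b" "y \<in> closed_segment c d" "cx x = cx y" "cz x = cz y"
  obtain s where s: "0 \<le> s" "s \<le> 1" "x = (1 - s) *\<^sub>R a + s *\<^sub>R b" "cz x = (1 - s) * cz a + s * cz b"
    using closed_segment_coords[OF xy(1)] by metis
  obtain r where r: "0 \<le> r" "r \<le> 1" "y = (1 - r) *\<^sub>R c + r *\<^sub>R d" "cz y = (1 - r) * cz c + r * cz d"
    using closed_segment_coords[OF xy(2)] by metis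
  have xb: "cz x = cz b - (1 - s) * (cz b - cz a)" "cz x = cz a + s * (cz b - cz a)"
    unfolding s(4) by (simp_all add: algebra_simps)
  have yc: "cz y = cz c + r * (cz d - cz c)" "cz y = cz d - (1 - r) * (cz d - cz c)"
    unfolding r(4) by (simp_all add: algebra_simps)
  have n: "(1 - s) * (cz b - cz a) \<ge> 0" "s * (cz b - cz a) \<ge> 0" "r * (cz d - cz c) \<ge> 0" "(1 - r) * (cz d - cz c) \<ge> 0"
    using s r assms(1,2) by simp_all
  have squeeze: "p = 0 \<and> q = 0 \<and> u = v" if "0 \<le> p" "0 \<le> q" "u \<le> v" "u - p = v + q" for p q u v :: real
    using that by linarith
  from assms(3) show False
  proof
    assume le: "cz b \<le> cz c \<and> (cz b = cz c \<longrightarrow> cx b \<noteq> cx c)"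
    hence "(1 - s) * (cz b - cz a) = 0 \<and> r * (cz d - cz c) = 0 \<and> cz b = cz c"
      using squeeze[OF n(1,3) _ trans[OF xb(1)[symmetric] trans[OF xy(4) yc(1)]]] by blast
    moreover from this have "s = 1" "r = 0" using assms(1,2) by auto
    ultimately show False using s(3) r(3) le xy(3) by simp
  next
    assume le: "cz d \<le> cz a \<and> (cz d = cz a \<longrightarrow> cx d \<noteq> cx a)"
    hence "(1 - r) * (cz d - cz c) = 0 \<and> s * (cz b - cz a) = 0 \<and> cz d = cz a"
      using squeeze[OF n(4,2) _ trans[OF yc(2)[symmetric] trans[OF xy(4)[symmetric] xb(2)]]] by blast
    moreover from this have "s = 0" "r = 1" using assms(1,2) by auto
    ultimately show False using s(3) r(3) le xy(3) by simp
  qed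
qed

text \<open>Two edges that span the same range of heights meet in the projection exactly when their
  horizontal order changes between the two ends.\<close>

lemma signed_crossing_same_levels:
  assumes z: "cz c = cz a" "cz d = cz b" "cz a < cz b"
    and D: "cx a \<noteq> cx c" "cx b \<noteq> cx d"
    and E: "(cx a < cx c) = (cx b < cx d) \<or> (cy a < cy c \<and> cy b < cy d) \<or> (cy a > cy c \<and> cy b > cy d)"
  shows "general_position view (a, b) (c, d)"
    "signed_crossing view (a, b) (c, d) =
      (if (cx a < cx c) \<noteq> (cx b < cx d) \<and> cy a < cy c then if cx a < cx c then 1 else -1 else 0)"
proof -
  define D0 D1 E0 E1 where "D0 = cx a - cx c" "D1 = cx b - cx d" "E0 = cy a - cy c" "E1 = cy b - cy d"
  note defs = D0_D1_E0_E1_def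
  have D': "D0 \<noteq> 0" "D1 \<noteq> 0" using D by (auto simp: defs)
  have coin: "\<exists>s. 0 < s \<and> s < 1 \<and> x = (1 - s) *\<^sub>R a + s *\<^sub>R b \<and> y = (1 - s) *\<^sub>R c + s *\<^sub>R d \<and>
      (D0 < 0) \<noteq> (D1 < 0) \<and> cy x - cy y = (1 - s) * E0 + s * E1"
    if xy: "x \<in> closed_segment a b" "y \<in> closed_segment c d" "cx x = cx y" "cz x = cz y" for x y
  proof -
    obtain s where s: "0 \<le> s" "s \<le> 1" "x = (1 - s) *\<^sub>R a + s *\<^sub>R b" "cz x = (1 - s) * cz a + s * cz b"
      using closed_segment_coords[OF xy(1)] by metis
    obtain r where r: "0 \<le> r" "r \<le> 1" "y = (1 - r) *\<^sub>R c + r *\<^sub>R d" "cz y = (1 - r) * cz c + r * cz d"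
      using closed_segment_coords[OF xy(2)] by metis
    \<comment> \<open>Equal height ranges force equal parameters on both edges, so the horizontal
      difference is a single linear interpolation between \<open>D0\<close> and
      \<open>D1\<close>.\<close>
    have "(s - r) * (cz b - cz a) = cz x - cz y" unfolding s(4) r(4) z by (simp add: algebra_simps)
    hence rs: "r = s" using xy(4) z(3) by simp
    have eq: "(1 - s) * D0 + s * D1 = 0"
      using xy(3) unfolding s(3) r(3) rs defs by (simp add: algebra_simps)
    have "s \<noteq> 0" "s \<noteq> 1" using eq D' by auto
    hence s01: "0 < s" "s < 1" using s by auto
    have "(D0 < 0) \<noteq> (D1 < 0)"
    proof (cases "D0 < 0")
      case True
      hence "(1 - s) * D0 < 0" using s01 by (simp add: mult_pos_neg)
      hence "s * D1 > 0" using eq by linarith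
      thus ?thesis using s01 True by (simp add: zero_less_mult_iff)
    next
      case False
      hence "(1 - s) * D0 > 0" using s01 D' by simp
      hence "s * D1 < 0" using eq by linarith
      thus ?thesis using s01 False by (simp add: mult_less_0_iff)
    qed
    moreover have "cy x - cy y = (1 - s) * E0 + s * E1"
      unfolding s(3) r(3) rs defs by (simp add: algebra_simps)
    ultimately show ?thesis using s01 s(3) r(3) rs by blast
  qed
  have ab: "a \<noteq> b" "c \<noteq> d" using z by auto
  have Epos: "(1 - s) * E0 + s * E1 > 0" if "0 < s" "s < 1" "E0 > 0" "E1 > 0" for s
    using that by (simp add: add_pos_pos)
  have Eneg: "(1 - s) * E0 + s * E1 < 0" if "0 < s" "s < 1" "E0 < 0" "E1 < 0" for s
    using that by (simp add: add_neg_neg mult_pos_neg)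
  have E': "(E0 < 0 \<and> E1 < 0) \<or> (E0 > 0 \<and> E1 > 0)" if "(D0 < 0) \<noteq> (D1 < 0)"
    using E that by (auto simp: defs)
  have inner: "inner (cross3 (b - a) (d - c)) view = (cz b - cz a) * (D1 - D0)"
    using z by (simp add: inner_coords cross3_coords view_def defs algebra_simps)
  show gp: "general_position view (a, b) (c, d)"
    unfolding general_position.simps
  proof (intro ballI allI impI)
    fix x y \<tau> assume xy: "x \<in> closed_segment a b" "y \<in> closed_segment c d" "x - y = \<tau> *\<^sub>R view"
    hence c: "cx x = cx y" "cz x = cz y" "\<tau> = cy y - cy x" by (auto simp: view_eq_iff)
    obtain s where s: "0 < s" "s < 1" "x = (1 - s) *\<^sub>R a + s *\<^sub>R b" "y = (1 - s) *\<^sub>R c + s *\<^sub>R d"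
      "(D0 < 0) \<noteq> (D1 < 0)" "cy x - cy y = (1 - s) * E0 + s * E1"
      using coin[OF xy(1,2) c(1,2)] by blast
    have "x \<in> open_segment a b" "y \<in> open_segment c d" using s ab by (auto simp: in_segment)
    moreover have "\<tau> \<noteq> 0" using E'[OF s(5)] Epos[OF s(1,2)] Eneg[OF s(1,2)] s(6) c(3) by fastforce
    moreover have "inner (cross3 (b - a) (d - c)) view \<noteq> 0" unfolding inner using z(3) s(5) D' by auto
    ultimately show "x \<in> open_segment a b \<and> y \<in> open_segment c d \<and> \<tau> \<noteq> 0 \<and> inner (cross3 (b - a) (d - c)) view \<noteq> 0"
      by blast
  qed
  have over: "crosses_over view (a, b) (c, d) \<longleftrightarrow> (D0 < 0) \<noteq> (D1 < 0) \<and> E0 < 0"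
  proof
    assume "crosses_over view (a, b) (c, d)"
    then obtain x y \<tau> where xy: "x \<in> open_segment a b" "y \<in> open_segment c d" "\<tau> > 0" "x - y = \<tau> *\<^sub>R view"
      by auto
    hence c: "cx x = cx y" "cz x = cz y" "\<tau> = cy y - cy x" by (auto simp: view_eq_iff)
    have "x \<in> closed_segment a b" "y \<in> closed_segment c d" using xy segment_open_subset_closed by blast+
    then obtain s where s: "0 < s" "s < 1"
      "(D0 < 0) \<noteq> (D1 < 0)" "cy x - cy y = (1 - s) * E0 + s * E1"
      using coin c(1,2) by blast
    have "E0 < 0" using E'[OF s(3)] Epos[OF s(1,2)] s(4) c(3) xy(3) by fastforce
    thus "(D0 < 0) \<noteq> (D1 < 0) \<and> E0 < 0" using s by blast
  next
    assume a: "(D0 < 0) \<noteq> (D1 < 0) \<and> E0 < 0"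
    \<comment> \<open>The zero of the interpolation between \<open>D0\<close> and \<open>D1\<close>;
      it lies strictly inside because their signs differ.\<close>
    define s where "s = D0 / (D0 - D1)"
    have s: "0 < s" "s < 1" "(1 - s) * D0 + s * D1 = 0"
      using a D' by (auto simp: s_def field_simps)
    have "E1 < 0" using E' a by force
    hence E: "(1 - s) * E0 + s * E1 < 0" using Eneg s a by blast
    let ?x = "(1 - s) *\<^sub>R a + s *\<^sub>R b" and ?y = "(1 - s) *\<^sub>R c + s *\<^sub>R d"
    have "?x \<in> open_segment a b" "?y \<in> open_segment c d" using s ab by (auto simp: in_segment)
    moreover have "?x - ?y = (- ((1 - s) * E0 + s * E1)) *\<^sub>R view"
      unfolding view_eq_iff using s(3) z by (simp add: defs algebra_simps)
    moreover have "- ((1 - s) * E0 + s * E1) > 0" using E by simp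
    ultimately show "crosses_over view (a, b) (c, d)" unfolding crosses_over.simps by blast
  qed
  have sign: "crossing_sign view (a, b) (c, d) = (if D0 < 0 then 1 else -1)" if "(D0 < 0) \<noteq> (D1 < 0)"
  proof -
    show ?thesis
    proof (cases "D0 < 0")
      case True
      hence "(cz b - cz a) * (D1 - D0) > 0" using that z(3) by simp
      thus ?thesis using True inner by (simp add: Let_def)
    next
      case False
      hence "(cz b - cz a) * (D1 - D0) < 0" using that z(3) D' by (simp add: mult_pos_neg)
      thus ?thesis using False inner by (simp add: Let_def)
    qed
  qed
  have "signed_crossing view (a, b) (c, d) = (if (D0 < 0) \<noteq> (D1 < 0) \<and> E0 < 0 then if D0 < 0 then 1 else -1 else 0)"
    unfolding signed_crossing_def over using sign by simp
  thus "signed_crossing view (a, b) (c, d) =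
      (if (cx a < cx c) \<noteq> (cx b < cx d) \<and> cy a < cy c then if cx a < cx c then 1 else -1 else 0)"
    by (simp add: defs)
qed

text \<open>When \<open>f 0 = g 0\<close> and \<open>f p = g q\<close>, this closed polygon follows \<open>f\<close> to \<open>f p\<close> and returns along \<open>g\<close>.\<close>

definition digon :: "(nat \<Rightarrow> 'a) \<Rightarrow> nat \<Rightarrow> (nat \<Rightarrow> 'a) \<Rightarrow> nat \<Rightarrow> 'a list" where
  "digon f p g q = map f [0..<p] @ map (\<lambda>i. g (q - i)) [0..<q]"

lemma map_digon: "map k (digon f p g q) = digon (\<lambda>i. k (f i)) p (\<lambda>i. k (g i)) q"
  by (simp add: digon_def o_def)

text \<open>The list contains neither the entry for \<open>f p\<close> nor the one for
  \<open>g 0\<close>: the former is the first entry \<open>g q\<close> of the second half, and the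
  wrap-around closes the polygon at \<open>f 0\<close>.\<close>

lemma closed_edges_digon:
  assumes "f 0 = g 0" "f p = g q" "p > 0" "q > 0"
  shows "closed_edges (digon f p g q) =
    map (\<lambda>i. (f i, f (Suc i))) [0..<p] @ map (\<lambda>i. (g (q - i), g (q - Suc i))) [0..<q]"
proof (rule nth_equalityI)
  fix i assume "i < length (closed_edges (digon f p g q))"
  hence i: "i < p + q" by (simp add: closed_edges_def digon_def)
  have n: "digon f p g q ! k = (if k < p then f k else g (q - (k - p)))" if "k < p + q" for k
    using that by (auto simp: digon_def nth_append)
  have l: "length (digon f p g q) = p + q" by (simp add: digon_def)
  have "closed_edges (digon f p g q) ! i = (digon f p g q ! i, digon f p g q ! (Suc i mod (p + q)))"
    using i l by (simp add: closed_edges_def nth_rotate1)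
  also have "\<dots> = (map (\<lambda>i. (f i, f (Suc i))) [0..<p] @ map (\<lambda>i. (g (q - i), g (q - Suc i))) [0..<q]) ! i"
  proof (cases "Suc i = p + q")
    case True
    thus ?thesis using assms n[of i] n[of 0] by (auto simp: nth_append)
  next
    case False
    hence "Suc i < p + q" using i by simp
    consider "Suc i < p" | "Suc i = p" | "p \<le> i" by linarith
    thus ?thesis
      using \<open>Suc i < p + q\<close> assms n[of i] n[of "Suc i"] i
      by cases (auto simp: nth_append Suc_diff_le)
  qed
  finally show "closed_edges (digon f p g q) ! i =
    (map (\<lambda>i. (f i, f (Suc i))) [0..<p] @ map (\<lambda>i. (g (q - i), g (q - Suc i))) [0..<q]) ! i" .
qed (simp add: closed_edges_def digon_def)

text \<open>Any antisymmetric function is allowed because this serves twice, for signed crossings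
  and for the edge counts in \<open>loop_chain\<close>.\<close>

lemma sum_list_closed_edges_digon:
  fixes h :: "'a \<times> 'a \<Rightarrow> int"
  assumes "f 0 = g 0" "f p = g q" "p > 0" "q > 0" and h: "\<And>a b. h (b, a) = - h (a, b)"
  shows "(\<Sum>e\<leftarrow>closed_edges (digon f p g q). h e) = (\<Sum>i<p. h (f i, f (Suc i))) - (\<Sum>i<q. h (g i, g (Suc i)))"
proof -
  have "(\<Sum>i<q. h (g (q - i), g (q - Suc i))) = (\<Sum>i<q. h (g (Suc (q - Suc i)), g (q - Suc i)))"
    by (rule sum.cong) (auto simp: Suc_diff_Suc)
  also have "\<dots> = (\<Sum>i<q. h (g (Suc i), g i))" by (rule sum.nat_diff_reindex)
  also have "\<dots> = - (\<Sum>i<q. h (g i, g (Suc i)))" unfolding sum_negf[symmetric] by (rule sum.cong) (auto intro: h)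
  finally show ?thesis
    unfolding closed_edges_digon[OF assms(1-4)]
    by (simp add: o_def interv_sum_list_conv_sum_set_nat atLeast0LessThan)
qed

lemma set_closed_edges_digon:
  assumes "f 0 = g 0" "f p = g q" "p > 0" "q > 0"
  shows "set (closed_edges (digon f p g q)) =
    (\<lambda>i. (f i, f (Suc i))) ` {..<p} \<union> (\<lambda>i. (g (Suc i), g i)) ` {..<q}"
proof -
  have "(\<lambda>i. (g (q - i), g (q - Suc i))) ` {0..<q} = (\<lambda>i. (g (Suc i), g i)) ` {..<q}"
  proof (intro subset_antisym subsetI)
    fix e assume "e \<in> (\<lambda>i. (g (q - i), g (q - Suc i))) ` {0..<q}"
    then obtain i where "i < q" "e = (g (q - i), g (q - Suc i))" by auto
    thus "e \<in> (\<lambda>i. (g (Suc i), g i)) ` {..<q}" by (intro image_eqI[of _ _ "q - Suc i"]) (auto simp: Suc_diff_Suc)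
  next
    fix e assume "e \<in> (\<lambda>i. (g (Suc i), g i)) ` {..<q}"
    then obtain i where "i < q" "e = (g (Suc i), g i)" by auto
    thus "e \<in> (\<lambda>i. (g (q - i), g (q - Suc i))) ` {0..<q}" by (intro image_eqI[of _ _ "q - Suc i"]) auto
  qed
  thus ?thesis unfolding closed_edges_digon[OF assms] by (simp add: atLeast0LessThan)
qed

text \<open>The sine is 1 at the levels 1 mod 4. For \<open>n = 2 * k + 1\<close> the range consists
  of \<open>k\<close> full periods and the first half of another, which contains one more such
  level.\<close>

lemma sum_qsin_eq_1: "odd n \<Longrightarrow> (\<Sum>m<2 * n. if qsin m = 1 then 1 else 0) = (int n + 1) div 2"
proof -
  have "(\<Sum>m<4 * k + 2. if qsin m = 1 then 1 else 0) = int k + 1" for k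
  proof (induction k)
    case 0
    show ?case by (simp add: eval_nat_numeral)
  next
    case (Suc k)
    have "4 * Suc k + 2 = Suc (Suc (Suc (Suc (4 * k + 2))))" by simp
    thus ?case using Suc by (cases rule: qcos_qsin_cases[of "4 * k + 2"]) (simp_all only: sum.lessThan_Suc, simp_all)
  qed
  moreover assume "odd n"
  then obtain k where "n = 2 * k + 1" by (rule oddE)
  ultimately show ?thesis by (simp add: algebra_simps)
qed

section \<open>Linking numbers of strands and loops\<close>

context pretzel
begin

text \<open>The strand of a band runs from the bottom apex to the top apex along the left edge of the band.\<close>

definition strand :: "nat \<Rightarrow> nat \<Rightarrow> point" where
  "strand j i = (if i = 0 then ap 0 else if i \<le> Suc (N j) then L j (i - 1) else ap 1)"

abbreviation shift :: "point \<Rightarrow> point" where "shift v \<equiv> v + nu v"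

lemma strand_cases:
  assumes "i < N j + 2"
  obtains (0) "i = 0" "strand j i = ap 0" "strand j (Suc i) = L j 0"
  | (1) m where "i = Suc m" "m < N j" "strand j i = L j m" "strand j (Suc i) = L j (Suc m)"
  | (2) "i = Suc (N j)" "strand j i = L j (N j)" "strand j (Suc i) = ap 1"
proof -
  consider "i = 0" | "i = Suc (N j)" | "i \<noteq> 0" "i \<noteq> Suc (N j)" by blast
  thus thesis
  proof cases
    case 1 thus thesis using that(1) by (simp add: strand_def)
  next
    case 2 thus thesis using that(3) by (simp add: strand_def)
  next
    case 3
    then obtain m where "i = Suc m" by (cases i) auto
    thus thesis using 3 assms that(2)[of m] by (simp add: strand_def)
  qed
qed

definition strand_crossing :: "nat \<Rightarrow> nat \<Rightarrow> nat \<Rightarrow> nat \<Rightarrow> int" where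
  "strand_crossing j i k l =
    signed_crossing view (strand j i, strand j (Suc i)) (shift (strand k l), shift (strand k (Suc l)))"

text \<open>The shift of a left edge turns with the band, so the strand crosses its own push-off once per
  half-twist, alternately over and under. In the bottom disk the push-off is in front, so that only
  the crossings in the top disk count.\<close>

lemma strand_crossing:
  assumes "i < N j + 2" "l < N k + 2"
  shows "general_position view (strand j i, strand j (Suc i)) (shift (strand k l), shift (strand k (Suc l)))
    \<and> strand_crossing j i k l =
      (if i = Suc (N j) \<and> l = Suc (N k) \<and> (j < k \<or> j = k \<and> sg j = -1) then 1
       else if j = k \<and> l = i \<and> i > 0 \<and> i \<le> N j \<and> qsin (i - 1) = 1 then sgn (h j) else 0)"
  unfolding strand_crossing_def
proof -
  have jk: "real j \<le> real k - 1 \<or> j = k \<or> real j \<ge> real k + 1" by linarith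
  have sgj: "sgn (h j) = (if sg j = 1 then 1 else -1)"
    using h_nz[of j] by (simp add: sg_def sgn_if)
  have lt: "real m / real n < real (Suc m) / real n" if "n > 0" for m n using that by (simp add: divide_strict_right_mono)
  let ?val = "if i = Suc (N j) \<and> l = Suc (N k) \<and> (j < k \<or> j = k \<and> sg j = -1) then 1
       else if j = k \<and> l = i \<and> i > 0 \<and> i \<le> N j \<and> qsin (i - 1) = 1 then sgn (h j) else 0 :: int"
  let ?goal = "general_position view (strand j i, strand j (Suc i)) (shift (strand k l), shift (strand k (Suc l))) \<and>
    signed_crossing view (strand j i, strand j (Suc i)) (shift (strand k l), shift (strand k (Suc l))) = ?val"
  have nul: "cx (nu (L k m)) = 1/4 \<or> cx (nu (L k m)) = -1/4" for k m
    by (cases rule: sg_cases[of k]; cases rule: qcos_qsin_cases[of m]) auto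
  have neq0: "3 * real j - 1 \<noteq> 3 * real k - 1 + sg k / 4"
    using jk by (cases rule: sg_cases[of k]) auto
  have neq1: "3 * real j + 1 \<noteq> 3 * real k + 1 - sg k / 4"
    using jk by (cases rule: sg_cases[of k]) auto
  \<comment> \<open>At the top apex the push-off is a quarter to the left of the strand, so the last
    edges cross in the projection exactly if the order at their lower ends is the opposite
    one.\<close>
  have sk: "3 * real j + 1 < 3 * real k + 1 - sg k / 4 \<longleftrightarrow> j < k \<or> j = k \<and> sg j = -1"
    using jk by (cases rule: sg_cases[of k]; cases rule: sg_cases[of j]) auto
  have top: "cz (L j (Suc m)) \<le> 1 \<and> (cz (L j (Suc m)) = 1 \<longrightarrow> Suc m = N j \<and> cx (L j (Suc m)) = 3 * real j + 1)"
    if "m < N j" for j m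
  proof -
    have "cz (L j (Suc m)) \<le> 1" using that by (simp add: divide_le_eq)
    moreover have "Suc m = N j" if "cz (L j (Suc m)) = 1" using that by (simp add: divide_eq_eq)
    moreover have "cx (L j (Suc m)) = 3 * real j + 1" if "Suc m = N j" unfolding that by (simp add: qcos_qsin_N)
    ultimately show ?thesis by blast
  qed
  show ?goal
    using assms(1)
  proof (cases rule: strand_cases)
    case i: 0
    show ?thesis using assms(2)
    proof (cases rule: strand_cases)
      case l: 0
      have gp: "general_position view (strand j i, strand j (Suc i)) (shift (strand k l), shift (strand k (Suc l)))"
        unfolding i(2-) l(2-) by (rule signed_crossing_same_levels(1)) (use neq0 in auto)
      have "signed_crossing view (strand j i, strand j (Suc i)) (shift (strand k l), shift (strand k (Suc l))) = 0"
        unfolding i(2-) l(2-) by (subst signed_crossing_same_levels(2)) (use neq0 in auto)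
      thus ?thesis using gp i(1) l(1) by (simp del: general_position.simps nu_simps)
    next
      case l: (1 n)
      have "general_position view (strand j i, strand j (Suc i)) (shift (strand k l), shift (strand k (Suc l))) \<and>
        signed_crossing view (strand j i, strand j (Suc i)) (shift (strand k l), shift (strand k (Suc l))) = 0"
        unfolding i(2-) l(2-) by (rule no_coincidence_levels) (use neq0 lt[of "N k" n] in auto)
      thus ?thesis using i by (simp del: general_position.simps nu_simps)
    next
      case l: 2
      have "general_position view (strand j i, strand j (Suc i)) (shift (strand k l), shift (strand k (Suc l))) \<and>
        signed_crossing view (strand j i, strand j (Suc i)) (shift (strand k l), shift (strand k (Suc l))) = 0"
        unfolding i(2-) l(2-) by (rule no_coincidence_levels) auto
      thus ?thesis using i by (simp del: general_position.simps nu_simps)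
    qed
  next
    case i: (1 m)
    show ?thesis using assms(2)
    proof (cases rule: strand_cases)
      case l: 0
      have "general_position view (strand j i, strand j (Suc i)) (shift (strand k l), shift (strand k (Suc l))) \<and>
        signed_crossing view (strand j i, strand j (Suc i)) (shift (strand k l), shift (strand k (Suc l))) = 0"
        unfolding i(2-) l(2-) by (rule no_coincidence_levels) (use neq0 lt[of "N j" m] in auto)
      thus ?thesis using i l by (auto simp del: general_position.simps nu_simps)
    next
      case l: (1 n)
      show ?thesis
      proof (cases "j = k \<and> m = n")
        case True
        have gp: "general_position view (L j m, L j (Suc m)) (shift (L j m), shift (L j (Suc m)))"
          by (rule signed_crossing_same_levels(1); cases rule: sg_cases[of j]; cases rule: qcos_qsin_cases[of m])
            (use lt[of "N j" m] in auto)
        \<comment> \<open>The horizontal displacement changes sign between levels \<open>m\<close>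
          and \<open>Suc m\<close> exactly if the sine is 1 or -1; in the first case the push-off is
          behind the strand.\<close>
        have "signed_crossing view (L j m, L j (Suc m)) (shift (L j m), shift (L j (Suc m))) =
          (if qsin m = 1 then sgn (h j) else 0)"
          by (subst signed_crossing_same_levels(2); cases rule: sg_cases[of j]; cases rule: qcos_qsin_cases[of m])
            (use lt[of "N j" m] in \<open>auto simp: sgj\<close>)
        thus ?thesis using gp i l True by (simp del: general_position.simps nu_simps)
      next
        case False
        have "general_position view (strand j i, strand j (Suc i)) (shift (strand k l), shift (strand k (Suc l))) \<and>
          signed_crossing view (strand j i, strand j (Suc i)) (shift (strand k l), shift (strand k (Suc l))) = 0"
        proof (cases "j = k")
          case True
          hence mn: "m < n \<or> n < m" using False by auto
          have le: "real (Suc m) / real (N j) \<le> real n / real (N j)" if "m < n"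
            using that by (intro divide_right_mono) auto
          have le': "real (Suc n) / real (N j) \<le> real m / real (N j)" if "n < m"
            using that by (intro divide_right_mono) auto
          have eq: "real a / real (N j) = real b / real (N j) \<longleftrightarrow> a = b" for a b
            by simp
          have czs: "cz (shift (L j a)) = real a / real (N j)" "cz (L j a) = real a / real (N j)" for a
            by simp_all
          have nul': "cx (L j a) \<noteq> cx (shift (L j a))" for a using nul[of j a] by (auto simp del: nu_simps)
          show ?thesis
            unfolding i(2-) l(2-) unfolding True[symmetric]
          proof (rule no_coincidence_levels)
            show "cz (L j (Suc m)) \<le> cz (shift (L j n)) \<and>
                (cz (L j (Suc m)) = cz (shift (L j n)) \<longrightarrow> cx (L j (Suc m)) \<noteq> cx (shift (L j n))) \<or>
              cz (shift (L j (Suc n))) \<le> cz (L j m) \<and>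
                (cz (shift (L j (Suc n))) = cz (L j m) \<longrightarrow> cx (shift (L j (Suc n))) \<noteq> cx (L j m))"
              using mn
            proof
              assume "m < n"
              have "cz (L j (Suc m)) = cz (shift (L j n)) \<longrightarrow> Suc m = n" unfolding czs eq ..
              thus ?thesis using le[OF \<open>m < n\<close>] nul' unfolding czs by metis
            next
              assume "n < m"
              have "cz (shift (L j (Suc n))) = cz (L j m) \<longrightarrow> Suc n = m" unfolding czs eq ..
              thus ?thesis using le'[OF \<open>n < m\<close>] nul' unfolding czs by metis
            qed
          qed (use lt[of "N j"] in auto)
        next
          case False
          show ?thesis
            unfolding i(2-) l(2-)
          proof (rule no_coincidence)
            fix x y assume xy: "x \<in> closed_segment (L j m) (L j (Suc m))" "y \<in> closed_segment (shift (L k n)) (shift (L k (Suc n)))"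
              "cx x = cx y"
            \<comment> \<open>The reaches 1 of a band and 5/4 of a pushed left edge add up to less
              than the distance 3 of two axes.\<close>
            have "\<bar>cx x - 3 * real j\<bar> \<le> 1"
              by (rule closed_segment_cx_bound[OF xy(1)]) (use qcos_le[of m] qcos_le[of "Suc m"] in \<open>auto simp del: qcos_qsin_Suc\<close>)
            moreover have "\<bar>cx y - 3 * real k\<bar> \<le> 5 / 4"
            proof (rule closed_segment_cx_bound[OF xy(2)])
              show "\<bar>cx (shift (L k n)) - 3 * real k\<bar> \<le> 5 / 4" "\<bar>cx (shift (L k (Suc n))) - 3 * real k\<bar> \<le> 5 / 4"
                by (cases rule: sg_cases[of k]; cases rule: qcos_qsin_cases[of n]; simp)+
            qed
            ultimately show False using jk False xy(3) by (auto simp: abs_le_iff)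
          qed
        qed
        thus ?thesis using i l False by (auto simp del: general_position.simps nu_simps)
      qed
    next
      case l: 2
      have "general_position view (strand j i, strand j (Suc i)) (shift (strand k l), shift (strand k (Suc l))) \<and>
        signed_crossing view (strand j i, strand j (Suc i)) (shift (strand k l), shift (strand k (Suc l))) = 0"
        unfolding i(2-) l(2-)
      proof (rule no_coincidence_levels, goal_cases)
        case 3
        have "cz (L j (Suc m)) \<le> 1" "cz (L j (Suc m)) = 1 \<longrightarrow> cx (L j (Suc m)) = 3 * real j + 1"
          using top[OF i(2)] by blast+
        thus ?case using neq1 by (intro disjI1) (simp add: qcos_qsin_N del: qcos_qsin_Suc)
      qed (use lt[of "N j" m] in auto)
      thus ?thesis using i l by (auto simp del: general_position.simps nu_simps)
    qed
  next
    case i: 2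
    show ?thesis using assms(2)
    proof (cases rule: strand_cases)
      case l: 0
      have "general_position view (strand j i, strand j (Suc i)) (shift (strand k l), shift (strand k (Suc l))) \<and>
        signed_crossing view (strand j i, strand j (Suc i)) (shift (strand k l), shift (strand k (Suc l))) = 0"
        unfolding i(2-) l(2-) by (rule no_coincidence_levels) auto
      thus ?thesis using i l by (auto simp del: general_position.simps nu_simps)
    next
      case l: (1 n)
      have "general_position view (strand j i, strand j (Suc i)) (shift (strand k l), shift (strand k (Suc l))) \<and>
        signed_crossing view (strand j i, strand j (Suc i)) (shift (strand k l), shift (strand k (Suc l))) = 0"
        unfolding i(2-) l(2-)
      proof (rule no_coincidence_levels, goal_cases)
        case 3
        have "cz (shift (L k (Suc n))) \<le> 1 \<and> (cz (shift (L k (Suc n))) = 1 \<longrightarrow>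
            cx (shift (L k (Suc n))) = 3 * real k + 1 - sg k / 4)"
        proof -
          have "cz (shift (L k (Suc n))) = cz (L k (Suc n))" by simp
          moreover have "cx (shift (L k (Suc n))) = 3 * real k + 1 - sg k / 4" if "Suc n = N k"
            unfolding that by (simp add: qcos_qsin_N)
          ultimately show ?thesis using top[OF l(2)] by metis
        qed
        moreover have "cz (L j (N j)) = 1" "cx (L j (N j)) = 3 * real j + 1" by (simp_all add: qcos_qsin_N)
        ultimately show ?case using neq1 by metis
      qed (use lt[of "N k" n] in auto)
      thus ?thesis using i l by (auto simp del: general_position.simps nu_simps)
    next
      case l: 2
      have gp: "general_position view (strand j i, strand j (Suc i)) (shift (strand k l), shift (strand k (Suc l)))"
        unfolding i(2-) l(2-) by (rule signed_crossing_same_levels(1)) (use neq1 in \<open>auto simp: qcos_qsin_N\<close>)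
      have "signed_crossing view (strand j i, strand j (Suc i)) (shift (strand k l), shift (strand k (Suc l))) =
        (if j < k \<or> j = k \<and> sg j = -1 then 1 else 0)"
        unfolding i(2-) l(2-)
        by (subst signed_crossing_same_levels(2)) (use neq1 in \<open>simp_all add: qcos_qsin_N sk[simplified]\<close>)
      thus ?thesis using gp i l by (auto simp del: general_position.simps nu_simps)
    qed
  qed
qed

text \<open>A strand is not closed, so this number belongs to the chosen projection; the alternating
  sum over two loops is a linking number.\<close>

definition strand_linking :: "nat \<Rightarrow> nat \<Rightarrow> int" where
  "strand_linking j k = (\<Sum>i<N j + 2. \<Sum>l<N k + 2. strand_crossing j i k l)"

text \<open>For \<open>j = k\<close> the value is \<open>(h j + 1) div 2\<close> for either sign of
  \<open>h j\<close>: if \<open>h j\<close> is negative, the extra crossing in the top disk makes up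
  for the sign in front of \<open>(\<bar>h j\<bar> + 1) div 2\<close>.\<close>

lemma strand_linking:
  "strand_linking j k = (if j < k then 1 else if k < j then 0
     else sgn (h j) * ((\<bar>h j\<bar> + 1) div 2) + (if sg j = -1 then 1 else 0))"
proof -
  let ?a = "\<lambda>i l. if i = Suc (N j) \<and> l = Suc (N k) \<and> (j < k \<or> j = k \<and> sg j = -1) then 1 else 0 :: int"
  let ?b = "\<lambda>i l. if j = k \<and> l = i \<and> i > 0 \<and> i \<le> N j \<and> qsin (i - 1) = 1 then sgn (h j) else 0"
  have "strand_linking j k = (\<Sum>i<N j + 2. \<Sum>l<N k + 2. ?a i l + ?b i l)"
    unfolding strand_linking_def using strand_crossing by (intro sum.cong refl) auto
  also have "\<dots> = (\<Sum>i<N j + 2. \<Sum>l<N k + 2. ?a i l) + (\<Sum>i<N j + 2. \<Sum>l<N k + 2. ?b i l)"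
    by (simp only: sum.distrib)
  also have "(\<Sum>i<N j + 2. \<Sum>l<N k + 2. ?a i l) = (\<Sum>i<N j + 2. if i = Suc (N j) then
      if j < k \<or> j = k \<and> sg j = -1 then 1 else 0 else 0)"
    by (rule sum.cong) (auto simp: sum.delta[of "{..<N k + 2}"] if_distrib cong: if_cong)
  also have "\<dots> = (if j < k \<or> j = k \<and> sg j = -1 then 1 else 0)"
    by simp
  also have "(\<Sum>i<N j + 2. \<Sum>l<N k + 2. ?b i l) = (if j = k then sgn (h j) * ((\<bar>h j\<bar> + 1) div 2) else 0)"
  proof (cases "j = k")
    case True
    have "(\<Sum>i<N j + 2. \<Sum>l<N k + 2. ?b i l) =
        (\<Sum>i<N j + 2. if i > 0 \<and> i \<le> N j \<and> qsin (i - 1) = 1 then sgn (h j) else 0)"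
      unfolding True by (rule sum.cong) (auto simp: if_distrib cong: if_cong)
    also have "\<dots> = (\<Sum>i<N j + 1. if i < N j \<and> qsin i = 1 then sgn (h j) else 0)"
      by (simp add: sum.lessThan_Suc_shift Suc_le_eq del: sum.lessThan_Suc)
    also have "\<dots> = (\<Sum>i<N j. if qsin i = 1 then sgn (h j) else 0)" by simp
    also have "\<dots> = (\<Sum>i<N j. sgn (h j) * (if qsin i = 1 then 1 else 0))"
      by (rule sum.cong) auto
    also have "\<dots> = sgn (h j) * (\<Sum>i<2 * nat \<bar>h j\<bar>. if qsin i = 1 then 1 else 0)"
      by (simp add: sum_distrib_left N_def nat_mult_distrib)
    also have "(\<Sum>i<2 * nat \<bar>h j\<bar>. if qsin i = 1 then 1 else 0 :: int) = (int (nat \<bar>h j\<bar>) + 1) div 2"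
      by (rule sum_qsin_eq_1) (use odd_h[of j] in \<open>simp add: even_nat_iff\<close>)
    finally show ?thesis using True by simp
  qed simp
  finally show ?thesis by auto
qed

definition loop :: "nat \<Rightarrow> point list" where
  "loop j = digon (strand j) (N j + 2) (strand (Suc j)) (N (Suc j) + 2)"

lemma strand_ends [simp]: "strand j 0 = ap 0" "strand j (Suc (Suc (N j))) = ap 1"
  by (simp_all add: strand_def)

lemma has_linking_number_loop:
  "has_linking_number (loop i) (map shift (loop j))
     (strand_linking i j - strand_linking i (Suc j) - strand_linking (Suc i) j + strand_linking (Suc i) (Suc j))"
proof -
  have shift_loop: "map shift (loop j) =
      digon (\<lambda>l. shift (strand j l)) (N j + 2) (\<lambda>l. shift (strand (Suc j) l)) (N (Suc j) + 2)"
    unfolding loop_def map_digon ..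
  have neg: "(\<Sum>f\<leftarrow>fs. signed_crossing view (b, a) f) = - (\<Sum>f\<leftarrow>fs. signed_crossing view (a, b) f)" for a b fs
    by (simp add: signed_crossing_rev(1)[of view a b] uminus_sum_list_map o_def)
  have inner: "(\<Sum>f\<leftarrow>closed_edges (map shift (loop j)). signed_crossing view e f) =
      (\<Sum>l<N j + 2. signed_crossing view e (shift (strand j l), shift (strand j (Suc l)))) -
      (\<Sum>l<N (Suc j) + 2. signed_crossing view e (shift (strand (Suc j) l), shift (strand (Suc j) (Suc l))))" for e
    unfolding shift_loop by (rule sum_list_closed_edges_digon) (auto intro: signed_crossing_rev(2))
  let ?h = "\<lambda>e. \<Sum>f\<leftarrow>closed_edges (map shift (loop j)). signed_crossing view e f"
  have "(\<Sum>e\<leftarrow>closed_edges (loop i). ?h e) = (\<Sum>m<N i + 2. ?h (strand i m, strand i (Suc m))) -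
      (\<Sum>m<N (Suc i) + 2. ?h (strand (Suc i) m, strand (Suc i) (Suc m)))"
    unfolding loop_def[of i]
  proof (rule sum_list_closed_edges_digon)
    show "?h (b, a) = - ?h (a, b)" for a b by (rule neg)
  qed simp_all
  also have "\<dots> = strand_linking i j - strand_linking i (Suc j) - strand_linking (Suc i) j + strand_linking (Suc i) (Suc j)"
    unfolding inner by (simp only: sum_subtractf strand_linking_def strand_crossing_def)
  finally have "(\<Sum>e\<leftarrow>closed_edges (loop i). ?h e) =
    strand_linking i j - strand_linking i (Suc j) - strand_linking (Suc i) j + strand_linking (Suc i) (Suc j)" .
  moreover have "general_position view e f"
    if e: "e \<in> set (closed_edges (loop i))" and f: "f \<in> set (closed_edges (map shift (loop j)))" for e f
  proof -
    obtain j' l where j': "l < N j' + 2" "f = (shift (strand j' l), shift (strand j' (Suc l))) \<or>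
        f = (shift (strand j' (Suc l)), shift (strand j' l))"
      using f unfolding shift_loop by (subst (asm) set_closed_edges_digon) auto
    obtain i' m where i': "m < N i' + 2" "e = (strand i' m, strand i' (Suc m)) \<or> e = (strand i' (Suc m), strand i' m)"
      using e unfolding loop_def by (subst (asm) set_closed_edges_digon) auto
    show ?thesis using i'(2) j'(2) strand_crossing[OF i'(1) j'(1)] by (auto simp: general_position_rev simp del: general_position.simps)
  qed
  moreover have "view \<noteq> 0" by (simp add: view_def point_eq_iff)
  ultimately show ?thesis
    unfolding has_linking_number_def signed_crossing_def[symmetric] by (intro exI[of _ view]) simp
qed

end

section \<open>Homology of the surface\<close>

lemma sum_count_list_pairs:
  assumes "finite V" "set es \<subseteq> UNIV \<times> V"
  shows "(\<Sum>b\<in>V. count_list es (a, b)) = count_list (map fst es) a"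
  using assms(2)
proof (induction es)
  case (Cons e es)
  obtain p q where e: "e = (p, q)" by (cases e)
  have "(\<Sum>b\<in>V. count_list (e # es) (a, b)) = (\<Sum>b\<in>V. (if a = p \<and> b = q then 1 else 0) + count_list es (a, b))"
    by (rule sum.cong) (auto simp: e)
  also have "\<dots> = (\<Sum>b\<in>V. if b = q then if a = p then 1 else 0 else 0) + count_list (map fst es) a"
    using Cons by (auto simp: sum.distrib intro!: sum.cong)
  also have "(\<Sum>b\<in>V. if b = q then if a = p then 1 else 0 else 0) = (if a = p then 1 else 0 :: nat)"
    using Cons.prems assms(1) e by (simp add: sum.delta)
  finally show ?case by (auto simp: e)
qed simp

lemma count_list_rotate1: "count_list (rotate1 l) a = count_list l a"
  by (cases l) auto

lemma map_fst_snd_closed_edges: "map fst (closed_edges l) = l" "map snd (closed_edges l) = rotate1 l"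
  by (simp_all add: closed_edges_def)

text \<open>A closed path leaves each vertex as often as it enters it, since the heads of its edges
  are a rotation of the tails.\<close>

lemma sum_loop_chain:
  assumes "finite V" "set l \<subseteq> V"
  shows "(\<Sum>b\<in>V. loop_chain l (a, b)) = 0"
proof -
  let ?ce = "closed_edges l" and ?ec = "map prod.swap (closed_edges l)"
  have "set ?ce \<subseteq> set l \<times> set l"
    by (auto simp: closed_edges_def dest: set_zip_leftD set_zip_rightD)
  hence sub: "set ?ce \<subseteq> UNIV \<times> V" "set ?ec \<subseteq> UNIV \<times> V" using assms(2) by auto
  have "count_list es (b, a) = count_list (map prod.swap es) (a, b)" for es :: "edge list" and b
    by (induction es) auto
  note swap = this[of ?ce]
  have "map fst ?ec = rotate1 l" using map_fst_snd_closed_edges(2)[of l] by (simp add: o_def)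
  hence "(\<Sum>b\<in>V. count_list ?ce (a, b)) = (\<Sum>b\<in>V. count_list ?ec (a, b))"
    unfolding sum_count_list_pairs[OF assms(1) sub(1)] sum_count_list_pairs[OF assms(1) sub(2)]
    by (simp add: map_fst_snd_closed_edges count_list_rotate1)
  hence "(\<Sum>b\<in>V. int (count_list ?ce (a, b))) = (\<Sum>b\<in>V. int (count_list ?ce (b, a)))"
    unfolding swap by (simp flip: of_nat_sum)
  thus ?thesis by (simp add: loop_chain_def sum_subtractf)
qed

lemma loop_chain_sum_list:
  "loop_chain l (a, b) = (\<Sum>e\<leftarrow>closed_edges l. of_bool (e = (a, b)) - of_bool (e = (b, a)))"
proof -
  have "int (count_list es e) = (\<Sum>e'\<leftarrow>es. of_bool (e' = e))" for es and e :: edge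
    by (induction es) auto
  thus ?thesis by (simp add: loop_chain_def sum_list_subtractf)
qed

definition chain_boundary :: "triangle set \<Rightarrow> (triangle \<Rightarrow> int) \<Rightarrow> edge \<Rightarrow> int" where
  "chain_boundary T x = (\<lambda>(a, b). \<Sum>t\<in>T. x t * (of_bool ((a, b) \<in> directed_edges t) - of_bool ((b, a) \<in> directed_edges t)))"

lemma one_boundaries_eq: "one_boundaries T = range (chain_boundary T)"
  by (auto simp: one_boundaries_def chain_boundary_def)

lemma chain_boundary_swap: "chain_boundary T x (b, a) = - chain_boundary T x (a, b)"
  by (simp add: chain_boundary_def sum_negf[symmetric] algebra_simps)

context pretzel
begin

text \<open>A directed edge lies in at most one triangle, whose coefficient this is (\<open>0\<close> if there is none).\<close>

definition owner_coeff :: "(triangle \<Rightarrow> int) \<Rightarrow> edge \<Rightarrow> int" where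
  "owner_coeff x e = (\<Sum>t\<in>T. x t * of_bool (e \<in> directed_edges t))"

lemma chain_boundary_owner: "chain_boundary T x (a, b) = owner_coeff x (a, b) - owner_coeff x (b, a)"
  by (simp add: chain_boundary_def owner_coeff_def right_diff_distrib sum_subtractf)

lemma owner_coeff_eq:
  assumes "t \<in> T" "e \<in> directed_edges t"
  shows "owner_coeff x e = x t"
proof -
  have "e \<notin> directed_edges t'" if "t' \<in> T" "t' \<noteq> t" for t'
    using directed_edges_disjoint[OF assms(1) that(1)] that(2) assms(2) by blast
  hence "owner_coeff x e = (\<Sum>t'\<in>T. if t' = t then x t else 0)"
    unfolding owner_coeff_def using assms by (intro sum.cong) auto
  thus ?thesis using assms(1) finite_T by simp
qed

lemma owner_coeff_0: "(\<And>t. t \<in> T \<Longrightarrow> e \<notin> directed_edges t) \<Longrightarrow> owner_coeff x e = 0"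
  unfolding owner_coeff_def by (intro sum.neutral) auto

lemma tri_edges:
  "directed_edges (A j m) = {(L j m, R j m), (R j m, R j (Suc m)), (R j (Suc m), L j m)}"
  "directed_edges (B j m) = {(L j m, R j (Suc m)), (R j (Suc m), L j (Suc m)), (L j (Suc m), L j m)}"
  "directed_edges (D z k) = {(dv z (Suc k), dv z k), (dv z k, ap z), (ap z, dv z (Suc k))}"
  by (simp_all add: A_def B_def D_def)

text \<open>The last two are the directions of the outer edges that no triangle induces.\<close>

lemma owner_band:
  assumes "j < 3" "m < N j"
  shows "owner_coeff x (L j m, R j m) = x (A j m)" "owner_coeff x (R j m, R j (Suc m)) = x (A j m)"
    "owner_coeff x (R j (Suc m), L j m) = x (A j m)"
    "owner_coeff x (L j m, R j (Suc m)) = x (B j m)" "owner_coeff x (R j (Suc m), L j (Suc m)) = x (B j m)"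
    "owner_coeff x (L j (Suc m), L j m) = x (B j m)"
    "owner_coeff x (R j (Suc m), R j m) = 0" "owner_coeff x (L j m, L j (Suc m)) = 0"
proof -
  show "owner_coeff x (L j m, R j m) = x (A j m)" "owner_coeff x (R j m, R j (Suc m)) = x (A j m)"
    "owner_coeff x (R j (Suc m), L j m) = x (A j m)"
    by (rule owner_coeff_eq[OF T_mem(3)[OF assms]]; simp add: tri_edges)+
  show "owner_coeff x (L j m, R j (Suc m)) = x (B j m)" "owner_coeff x (R j (Suc m), L j (Suc m)) = x (B j m)"
    "owner_coeff x (L j (Suc m), L j m) = x (B j m)"
    by (rule owner_coeff_eq[OF T_mem(4)[OF assms]]; simp add: tri_edges)+
  show "owner_coeff x (R j (Suc m), R j m) = 0"
    by (rule owner_coeff_0, elim T_tuples) (use assms in auto)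
  show "owner_coeff x (L j m, L j (Suc m)) = 0"
    by (rule owner_coeff_0, elim T_tuples) (use assms in auto)
qed

lemma owner_disk:
  assumes "z = 0 \<or> z = 1"
  shows "k < 5 \<Longrightarrow> owner_coeff x (dv z (Suc k), dv z k) = x (D z k)"
    "k < 6 \<Longrightarrow> owner_coeff x (dv z k, ap z) = (if k < 5 then x (D z k) else 0)"
    "k < 6 \<Longrightarrow> owner_coeff x (ap z, dv z k) = (if k > 0 then x (D z (k - 1)) else 0)"
    "j < 2 \<Longrightarrow> owner_coeff x (dv z (Suc (2 * j)), dv z (Suc (Suc (2 * j)))) = 0"
proof -
  have mem: "D z k \<in> T" if "k < 5" for k using T_mem(1,2)[OF that] assms by auto
  show "k < 5 \<Longrightarrow> owner_coeff x (dv z (Suc k), dv z k) = x (D z k)"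
    by (rule owner_coeff_eq[OF mem]) (simp_all add: tri_edges)
  have ne: "ap z \<noteq> dv z' k" "dv z' k \<noteq> ap z" if "z' = 0 \<or> z' = 1" for z' k
    using assms that by (auto simp: point_eq_iff)
  show "owner_coeff x (dv z k, ap z) = (if k < 5 then x (D z k) else 0)" if "k < 6"
  proof (cases "k < 5")
    case True
    thus ?thesis using owner_coeff_eq[OF mem, of k "(dv z k, ap z)" x] by (simp add: tri_edges)
  next
    case False
    have "(dv z k, ap z) \<notin> directed_edges t" if "t \<in> T" for t
      using that
    proof (cases rule: T_cases)
      case (D z' k')
      thus ?thesis using False assms ne by (auto simp: tri_edges)
    qed (use assms in \<open>auto simp: tri_edges\<close>)
    thus ?thesis using owner_coeff_0 False by simp
  qed
  show "owner_coeff x (ap z, dv z k) = (if k > 0 then x (D z (k - 1)) else 0)" if "k < 6"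
  proof (cases "k > 0")
    case True
    thus ?thesis using owner_coeff_eq[OF mem, of "k - 1" "(ap z, dv z k)" x] that by (simp add: tri_edges)
  next
    case False
    have "(ap z, dv z k) \<notin> directed_edges t" if "t \<in> T" for t
      using that
    proof (cases rule: T_cases)
      case (D z' k')
      thus ?thesis using False assms ne by (auto simp: tri_edges)
    qed (use assms in \<open>auto simp: tri_edges\<close>)
    thus ?thesis using owner_coeff_0 False by simp
  qed
  show "owner_coeff x (dv z (Suc (2 * j)), dv z (Suc (Suc (2 * j)))) = 0" if "j < 2"
  proof (rule owner_coeff_0)
    have "dv 0 (Suc (Suc (2 * j))) = L (Suc j) 0" "dv 1 (Suc (Suc (2 * j))) = R (Suc j) (N (Suc j))"
      using dv_eq(1,3)[of "Suc j"] by simp_all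
    thus "(dv z (Suc (2 * j)), dv z (Suc (Suc (2 * j)))) \<notin> directed_edges t" if "t \<in> T" for t
      using that assms by (elim T_tuples) (auto simp: dv_eq)
  qed
qed

text \<open>The intersection number of \<open>z\<close> with an arc across band \<open>j\<close>,
  read off on the three edges that climb through layer \<open>m\<close>.\<close>

definition flow :: "nat \<Rightarrow> nat \<Rightarrow> (edge \<Rightarrow> int) \<Rightarrow> int" where
  "flow j m z = z (L j m, L j (Suc m)) + z (L j m, R j (Suc m)) + z (R j m, R j (Suc m))"

text \<open>If \<open>a\<close> and \<open>b\<close> are the coefficients of the two triangles of
  the layer, the three values are \<open>- b\<close>, \<open>b - a\<close> and
  \<open>a\<close>.\<close>

lemma flow_chain_boundary:
  assumes "j < 3" "m < N j"
  shows "flow j m (chain_boundary T x) = 0"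
  by (simp add: flow_def chain_boundary_owner owner_band[OF assms])

section \<open>Cycles and their flow through the bands\<close>

lemma surface_edgesD:
  assumes "(a, b) \<in> surface_edges T"
  obtains t where "t \<in> T" "(a, b) \<in> directed_edges t \<or> (b, a) \<in> directed_edges t"
  using assms by (auto simp: surface_edges_def)

lemma finite_vertices: "finite (vertices T)"
proof -
  have "finite (verts t)" for t by (cases t) auto
  thus ?thesis using finite_T by (simp add: vertices_def)
qed

context
  fixes z assumes z: "z \<in> one_cycles T"
begin

lemma cycle_anti: "z (b, a) = - z (a, b)"
  using z unfolding one_cycles_def by blast

lemma cycle_support: "e \<notin> surface_edges T \<Longrightarrow> z e = 0"
  using z unfolding one_cycles_def by blast

text \<open>Replacing all vertices by an explicit set of neighbours makes the cycle condition a
  short form of Kirchhoff's law.\<close>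

lemma cycle_sum:
  assumes "finite S" "\<And>b. (a, b) \<in> surface_edges T \<Longrightarrow> b \<in> S"
  shows "(\<Sum>b\<in>S. z (a, b)) = 0"
proof -
  have z0: "z (a, b) = 0" if "b \<notin> S \<or> b \<notin> vertices T" for b
  proof -
    have "(a, b) \<notin> surface_edges T"
    proof
      assume e: "(a, b) \<in> surface_edges T"
      then obtain t where t: "t \<in> T" "(a, b) \<in> directed_edges t \<or> (b, a) \<in> directed_edges t"
        by (rule surface_edgesD)
      hence "b \<in> verts t" by (cases t) auto
      thus False using t(1) that assms(2)[OF e] by (auto simp: vertices_def)
    qed
    thus ?thesis by (rule cycle_support)
  qed
  have "(\<Sum>b\<in>S. z (a, b)) = (\<Sum>b\<in>S \<union> vertices T. z (a, b))"
    by (rule sum.mono_neutral_left) (use assms(1) finite_vertices z0 in auto)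
  also have "\<dots> = (\<Sum>b\<in>vertices T. z (a, b))"
    by (rule sum.mono_neutral_right) (use assms(1) finite_vertices z0 in auto)
  also have "\<dots> = 0" using z unfolding one_cycles_def by blast
  finally show ?thesis .
qed

lemma cycle_L_mid:
  assumes "j < 3" "Suc m < N j"
  shows "z (L j (Suc m), L j m) + z (L j (Suc m), R j (Suc m)) + z (L j (Suc m), R j (Suc (Suc m)))
    + z (L j (Suc m), L j (Suc (Suc m))) = 0"
proof -
  have "(\<Sum>b\<in>{L j m, R j (Suc m), R j (Suc (Suc m)), L j (Suc (Suc m))}. z (L j (Suc m), b)) = 0"
    by (rule cycle_sum, simp, erule surface_edgesD, (elim T_tuples; use assms in auto))
  thus ?thesis by simp
qed

lemma cycle_R_mid:
  assumes "j < 3" "Suc m < N j"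
  shows "z (R j (Suc m), R j m) + z (R j (Suc m), L j m) + z (R j (Suc m), L j (Suc m))
    + z (R j (Suc m), R j (Suc (Suc m))) = 0"
proof -
  have "(\<Sum>b\<in>{R j m, L j m, L j (Suc m), R j (Suc (Suc m))}. z (R j (Suc m), b)) = 0"
    by (rule cycle_sum, simp, erule surface_edgesD, (elim T_tuples; use assms in auto))
  thus ?thesis by simp
qed

text \<open>When the cycle conditions at both ends of a rung are added, the values on the rung
  cancel, and what arrives from below leaves upwards.\<close>

lemma flow_const:
  assumes "j < 3" "m < N j"
  shows "flow j m z = flow j 0 z"
  using assms(2)
proof (induction m)
  case (Suc m)
  have "flow j (Suc m) z = flow j m z"
    using cycle_L_mid[OF assms(1) Suc.prems] cycle_R_mid[OF assms(1) Suc.prems]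
      cycle_anti[of "L j m" "L j (Suc m)"] cycle_anti[of "R j m" "R j (Suc m)"]
      cycle_anti[of "L j m" "R j (Suc m)"] cycle_anti[of "L j (Suc m)" "R j (Suc m)"]
    by (simp add: flow_def)
  thus ?case using Suc by simp
qed simp

lemma cycle_L_bot:
  assumes "j < 3"
  shows "z (L j 0, ap 0) + z (L j 0, R j 0) + (z (L j 0, L j 1) + z (L j 0, R j 1))
    + (if j > 0 then z (L j 0, R (j - 1) 0) else 0) = 0"
proof -
  have "(\<Sum>b\<in>{ap 0, R j 0, L j 1, R j 1} \<union> (if j > 0 then {R (j - 1) 0} else {}). z (L j 0, b)) = 0"
    by (rule cycle_sum, simp, erule surface_edgesD, (elim T_tuples; use assms in auto))
  thus ?thesis by (cases "j > 0") auto
qed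

lemma cycle_R_bot:
  assumes "j < 3"
  shows "z (R j 0, ap 0) + z (R j 0, L j 0) + z (R j 0, R j 1)
    + (if j < 2 then z (R j 0, L (Suc j) 0) else 0) = 0"
proof -
  have "(\<Sum>b\<in>{ap 0, L j 0, R j 1} \<union> (if j < 2 then {L (Suc j) 0} else {}). z (R j 0, b)) = 0"
    by (rule cycle_sum, simp, erule surface_edgesD, (elim T_tuples; use assms in auto))
  thus ?thesis by (cases "j < 2") auto
qed

lemma cycle_R_top:
  assumes "j < 3"
  shows "z (R j (N j), ap 1) + z (R j (N j), L j (N j)) + (z (R j (N j), R j (N j - 1)) + z (R j (N j), L j (N j - 1)))
    + (if j > 0 then z (R j (N j), L (j - 1) (N (j - 1))) else 0) = 0"
proof -
  obtain n where n: "N j = Suc n" by (rule N_pred)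
  have "(\<Sum>b\<in>{ap 1, L j (N j), R j n, L j n} \<union> (if j > 0 then {L (j - 1) (N (j - 1))} else {}). z (R j (N j), b)) = 0"
    by (rule cycle_sum, simp, erule surface_edgesD, (elim T_tuples; use assms n in auto))
  thus ?thesis using n by (cases "j > 0") auto
qed

lemma cycle_L_top:
  assumes "j < 3"
  shows "z (L j (N j), ap 1) + z (L j (N j), R j (N j)) + z (L j (N j), L j (N j - 1))
    + (if j < 2 then z (L j (N j), R (Suc j) (N (Suc j))) else 0) = 0"
proof -
  obtain n where n: "N j = Suc n" by (rule N_pred)
  have "(\<Sum>b\<in>{ap 1, R j (N j), L j n} \<union> (if j < 2 then {R (Suc j) (N (Suc j))} else {}). z (L j (N j), b)) = 0"
    by (rule cycle_sum, simp, erule surface_edgesD, (elim T_tuples; use assms n in auto))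
  thus ?thesis using n by (cases "j < 2") auto
qed

text \<open>The outflow of \<open>z\<close> from the base vertex \<open>dv y k\<close> into its
  band. The diagonals run from \<open>L j m\<close> to \<open>R j (Suc m)\<close>, so at both disks
  it is the left end of the band, with even \<open>k\<close>, that carries a diagonal.\<close>

definition up :: "real \<Rightarrow> nat \<Rightarrow> int" where
  "up y k = (let j = k div 2 in
     if y = 0 then if even k then z (L j 0, L j 1) + z (L j 0, R j 1) else z (R j 0, R j 1)
     else if even k then z (R j (N j), R j (N j - 1)) + z (R j (N j), L j (N j - 1))
     else z (L j (N j), L j (N j - 1)))"

text \<open>The conditions at the ends of the bands in one form, numbered along the base, so that
  induction along a disk is possible.\<close>

lemma cycle_dv:
  assumes y: "y = 0 \<or> y = 1" and "k < 6"
  shows "z (dv y k, ap y) + (if k < 5 then z (dv y k, dv y (Suc k)) else 0) + up y k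
    + (if k > 0 then z (dv y k, dv y (k - 1)) else 0) = 0"
proof -
  obtain j where j: "k = 2 * j \<or> k = Suc (2 * j)" by (metis oddE evenE Suc_eq_plus1)
  hence j3: "j < 3" using assms(2) by auto
  from j show ?thesis
  proof
    assume k: "k = 2 * j"
    have prev: "dv y (k - 1) = (if y = 0 then R (j - 1) 0 else L (j - 1) (N (j - 1)))" if k0: "k > 0"
    proof -
      obtain i where "j = Suc i" using k0 k by (cases j) auto
      thus ?thesis using dv_eq(2,4)[of i] y k by auto
    qed
    show ?thesis
      using cycle_L_bot[OF j3] cycle_R_top[OF j3] y j3 k prev dv_eq[of j] by (auto simp: up_def split: if_splits)
  next
    assume k: "k = Suc (2 * j)"
    have succ: "dv y (Suc k) = (if y = 0 then L (Suc j) 0 else R (Suc j) (N (Suc j)))"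
      using dv_eq(1,3)[of "Suc j"] y k by auto
    show ?thesis
      using cycle_R_bot[OF j3] cycle_L_top[OF j3] y j3 succ dv_eq[of j] by (auto simp: up_def k split: if_splits)
  qed
qed

lemma cycle_ap:
  assumes y: "y = 0 \<or> y = 1"
  shows "(\<Sum>k<6. z (dv y k, ap y)) = 0"
proof -
  have ne: "ap y \<noteq> dv y' k" if "y' = 0 \<or> y' = 1" for y' k
    using assms that by (auto simp: point_eq_iff)
  have "(\<Sum>b\<in>dv y ` {..<6}. z (ap y, b)) = 0"
  proof (rule cycle_sum)
    fix b assume "(ap y, b) \<in> surface_edges T"
    then obtain t where t: "t \<in> T" "(ap y, b) \<in> directed_edges t \<or> (b, ap y) \<in> directed_edges t"
      by (rule surface_edgesD)
    from t(1) show "b \<in> dv y ` {..<6}"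
    proof (cases rule: T_cases)
      case (D y' k)
      have "ap y = ap y' \<Longrightarrow> y = y'" by (simp add: point_eq_iff)
      thus ?thesis using t(2) ne[OF D(1)] D by (auto simp: tri_edges)
    qed (use t(2) y in \<open>auto simp: tri_edges\<close>)
  qed simp
  hence "(\<Sum>k<6. z (ap y, dv y k)) = 0" by (simp add: sum.reindex inj_on_def)
  thus ?thesis by (simp add: cycle_anti[of "ap y"] sum_negf)
qed

text \<open>What the base vertices up to \<open>k\<close> receive through this edge is what they
  send to the apex and into the bands.\<close>

lemma base_edge_sum:
  assumes y: "y = 0 \<or> y = 1" and "k < 5"
  shows "z (dv y (Suc k), dv y k) = (\<Sum>i\<le>k. z (dv y i, ap y) + up y i)"
  using assms(2)
proof (induction k)
  case 0
  show ?case using cycle_dv[OF y, of 0] cycle_anti[of "dv y 0" "dv y 1"] by simp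
next
  case (Suc k)
  thus ?case using cycle_dv[OF y, of "Suc k"] cycle_anti[of "dv y (Suc k)" "dv y (Suc (Suc k))"] by simp
qed

lemma up_flow:
  assumes "j < 3"
  shows "up 0 (2 * j) + up 0 (Suc (2 * j)) = flow j 0 z" "up 1 (2 * j) + up 1 (Suc (2 * j)) = - flow j 0 z"
proof -
  show "up 0 (2 * j) + up 0 (Suc (2 * j)) = flow j 0 z" by (simp add: up_def flow_def)
  obtain n where n: "N j = Suc n" by (rule N_pred)
  have "up 1 (2 * j) + up 1 (Suc (2 * j)) = - flow j n z"
    using cycle_anti[of "R j n" "R j (N j)"] cycle_anti[of "L j n" "R j (N j)"] cycle_anti[of "L j n" "L j (N j)"]
    by (simp add: up_def flow_def n)
  thus "up 1 (2 * j) + up 1 (Suc (2 * j)) = - flow j 0 z" using flow_const[OF assms, of n] n by simp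
qed

text \<open>A disk has no net outflow: the conditions at the base vertices of the bottom disk are
  added, and the apex contributes 0.\<close>

lemma flow_sum: "flow 0 0 z + flow 1 0 z + flow 2 0 z = 0"
proof -
  have "(\<Sum>i\<le>4. z (dv 0 i, ap 0) + up 0 i) + z (dv 0 5, ap 0) + up 0 5 = 0"
    using cycle_dv[of 0 5] base_edge_sum[of 0 4] cycle_anti[of "dv 0 4" "dv 0 5"] by simp
  hence "(\<Sum>i<6. z (dv 0 i, ap 0)) + (\<Sum>i<6. up 0 i) = 0"
    by (simp add: eval_nat_numeral sum.distrib)
  hence "(\<Sum>i<6. up 0 i) = 0" using cycle_ap[of 0] by simp
  thus ?thesis using up_flow(1)[of 0] up_flow(1)[of 1] up_flow(1)[of 2] by (simp add: eval_nat_numeral)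
qed

section \<open>Cycles without flow are boundaries\<close>

context
  assumes flow0: "flow 0 0 z = 0" and flow2: "flow 2 0 z = 0"
begin

lemma flow_eq_0: "j < 3 \<Longrightarrow> m < N j \<Longrightarrow> flow j m z = 0"
proof -
  assume "j < 3" "m < N j"
  moreover from this have "j = 0 \<or> j = 1 \<or> j = 2" by linarith
  ultimately show ?thesis using flow_const[of j m] flow0 flow2 flow_sum by auto
qed

text \<open>Without flow the two ends of a band cancel in the sum of the outflows; what remains is a
  left end whose right end comes after \<open>k\<close>.\<close>

lemma base_edge_eq:
  assumes y: "y = 0 \<or> y = 1" and "k < 5"
  shows "z (dv y (Suc k), dv y k) = (\<Sum>i\<le>k. z (dv y i, ap y)) + (if even k then up y k else 0)"
proof -
  have pair: "up y (2 * j) + up y (Suc (2 * j)) = 0" if "j < 3" for j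
    using up_flow[OF that] flow_eq_0[OF that, of 0] y by auto
  have "(\<Sum>i\<le>k. up y i) = (if even k then up y k else 0)" using assms(2)
  proof (induction k)
    case (Suc k)
    show ?case
    proof (cases "even k")
      case True
      then obtain j where "k = 2 * j" by (rule evenE)
      thus ?thesis using Suc pair[of j] by simp
    next
      case False
      thus ?thesis using Suc by simp
    qed
  qed simp
  thus ?thesis using base_edge_sum[OF assms] by (simp add: sum.distrib)
qed

text \<open>The coefficient of a triangle is the value of \<open>z\<close> on its boundary edge if it lies in a band,
  and the sum of the values of \<open>z\<close> on the edges to the apex that precede it if it lies in a disk.\<close>

definition filling :: "triangle \<Rightarrow> int" where
  "filling = (\<lambda>(a, b, c).
     if c = ap 0 \<or> c = ap 1 then \<Sum>i | i < 6 \<and> xk i \<le> cx b. z (dv (cz b) i, c)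
     else if \<exists>j m. a = L j m \<and> b = R j m then z (b, c) else z (c, a))"

text \<open>\<open>filling\<close> recognizes a triangle by its vertices: an apex in third place
  means a disk, first vertices on a common rung mean \<open>A j m\<close>. In a disk, the
  coordinates of the second vertex \<open>dv y k\<close> give back \<open>y\<close> and
  \<open>k\<close>.\<close>

lemma filling_simps:
  "filling (A j m) = z (R j m, R j (Suc m))" "filling (B j m) = z (L j (Suc m), L j m)"
  "y = 0 \<or> y = 1 \<Longrightarrow> k < 5 \<Longrightarrow> filling (D y k) = (\<Sum>i\<le>k. z (dv y i, ap y))"
proof -
  show "filling (A j m) = z (R j m, R j (Suc m))" "filling (B j m) = z (L j (Suc m), L j m)"
    by (auto simp: filling_def A_def B_def)
  assume "y = 0 \<or> y = 1" "k < 5"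
  moreover from this have "{i. i < 6 \<and> i \<le> k} = {..k}" by auto
  ultimately show "filling (D y k) = (\<Sum>i\<le>k. z (dv y i, ap y))"
    by (auto simp: filling_def D_def)
qed

text \<open>The coefficients on both sides of the edge differ by its value. After the last edge the
  total is 0, by the cycle condition at the apex.\<close>

lemma fill_apex:
  assumes y: "y = 0 \<or> y = 1" and "k < 6"
  shows "z (dv y k, ap y) = chain_boundary T filling (dv y k, ap y)"
proof -
  consider "k = 0" | "0 < k" "k < 5" | "k = 5" using assms(2) by linarith
  thus ?thesis
  proof cases
    case 1
    thus ?thesis using y by (simp add: chain_boundary_owner owner_disk filling_simps)
  next
    case 2
    then obtain i where "k = Suc i" by (cases k) auto
    thus ?thesis using y 2 by (simp add: chain_boundary_owner owner_disk filling_simps)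
  next
    case 3
    have "(\<Sum>i\<le>4. z (dv y i, ap y)) + z (dv y 5, ap y) = 0"
      using cycle_ap[OF y] by (simp add: eval_nat_numeral)
    thus ?thesis using y 3 by (simp add: chain_boundary_owner owner_disk filling_simps)
  qed
qed

text \<open>For even \<open>k\<close> the second triangle at the base edge belongs to a band; for
  odd \<open>k\<close> the edge lies on the boundary.\<close>

lemma fill_base:
  assumes y: "y = 0 \<or> y = 1" and k: "k < 5"
  shows "z (dv y (Suc k), dv y k) = chain_boundary T filling (dv y (Suc k), dv y k)"
proof (cases "even k")
  case True
  then obtain j where j: "k = 2 * j" by (rule evenE)
  hence j3: "j < 3" using k by simp
  obtain n where n: "N j = Suc n" by (rule N_pred)
  have "owner_coeff filling (dv y k, dv y (Suc k)) = up y (Suc k)"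
    using y owner_band(1)[OF j3, of 0] owner_band(5)[OF j3, of n] n
    by (auto simp: j dv_eq filling_simps up_def)
  moreover have "up y k + up y (Suc k) = 0"
    using up_flow[OF j3] flow_eq_0[OF j3, of 0] y j by auto
  ultimately show ?thesis using base_edge_eq[OF y k] True k owner_disk(1)[OF y, of k filling]
    by (simp add: chain_boundary_owner filling_simps(3)[OF y])
next
  case False
  then obtain j where j: "k = Suc (2 * j)" by (metis oddE Suc_eq_plus1)
  hence "owner_coeff filling (dv y k, dv y (Suc k)) = 0" using owner_disk(4)[OF y, of j] k by simp
  thus ?thesis using base_edge_eq[OF y k] False k owner_disk(1)[OF y, of k filling]
    by (simp add: chain_boundary_owner filling_simps(3)[OF y])
qed

text \<open>The outer edges agree by the choice of the coefficients, the diagonal because the flow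
  vanishes, and a rung by the cycle condition at its end \<open>L j m\<close>; the lowest rung is a
  base edge of the bottom disk.\<close>

lemma fill_band:
  assumes j: "j < 3" and m: "m < N j"
  shows "z (R j m, R j (Suc m)) = chain_boundary T filling (R j m, R j (Suc m))"
    "z (L j (Suc m), L j m) = chain_boundary T filling (L j (Suc m), L j m)"
    "z (R j (Suc m), L j m) = chain_boundary T filling (R j (Suc m), L j m)"
    "z (R j m, L j m) = chain_boundary T filling (R j m, L j m)"
proof -
  note owner = owner_band[OF assms] filling_simps(1,2)
  show "z (R j m, R j (Suc m)) = chain_boundary T filling (R j m, R j (Suc m))"
    "z (L j (Suc m), L j m) = chain_boundary T filling (L j (Suc m), L j m)"
    by (simp_all add: chain_boundary_owner owner)
  have f: "z (L j m, L j (Suc m)) + z (L j m, R j (Suc m)) + z (R j m, R j (Suc m)) = 0"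
    using flow_eq_0[OF assms] by (simp add: flow_def)
  show "z (R j (Suc m), L j m) = chain_boundary T filling (R j (Suc m), L j m)"
    using f cycle_anti[of "L j m" "R j (Suc m)"] cycle_anti[of "L j m" "L j (Suc m)"]
    by (simp add: chain_boundary_owner owner)
  show "z (R j m, L j m) = chain_boundary T filling (R j m, L j m)"
  proof (cases m)
    case 0
    thus ?thesis using fill_base[of 0 "2 * j"] j by (simp add: dv_eq)
  next
    case (Suc n)
    have "owner_coeff filling (R j m, L j m) = z (L j m, L j n)"
      using owner_band(5)[of j n filling] j m Suc by (simp add: filling_simps)
    thus ?thesis using f cycle_L_mid[of j n] j m cycle_anti[of "L j m" "R j m"]
      unfolding chain_boundary_owner owner by (simp add: Suc)
  qed
qed

lemma fill: "z = chain_boundary T filling"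
proof
  fix e :: edge
  obtain a b where e: "e = (a, b)" by (cases e)
  have swap: "z (q, p) = chain_boundary T filling (q, p)" if "z (p, q) = chain_boundary T filling (p, q)" for p q
    using that cycle_anti[of p q] chain_boundary_swap[of T filling p q] by simp
  have key: "z (p, q) = chain_boundary T filling (p, q)" if t: "t \<in> T" "(p, q) \<in> directed_edges t" for t p q
    using t(1)
  proof (cases rule: T_cases)
    case (D y k)
    thus ?thesis using t(2) fill_base[OF D(1), of k] fill_apex[OF D(1), of k] fill_apex[OF D(1), of "Suc k"]
      by (auto simp: tri_edges intro: swap)
  next
    case (A j m)
    thus ?thesis using t(2) fill_band[OF A(1,2)] by (auto simp: tri_edges intro: swap)
  next
    case (B j m)
    \<comment> \<open>The upper edge of the last layer is a base edge of the top disk instead of a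
      rung below another layer.\<close>
    have "z (R j (Suc m), L j (Suc m)) = chain_boundary T filling (R j (Suc m), L j (Suc m))"
    proof (cases "Suc m < N j")
      case True
      thus ?thesis using fill_band(4)[OF B(1)] by blast
    next
      case False
      hence "Suc m = N j" using B(2) by simp
      thus ?thesis using fill_base[of 1 "2 * j"] B(1) swap by (simp add: dv_eq)
    qed
    thus ?thesis using t(2) fill_band[OF B(1,2)] B by (auto simp: tri_edges intro: swap)
  qed
  show "z e = chain_boundary T filling e"
  proof (cases "e \<in> surface_edges T")
    case True
    then obtain t where "t \<in> T" "(a, b) \<in> directed_edges t \<or> (b, a) \<in> directed_edges t"
      unfolding e by (rule surface_edgesD)
    thus ?thesis unfolding e using key swap by blast
  next
    case False
    hence "z e = 0" by (rule cycle_support)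
    have n: "(a, b) \<notin> directed_edges t" "(b, a) \<notin> directed_edges t" if "t \<in> T" for t
      using False that unfolding e by (auto simp: surface_edges_def)
    have "owner_coeff filling (a, b) = 0" "owner_coeff filling (b, a) = 0" using owner_coeff_0[OF n(1)] owner_coeff_0[OF n(2)] by blast+
    with \<open>z e = 0\<close> show ?thesis by (simp add: e chain_boundary_owner)
  qed
qed

lemma zero_flow_boundary: "z \<in> one_boundaries T"
  unfolding one_boundaries_eq by (rule ssubst[where P="\<lambda>w. w \<in> range (chain_boundary T)", OF fill rangeI])

end
end

section \<open>The two loops as a homology basis\<close>

lemma strand_edges:
  assumes "j < 3" "i < N j + 2"
  shows "(strand j i, strand j (Suc i)) \<in> surface_edges T" "(strand j (Suc i), strand j i) \<in> surface_edges T"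
proof -
  have "\<exists>t\<in>T. (strand j i, strand j (Suc i)) \<in> directed_edges t \<or> (strand j (Suc i), strand j i) \<in> directed_edges t"
    using assms(2)
  proof (cases rule: strand_cases)
    case 0
    thus ?thesis using T_mem6(1)[OF assms(1)] by (intro bexI[of _ "D 0 (2 * j)"]) (auto simp: D_eq)
  next
    case (1 m)
    thus ?thesis using T_mem(4)[OF assms(1)] by (intro bexI[of _ "B j m"]) (auto simp: B_def)
  next
    case 2
    thus ?thesis using T_mem6(3)[OF assms(1)] by (intro bexI[of _ "D 1 (2 * j)"]) (auto simp: D_eq)
  qed
  thus "(strand j i, strand j (Suc i)) \<in> surface_edges T" "(strand j (Suc i), strand j i) \<in> surface_edges T"
    by (auto simp: surface_edges_def)
qed

lemma loop_edges:
  assumes "j < 2"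
  shows "set (closed_edges (loop j)) \<subseteq> surface_edges T"
  unfolding loop_def by (subst set_closed_edges_digon) (use strand_edges[of j] strand_edges[of "Suc j"] assms in auto)

lemma surface_edges_sym: "(a, b) \<in> surface_edges T \<longleftrightarrow> (b, a) \<in> surface_edges T"
  by (auto simp: surface_edges_def)

lemma surface_edges_vertices: "(a, b) \<in> surface_edges T \<Longrightarrow> a \<in> vertices T"
  by (erule surface_edgesD) (force simp: vertices_def elim!: directed_edges.elims)

lemma loop_chain_cycle:
  assumes "j < 2"
  shows "loop_chain (loop j) \<in> one_cycles T"
  unfolding one_cycles_def
proof (intro CollectI conjI allI impI)
  show "loop_chain (loop j) (b, a) = - loop_chain (loop j) (a, b)" for a b by (simp add: loop_chain_def)
  show "loop_chain (loop j) e = 0" if "e \<notin> surface_edges T" for e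
  proof -
    obtain a b where e: "e = (a, b)" by (cases e)
    hence "(a, b) \<notin> set (closed_edges (loop j))" "(b, a) \<notin> set (closed_edges (loop j))"
      using that loop_edges[OF assms] surface_edges_sym by blast+
    thus ?thesis by (simp add: e loop_chain_def count_list_0_iff)
  qed
  have "set (loop j) \<subseteq> vertices T"
  proof
    fix v assume "v \<in> set (loop j)"
    hence "v \<in> fst ` set (closed_edges (loop j))" using map_fst_snd_closed_edges(1)[of "loop j"] by (metis set_map)
    thus "v \<in> vertices T" using loop_edges[OF assms] surface_edges_vertices by fastforce
  qed
  thus "(\<Sum>b\<in>vertices T. loop_chain (loop j) (a, b)) = 0" for a
    by (rule sum_loop_chain[OF finite_vertices])
qed

lemma flow_loop: "flow i 0 (loop_chain (loop j)) = of_bool (i = j) - of_bool (i = Suc j)"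
proof -
  define dir :: "edge \<Rightarrow> edge \<Rightarrow> int" where "dir p e = of_bool (e = p) - of_bool (e = prod.swap p)" for p e
  have dir: "dir (a, b) (p, q) = of_bool (p = a \<and> q = b) - of_bool (p = b \<and> q = a)" for a b p q
    by (simp add: dir_def)
  have lc: "loop_chain (loop j) (a, b) = (\<Sum>l<N j + 2. dir (a, b) (strand j l, strand j (Suc l))) -
      (\<Sum>l<N (Suc j) + 2. dir (a, b) (strand (Suc j) l, strand (Suc j) (Suc l)))" for a b
  proof -
    have "loop_chain (loop j) (a, b) = (\<Sum>e\<leftarrow>closed_edges (loop j). dir (a, b) e)"
      by (simp add: loop_chain_sum_list dir_def)
    also have "\<dots> = (\<Sum>l<N j + 2. dir (a, b) (strand j l, strand j (Suc l))) -
      (\<Sum>l<N (Suc j) + 2. dir (a, b) (strand (Suc j) l, strand (Suc j) (Suc l)))"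
      unfolding loop_def
    proof (rule sum_list_closed_edges_digon)
      show "dir (a, b) (q, p) = - dir (a, b) (p, q)" for p q
        unfolding dir by (cases "p = a"; cases "q = b"; cases "p = b"; cases "q = a") simp_all
    qed simp_all
    finally show ?thesis .
  qed
  have s: "(\<Sum>l<N k + 2. dir (a, b) (strand k l, strand k (Suc l))) =
      (if i = k \<and> a = L i 0 \<and> b = L i 1 then 1 else 0)"
    if ab: "(a = L i 0 \<and> (b = L i 1 \<or> b = R i 1)) \<or> (a = R i 0 \<and> b = R i 1)" for k a b
  proof -
    \<comment> \<open>A strand starts at the apex, so its edge from level 0 to level 1 has index
      1.\<close>
    have "dir (a, b) (strand k l, strand k (Suc l)) = (if l = 1 then if i = k \<and> a = L i 0 \<and> b = L i 1 then 1 else 0 else 0)"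
      if "l < N k + 2" for l
      using that by (cases rule: strand_cases) (use ab in \<open>auto simp: dir\<close>)
    hence "(\<Sum>l<N k + 2. dir (a, b) (strand k l, strand k (Suc l))) =
        (\<Sum>l<N k + 2. if l = 1 then if i = k \<and> a = L i 0 \<and> b = L i 1 then 1 else 0 else 0)"
      by (intro sum.cong) auto
    also have "\<dots> = (if i = k \<and> a = L i 0 \<and> b = L i 1 then 1 else 0)" by (subst sum.delta) auto
    finally show ?thesis .
  qed
  show ?thesis
    unfolding flow_def lc using s[of "L i 0" "L i 1"] s[of "L i 0" "R i 1"] s[of "R i 0" "R i 1"] by auto
qed

lemma homology_basis_T: "homology_basis T 2 loop"
  unfolding homology_basis_def
proof (intro conjI ballI allI impI)
  show "set (closed_edges (loop i)) \<subseteq> surface_edges T" if "i < 2" for i using loop_edges[OF that] .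
  fix z assume z: "z \<in> one_cycles T"
  let ?rest = "\<lambda>m :: nat \<Rightarrow> int. \<lambda>e. z e - (\<Sum>i<2. m i * loop_chain (loop i) e)"
  have rest: "?rest m = (\<lambda>e. z e - (m 0 * loop_chain (loop 0) e + m 1 * loop_chain (loop 1) e))" for m
    by (simp add: eval_nat_numeral)
  have flow_rest: "flow j 0 (?rest m) = flow j 0 z - (m 0 * flow j 0 (loop_chain (loop 0)) + m 1 * flow j 0 (loop_chain (loop 1)))" for j m
    unfolding rest by (simp add: flow_def algebra_simps)
  show "\<exists>!m :: nat \<Rightarrow> int. (\<forall>i\<ge>2. m i = 0) \<and> ?rest m \<in> one_boundaries T"
  proof (rule ex1I)
    \<comment> \<open>Band 0 is used by \<open>loop 0\<close> alone, upwards, and band 2 by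
      \<open>loop 1\<close> alone, downwards; hence the sign of the second coefficient.\<close>
    let ?m = "\<lambda>i :: nat. if i = 0 then flow 0 0 z else if i = 1 then - flow 2 0 z else 0"
    have cyc: "?rest m \<in> one_cycles T" for m
    proof -
      have c: "z \<in> one_cycles T" "loop_chain (loop 0) \<in> one_cycles T" "loop_chain (loop 1) \<in> one_cycles T"
        using z loop_chain_cycle by simp_all
      show ?thesis unfolding rest
      proof (unfold one_cycles_def, intro CollectI conjI allI impI)
        show "z (b, a) - (m 0 * loop_chain (loop 0) (b, a) + m 1 * loop_chain (loop 1) (b, a)) =
            - (z (a, b) - (m 0 * loop_chain (loop 0) (a, b) + m 1 * loop_chain (loop 1) (a, b)))" for a b
          unfolding cycle_anti[OF c(1), of b a] cycle_anti[OF c(2), of b a] cycle_anti[OF c(3), of b a]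
          by (simp add: algebra_simps)
        show "z e - (m 0 * loop_chain (loop 0) e + m 1 * loop_chain (loop 1) e) = 0" if "e \<notin> surface_edges T" for e
          using cycle_support[OF c(1) that] cycle_support[OF c(2) that] cycle_support[OF c(3) that] by simp
        have "(\<Sum>b\<in>vertices T. z (a, b)) = 0" "(\<Sum>b\<in>vertices T. loop_chain (loop 0) (a, b)) = 0"
          "(\<Sum>b\<in>vertices T. loop_chain (loop 1) (a, b)) = 0" for a
          using c unfolding one_cycles_def by blast+
        thus "(\<Sum>b\<in>vertices T. z (a, b) - (m 0 * loop_chain (loop 0) (a, b) + m 1 * loop_chain (loop 1) (a, b))) = 0" for a
          by (simp add: sum_subtractf sum.distrib sum_distrib_left[symmetric])
      qed
    qed
    have "flow 0 0 (?rest ?m) = 0" "flow 2 0 (?rest ?m) = 0" unfolding flow_rest by (simp_all add: flow_loop)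
    hence "?rest ?m \<in> one_boundaries T" by (rule zero_flow_boundary[OF cyc])
    thus "(\<forall>i\<ge>2. ?m i = 0) \<and> ?rest ?m \<in> one_boundaries T" by simp
    fix m :: "nat \<Rightarrow> int" assume m: "(\<forall>i\<ge>2. m i = 0) \<and> ?rest m \<in> one_boundaries T"
    then obtain x where "?rest m = chain_boundary T x" unfolding one_boundaries_eq by blast
    hence "flow 0 0 (?rest m) = 0" "flow 2 0 (?rest m) = 0"
      using flow_chain_boundary[of 0 0 x] flow_chain_boundary[of 2 0 x] by simp_all
    hence "m 0 = flow 0 0 z" "m 1 = - flow 2 0 z" unfolding flow_rest by (simp_all add: flow_loop)
    thus "m = ?m" using m by (intro ext) (auto simp: not_le less_Suc_eq numeral_2_eq_2)
  qed
qed

end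

section \<open>Seifert matrices and elementary ideals\<close>

definition mat22 :: "'a \<Rightarrow> 'a \<Rightarrow> 'a \<Rightarrow> 'a \<Rightarrow> 'a mat" where
  "mat22 a b c d = Matrix.mat 2 2 (\<lambda>(i, j). if i = 0 then if j = 0 then a else b else if j = 0 then c else d)"

lemma mat22_simps [simp]:
  "mat22 a b c d \<in> carrier_mat 2 2" "dim_row (mat22 a b c d) = 2" "dim_col (mat22 a b c d) = 2"
  "mat22 a b c d $$ (0, 0) = a" "mat22 a b c d $$ (0, Suc 0) = b"
  "mat22 a b c d $$ (Suc 0, 0) = c" "mat22 a b c d $$ (Suc 0, Suc 0) = d"
  by (simp_all add: mat22_def)

context pretzel
begin

lemma seifert_matrix_T:
  assumes "h 0 < 0" "h 1 > 0" "h 2 > 0"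
  shows "seifert_matrix (pretzel_knot (h 0) (h 1) (h 2)) 2
    (mat22 ((h 0 + h 1) div 2) (- ((h 1 - 1) div 2)) (- ((h 1 + 1) div 2)) ((h 1 + h 2) div 2))"
    (is "seifert_matrix _ _ ?A")
  unfolding seifert_matrix_def
proof (intro conjI exI)
  show "?A \<in> carrier_mat 2 2" by simp
  show "seifert_surface T (pretzel_knot (h 0) (h 1) (h 2))"
    using oriented_surface_T by (simp add: seifert_surface_def pretzel_knot_def T_def)
  show "positive_pushoff T nu" by (rule positive_pushoff_T)
  show "homology_basis T 2 loop" by (rule homology_basis_T)
  have odds: "odd (h 0)" "odd (h 1)" "odd (h 2)" using odd_h by blast+
  have sgs: "sg 0 = -1" "sg 1 = 1" "sg 2 = 1" using assms by (simp_all add: sg_def)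
  \<comment> \<open>Only band 0 is negative, so only its diagonal value contains the extra crossing
    in the top disk.\<close>
  have lnk: "strand_linking 0 0 = - ((1 - h 0) div 2) + 1" "strand_linking 1 1 = (h 1 + 1) div 2"
    "strand_linking 2 2 = (h 2 + 1) div 2" "strand_linking 0 1 = 1" "strand_linking 0 2 = 1" "strand_linking 1 2 = 1"
    "strand_linking 1 0 = 0" "strand_linking 2 0 = 0" "strand_linking 2 1 = 0"
    using assms by (simp_all add: strand_linking sgs[unfolded One_nat_def] add.commute)
  have "?A $$ (i, j) = strand_linking i j - strand_linking i (Suc j) - strand_linking (Suc i) j + strand_linking (Suc i) (Suc j)"
    if "i < 2" "j < 2" for i j
  proof -
    have "i = 0 \<or> i = 1" "j = 0 \<or> j = 1" using that by auto
    thus ?thesis using odds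
      by (elim disjE oddE) (simp_all add: lnk[unfolded One_nat_def numeral_2_eq_2] numeral_2_eq_2, presburger?)
  qed
  thus "\<forall>i<2. \<forall>j<2. has_linking_number (loop i) (map (\<lambda>v. v + nu v) (loop j)) (?A $$ (i, j))"
    using has_linking_number_loop by presburger
qed

end

text \<open>The case \<open>q = - p = 2 * s + 1\<close>; \<open>c\<close> stands for
  \<open>(q + r)/2\<close>, the entry through which \<open>r\<close> enters.\<close>

definition seifert_family :: "int \<Rightarrow> int \<Rightarrow> int mat" where
  "seifert_family s c = mat22 0 (- s) (- (s + 1)) c"

lemma pretzel_seifert_matrix:
  fixes s i :: int
  assumes "s > 0" "i \<ge> 0"
  shows "seifert_matrix (pretzel_knot (- (2 * s + 1)) (2 * s + 1) (2 * i + 1)) 2 (seifert_family s (s + i + 1))"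
proof -
  let ?h = "\<lambda>j :: nat. if j = 0 then - (2 * s + 1) else if j = 1 then 2 * s + 1 else 2 * i + 1"
  interpret pretzel ?h by standard auto
  show ?thesis using seifert_matrix_T assms by (simp add: seifert_family_def add_ac)
qed

section \<open>The Alexander matrix and its determinant\<close>

lemma det_2:
  fixes M :: "'a::comm_ring_1 mat"
  assumes "M \<in> carrier_mat 2 2"
  shows "Determinant.det M = M $$ (0, 0) * M $$ (1, 1) - M $$ (0, 1) * M $$ (1, 0)"
proof -
  have "Determinant.det M = (\<Sum>j<2. M $$ (0, j) * cofactor M 0 j)"
    using laplace_expansion_row[OF assms, of 0] by simp
  also have "\<dots> = M $$ (0, 0) * cofactor M 0 0 + M $$ (0, 1) * cofactor M 0 1" by (simp add: numeral_2_eq_2)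
  also have "\<dots> = M $$ (0, 0) * M $$ (1, 1) + M $$ (0, 1) * (- M $$ (1, 0))"
  proof -
    have 1: "Determinant.det (Matrix.mat (Suc 0) (Suc 0) f) = f (0, 0)" for f :: "nat \<times> nat \<Rightarrow> 'a"
      by (subst det_single) auto
    show ?thesis
      using carrier_matD[OF assms] by (simp add: cofactor_def mat_delete_def 1)
  qed
  finally show ?thesis by simp
qed

lemma alexander_matrix_entries:
  "alexander_matrix (seifert_family s c) \<in> carrier_mat 2 2"
  "alexander_matrix (seifert_family s c) $$ (0, 0) = 0"
  "alexander_matrix (seifert_family s c) $$ (0, 1) = Poly_Mapping.single 0 (s + 1) - Poly_Mapping.single 1 s"
  "alexander_matrix (seifert_family s c) $$ (1, 0) = Poly_Mapping.single 0 s - Poly_Mapping.single 1 (s + 1)"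
  "alexander_matrix (seifert_family s c) $$ (1, 1) = Poly_Mapping.single 1 c - Poly_Mapping.single 0 c"
proof -
  have neg: "Poly_Mapping.single n (- a) = - Poly_Mapping.single n a" for n a :: int
    by (simp add: single_uminus)
  have dims: "dim_row (seifert_family s c) = 2" "dim_col (seifert_family s c) = 2"
    by (simp_all add: seifert_family_def)
  show "alexander_matrix (seifert_family s c) \<in> carrier_mat 2 2"
    by (rule carrier_matI) (simp_all add: alexander_matrix_def dims)
  show "alexander_matrix (seifert_family s c) $$ (0, 0) = 0"
    "alexander_matrix (seifert_family s c) $$ (0, 1) = Poly_Mapping.single 0 (s + 1) - Poly_Mapping.single 1 s"
    "alexander_matrix (seifert_family s c) $$ (1, 0) = Poly_Mapping.single 0 s - Poly_Mapping.single 1 (s + 1)"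
    "alexander_matrix (seifert_family s c) $$ (1, 1) = Poly_Mapping.single 1 c - Poly_Mapping.single 0 c"
    unfolding alexander_matrix_def by (simp_all add: dims) (simp_all only: seifert_family_def mat22_simps neg, simp_all)
qed

lemma det_alexander_matrix:
  "Determinant.det (alexander_matrix (seifert_family s c)) =
    - (Poly_Mapping.single 2 (s * (s + 1)) - Poly_Mapping.single 1 (2 * s * (s + 1) + 1)
                + Poly_Mapping.single 0 (s * (s + 1)))"
proof -
  have "Determinant.det (alexander_matrix (seifert_family s c)) =
      - ((Poly_Mapping.single 0 (s + 1) - Poly_Mapping.single 1 s) * (Poly_Mapping.single 0 s - Poly_Mapping.single 1 (s + 1)))"
    unfolding det_2[OF alexander_matrix_entries(1)] alexander_matrix_entries by simp
  also have "\<dots> = - (Poly_Mapping.single 2 (s * (s + 1)) - (Poly_Mapping.single 1 ((s + 1) * (s + 1)) + Poly_Mapping.single 1 (s * s))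
      + Poly_Mapping.single 0 (s * (s + 1)))"
    by (simp add: algebra_simps mult_single)
  also have "Poly_Mapping.single (1::int) ((s + 1) * (s + 1)) + Poly_Mapping.single 1 (s * s) = Poly_Mapping.single 1 (2 * s * (s + 1) + 1)"
    unfolding single_add[symmetric] by (simp add: algebra_simps)
  finally show ?thesis .
qed

lemma pretzel_alexander_polynomial:
  fixes s i :: int
  assumes "s > 0" "i > s"
  shows "is_alexander_polynomial (pretzel_knot (-(2 * s + 1)) (2 * s + 1) (2 * i + 1))
              (Poly_Mapping.single 2 (s * (s + 1)) - Poly_Mapping.single 1 (2 * s * (s + 1) + 1)
                + Poly_Mapping.single 0 (s * (s + 1)))"
  unfolding is_alexander_polynomial_def
proof (intro exI conjI)
  show "seifert_matrix (pretzel_knot (-(2 * s + 1)) (2 * s + 1) (2 * i + 1)) 2 (seifert_family s (s + i + 1))"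
    using pretzel_seifert_matrix assms by simp
  \<comment> \<open>The determinant is minus the product of the off-diagonal entries, and the unit
    -1 compensates that sign.\<close>
  show "-1 \<in> {1, -1 :: int}" by simp
  have "Poly_Mapping.single (0::int) (-1::int) = - 1" by (simp add: single_uminus)
  thus "Poly_Mapping.single 2 (s * (s + 1)) - Poly_Mapping.single 1 (2 * s * (s + 1) + 1)
                + Poly_Mapping.single 0 (s * (s + 1)) =
      Poly_Mapping.single 0 (-1) * Determinant.det (alexander_matrix (seifert_family s (s + i + 1)))"
    unfolding det_alexander_matrix by simp
qed

section \<open>Minors and elementary ideals\<close>

lemma module_self: "Modules.module ((*) :: 'a::comm_ring_1 \<Rightarrow> 'a \<Rightarrow> 'a)"
  by standard (simp_all add: algebra_simps)

lemma card_1_subset_2: "J \<subseteq> {..<2::nat} \<Longrightarrow> card J = 1 \<Longrightarrow> J = {0} \<or> J = {1}"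
  by (auto simp: card_1_singleton_iff)

lemma minors_1:
  fixes M :: "'a::comm_ring_1 mat"
  assumes M: "M \<in> carrier_mat 2 2"
  shows "minors M 1 = {M $$ (0, 0), M $$ (0, 1), M $$ (1, 0), M $$ (1, 1)}"
proof -
  have d: "Determinant.det (submatrix M {i} {j}) = M $$ (i, j)" if ij: "i < 2" "j < 2" for i j
  proof -
    have r: "{a. a < dim_row M \<and> a \<in> {i}} = {i}" "{a. a < dim_col M \<and> a \<in> {j}} = {j}" using M ij by auto
    have p: "pick {a} 0 = a" for a by (simp add: pick.simps Least_equality)
    have c: "submatrix M {i} {j} \<in> carrier_mat 1 1"
      by (rule carrier_matI) (simp_all only: dim_submatrix r, simp_all)
    have "submatrix M {i} {j} $$ (0, 0) = M $$ (i, j)"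
      using submatrix_index[of 0 M "{i}" 0 "{j}"] unfolding r by (simp add: p del: pick.simps)
    thus ?thesis using det_single[OF c] by simp
  qed
  have "minors M 1 = {Determinant.det (submatrix M I J) | I J. I \<in> {{0}, {1}} \<and> J \<in> {{0}, {1}}}"
  proof -
    have *: "I \<in> {{0}, {1}} \<longleftrightarrow> I \<subseteq> {..<2} \<and> card I = 1" for I :: "nat set"
      using card_1_subset_2[of I] by auto
    have "I \<subseteq> {..<dim_row M} \<and> J \<subseteq> {..<dim_col M} \<and> card I = 1 \<and> card J = 1 \<longleftrightarrow>
        I \<in> {{0}, {1}} \<and> J \<in> {{0}, {1}}" for I J
      unfolding carrier_matD[OF M] * by argo
    thus ?thesis by (simp only: minors_def)
  qed
  also have "\<dots> = {Determinant.det (submatrix M {0} {0}), Determinant.det (submatrix M {0} {1}),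
      Determinant.det (submatrix M {1} {0}), Determinant.det (submatrix M {1} {1})}"
    by blast
  also have "\<dots> = {M $$ (0, 0), M $$ (0, 1), M $$ (1, 0), M $$ (1, 1)}"
    by (simp only: d zero_less_numeral one_less_numeral_iff semiring_norm)
  finally show ?thesis .
qed

text \<open>\<open>pick\<close> enumerates the full index set in increasing order, so the submatrix
  of full size is the matrix itself.\<close>

lemma minors_2:
  fixes M :: "'a::comm_ring_1 mat"
  assumes M: "M \<in> carrier_mat 2 2"
  shows "minors M 2 = {Determinant.det M}"
proof -
  have full: "I = {..<2}" if "I \<subseteq> {..<2::nat}" "card I = 2" for I
    using that by (intro card_subset_eq) auto
  have d: "{i. i < 2 \<and> i \<in> {..<2::nat}} = {..<2}" by auto
  have p0: "pick {..<2} 0 = 0" by (simp add: pick.simps Least_equality)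
  have p1: "pick {..<2} 1 = 1" unfolding One_nat_def pick.simps p0 by (rule Least_equality) auto
  have "submatrix M {..<2} {..<2} = M"
  proof (rule eq_matI)
    show "dim_row (submatrix M {..<2} {..<2}) = dim_row M" "dim_col (submatrix M {..<2} {..<2}) = dim_col M"
      using M by (auto simp: dim_submatrix d)
    fix i j assume "i < dim_row M" "j < dim_col M"
    hence ij: "i < 2" "j < 2" using M by auto
    have "pick {..<2} k = k" if "k < 2" for k
      using that p0 p1 by (auto simp: less_2_cases_iff)
    thus "submatrix M {..<2} {..<2} $$ (i, j) = M $$ (i, j)"
      using submatrix_index[of i M "{..<2}" j "{..<2}"] ij M by (simp add: d)
  qed
  moreover have "I \<subseteq> {..<dim_row M} \<and> J \<subseteq> {..<dim_col M} \<and> card I = 2 \<and> card J = 2 \<longleftrightarrow>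
      I = {..<2} \<and> J = {..<2}" for I J
    unfolding carrier_matD[OF M] using full[of I] full[of J] by auto
  ultimately show ?thesis by (simp add: minors_def)
qed

lemma ideal_generated_eqI:
  fixes X Y :: "'a::comm_ring_1 set"
  assumes "X \<subseteq> ideal_generated Y" "Y \<subseteq> ideal_generated X"
  shows "ideal_generated X = ideal_generated Y"
proof -
  interpret M: Modules.module "(*) :: 'a \<Rightarrow> 'a \<Rightarrow> 'a" by (rule module_self)
  show ?thesis using assms unfolding ideal_generated_def by (meson M.span_eq)
qed

lemma single_int_mult: "Poly_Mapping.single n (a * b :: int) = of_int a * Poly_Mapping.single n b"
  for n :: int
proof -
  have "(of_int a :: laurent) = Poly_Mapping.single 0 (of_int a :: int)"
    by (rule single_of_int[symmetric])
  thus ?thesis by (simp add: mult_single)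
qed

text \<open>The sum of the off-diagonal entries is \<open>- (2 s + 1) (t - 1)\<close>, which divides the diagonal entry.\<close>

lemma ideal_entries:
  "ideal_generated (minors (alexander_matrix (seifert_family s (k * (2 * s + 1)))) 1) =
    ideal_generated {Poly_Mapping.single 0 (s + 1) - Poly_Mapping.single 1 s, Poly_Mapping.single 0 s - Poly_Mapping.single 1 (s + 1)}"
    (is "_ = ideal_generated {?f, ?g}")
proof (rule ideal_generated_eqI)
  interpret M: Modules.module "(*) :: laurent \<Rightarrow> laurent \<Rightarrow> laurent" by (rule module_self)
  have e: "minors (alexander_matrix (seifert_family s (k * (2 * s + 1)))) 1 =
      {0, ?f, ?g, Poly_Mapping.single 1 (k * (2 * s + 1)) - Poly_Mapping.single 0 (k * (2 * s + 1))}"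
    unfolding minors_1[OF alexander_matrix_entries(1)] alexander_matrix_entries ..
  show "{?f, ?g} \<subseteq> ideal_generated (minors (alexander_matrix (seifert_family s (k * (2 * s + 1)))) 1)"
    unfolding e ideal_generated_def by (auto intro: M.span_base)
  have "Poly_Mapping.single 1 (2 * s + 1) - Poly_Mapping.single 0 (2 * s + 1) = - (?f + ?g)"
  proof -
    have "Poly_Mapping.single n (2 * s + 1) = Poly_Mapping.single n (s + 1) + Poly_Mapping.single n s" for n :: int
      unfolding single_add[symmetric] by simp
    thus ?thesis by simp
  qed
  hence "Poly_Mapping.single 1 (k * (2 * s + 1)) - Poly_Mapping.single 0 (k * (2 * s + 1)) = of_int k * - (?f + ?g)"
    unfolding single_int_mult right_diff_distrib[symmetric] by (rule arg_cong)
  hence "Poly_Mapping.single 1 (k * (2 * s + 1)) - Poly_Mapping.single 0 (k * (2 * s + 1)) = of_int (- k) * (?f + ?g)"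
    by (simp only: of_int_minus mult_minus_left mult_minus_right)
  moreover have "of_int (- k) * (?f + ?g) \<in> M.span {?f, ?g}"
    by (intro M.span_scale M.span_add M.span_base) auto
  ultimately show "minors (alexander_matrix (seifert_family s (k * (2 * s + 1)))) 1 \<subseteq> ideal_generated {?f, ?g}"
    unfolding e ideal_generated_def by (auto intro: M.span_base M.span_zero)
qed

text \<open>The matrix for \<open>k = 1\<close> is the common reference: the determinant settles
  \<open>r = 1\<close>, the off-diagonal entries settle \<open>r = 2\<close>, and beyond that the
  ideal is the whole ring.\<close>

lemma elementary_ideal_family:
  assumes "r \<ge> 1"
  shows "elementary_ideal (alexander_matrix (seifert_family s (k * (2 * s + 1)))) r =
    elementary_ideal (alexander_matrix (seifert_family s (2 * s + 1))) r"
proof -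
  have dim: "dim_row (alexander_matrix (seifert_family s c)) = 2" for c
    using alexander_matrix_entries(1) by (rule carrier_matD)
  consider "r = 1" | "r = 2" | "r > 2" using assms by linarith
  thus ?thesis
  proof cases
    case 1
    thus ?thesis
      by (simp add: elementary_ideal_def dim det_alexander_matrix
        minors_2[OF alexander_matrix_entries(1), unfolded numeral_2_eq_2])
  next
    case 2
    thus ?thesis using ideal_entries[of s k] ideal_entries[of s 1] by (simp add: elementary_ideal_def dim)
  next
    case 3
    thus ?thesis by (simp add: elementary_ideal_def dim)
  qed
qed

lemma pretzel_elementary_ideals:
  fixes s k :: int
  assumes "s > 0" "k > 0"
  shows "has_elementary_ideals (pretzel_knot (-(2 * s + 1)) (2 * s + 1) (2 * ((2 * k - 1) * s + k - 1) + 1))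
    (elementary_ideal (alexander_matrix (seifert_family s (2 * s + 1))))"
  unfolding has_elementary_ideals_def
proof (intro exI conjI allI impI)
  have "(2 * k - 1) * s \<ge> 0" using assms by (intro mult_nonneg_nonneg) auto
  hence nonneg: "(2 * k - 1) * s + k - 1 \<ge> 0" using assms by linarith
  \<comment> \<open>The equation behind the choice of the indices: it makes the last entry of the
    Seifert matrix \<open>k\<close> times \<open>2 * s + 1\<close>.\<close>
  have eq: "s + ((2 * k - 1) * s + k - 1) + 1 = k * (2 * s + 1)" by (simp add: algebra_simps)
  show "seifert_matrix (pretzel_knot (-(2 * s + 1)) (2 * s + 1) (2 * ((2 * k - 1) * s + k - 1) + 1)) 2
      (seifert_family s (k * (2 * s + 1)))"
    using pretzel_seifert_matrix[OF assms(1) nonneg] unfolding eq .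
  show "elementary_ideal (alexander_matrix (seifert_family s (2 * s + 1))) r =
      elementary_ideal (alexander_matrix (seifert_family s (k * (2 * s + 1)))) r" if "r \<ge> 1" for r
    using elementary_ideal_family[OF that] by simp
qed

theorem theorem4p1:
  fixes s :: int
  assumes "s > 0"
  shows "(\<forall>i::int. i > s \<longrightarrow>
            is_alexander_polynomial (pretzel_knot (-(2 * s + 1)) (2 * s + 1) (2 * i + 1))
              (Poly_Mapping.single 2 (s * (s + 1)) - Poly_Mapping.single 1 (2 * s * (s + 1) + 1)
                + Poly_Mapping.single 0 (s * (s + 1)))) \<and>
         (\<exists>I. \<forall>k::int. k > 0 \<longrightarrow>
            has_elementary_ideals
              (pretzel_knot (-(2 * s + 1)) (2 * s + 1) (2 * ((2 * k - 1) * s + k - 1) + 1)) I)"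
  using pretzel_alexander_polynomial[OF assms] pretzel_elementary_ideals[OF assms] by blast

end
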